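(* Let $F=F(x,y)$ be a projectively flat Finsler metric on an open connected domain $\mathcal U\subset\mathbb R^n$ ($n\geq 2$) of weakly isotropic flag curvature $$\mathbf K=\frac{3\theta}{F}+\sigma,$$ where $\theta=\theta_i(x)y^i\neq0$ is a ($\text{not identically zero}$) $1$-form and $\sigma=\sigma(x)$ is a scalar function. Then $F$ is a Randers metric.
   Context: A Finsler metric on a manifold $M$ is a function $F=F(x,y)$ on $TM$, $C^\infty$ on $TM\setminus\{0\}$, with $F\ge 0$ and $F(x,y)=0$ iff $y=0$, $F(x,\lambda y)=\lambda F(x,y)$ for $\lambda\ge 0$, and with $g_{ij}=\frac12 [F^2]_{y^iy^j}$ positive definite for $y\ne0$. Geodesic coefficients: $G^i=\frac14 g^{il}\{[F^2]_{x^my^l}y^m-[F^2]_{x^l}\}$. A Finsler metric on an open domain $\mathcal U\subset\mathbb R^n$ is projectively flat if all its geodesics are straight lines; equivalently $G^i=Py^i$ with $P=F_{x^k}y^k/(2F)$ (the projective factor), equivalently $F_{x^ly^k}=F_{x^ky^l}$. Such a metric is of scalar flag curvature, with flag curvature $\mathbf K=\mathbf K(x,y)=\big(P^2-\frac{\partial P}{\partial x^m}y^m\big)/F^2$. A Randers metric is a Finsler metric $F=\alpha+\beta$ with $\alpha=\sqrt{a_{ij}(x)y^iy^j}$ a Riemannian metric and $\beta=b_i(x)y^i$ a $1$-form with $\|\beta\|_\alpha<1$ at every point (the case $\beta=0$ is allowed). *)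

theory Defs
  imports "HOL-Analysis.Analysis"
begin

text \<open>Smoothness is only used on open sets, so derivatives are taken at \<open>x\<close>, not within \<open>S\<close>.\<close>

primrec Ck_on :: "nat \<Rightarrow> 'a::real_normed_vector set \<Rightarrow> ('a \<Rightarrow> 'b::real_normed_vector) \<Rightarrow> bool" where
  "Ck_on 0 S f \<longleftrightarrow> continuous_on S f"
| "Ck_on (Suc k) S f \<longleftrightarrow>
     (\<forall>x\<in>S. f differentiable (at x)) \<and> (\<forall>v. Ck_on k S (\<lambda>x. frechet_derivative f (at x) v))"

definition smooth_on :: "'a::real_normed_vector set \<Rightarrow> ('a \<Rightarrow> 'b::real_normed_vector) \<Rightarrow> bool" where
  "smooth_on S f \<longleftrightarrow> (\<forall>k. Ck_on k S f)"

text \<open>The tangent bundle of \<open>U\<close> is \<open>U \<times> \<real>\<^sup>n\<close>. Functions on it are written in curried form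
  \<open>H x y\<close>; \<open>dx k H\<close> and \<open>dy k H\<close> are the partial derivatives of \<open>H\<close> with respect to
  the base coordinate \<open>x\<^sup>k\<close> and the fibre coordinate \<open>y\<^sup>k\<close>.\<close>

definition dx :: "'n \<Rightarrow> (real^'n \<Rightarrow> real^'n \<Rightarrow> real) \<Rightarrow> real^'n \<Rightarrow> real^'n \<Rightarrow> real" where
  "dx k H x y = frechet_derivative (\<lambda>z. H z y) (at x) (axis k 1)"

definition dy :: "'n \<Rightarrow> (real^'n \<Rightarrow> real^'n \<Rightarrow> real) \<Rightarrow> real^'n \<Rightarrow> real^'n \<Rightarrow> real" where
  "dy k H x y = frechet_derivative (\<lambda>w. H x w) (at y) (axis k 1)"

definition pos_def :: "real^'n^'n \<Rightarrow> bool" where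
  "pos_def A \<longleftrightarrow> transpose A = A \<and> (\<forall>v. v \<noteq> 0 \<longrightarrow> v \<bullet> (A *v v) > 0)"

definition fund_tensor :: "(real^'n \<Rightarrow> real^'n \<Rightarrow> real) \<Rightarrow> real^'n \<Rightarrow> real^'n \<Rightarrow> real^'n^'n" where
  "fund_tensor F x y = (\<chi> i j. 1/2 * dy j (dy i (\<lambda>x y. (F x y)^2)) x y)"

definition finsler_metric :: "(real^'n) set \<Rightarrow> (real^'n \<Rightarrow> real^'n \<Rightarrow> real) \<Rightarrow> bool" where
  "finsler_metric U F \<longleftrightarrow>
     smooth_on (U \<times> (- {0})) (\<lambda>(x, y). F x y) \<and>
     (\<forall>x\<in>U. \<forall>y. F x y \<ge> 0 \<and> (F x y = 0 \<longleftrightarrow> y = 0)) \<and>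
     (\<forall>x\<in>U. \<forall>y. \<forall>l\<ge>0. F x (l *\<^sub>R y) = l * F x y) \<and>
     (\<forall>x\<in>U. \<forall>y. y \<noteq> 0 \<longrightarrow> pos_def (fund_tensor F x y))"

definition geod_coeff ::
    "(real^'n \<Rightarrow> real^'n \<Rightarrow> real) \<Rightarrow> 'n \<Rightarrow> real^'n \<Rightarrow> real^'n \<Rightarrow> real" where
  "geod_coeff F i x y =
     1/4 * (\<Sum>l\<in>UNIV. matrix_inv (fund_tensor F x y) $ i $ l *
        ((\<Sum>m\<in>UNIV. dy l (dx m (\<lambda>x y. (F x y)^2)) x y * y $ m)
          - dx l (\<lambda>x y. (F x y)^2) x y))"

text \<open>Geodesics are the non-constant solutions, on an open interval, of
  \<open>c'' + 2 G(c, c') = 0\<close>; a solution with \<open>c' \<noteq> 0\<close> has constant positive speed \<open>F(c, c')\<close>.\<close>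

definition geodesic_on ::
    "(real^'n) set \<Rightarrow> (real^'n \<Rightarrow> real^'n \<Rightarrow> real) \<Rightarrow> real set \<Rightarrow> (real \<Rightarrow> real^'n) \<Rightarrow> bool" where
  "geodesic_on U F I c \<longleftrightarrow>
     open I \<and> is_interval I \<and>
     (\<exists>v. \<forall>t\<in>I. c t \<in> U \<and> v t \<noteq> 0 \<and>
        (c has_vector_derivative v t) (at t) \<and>
        (v has_vector_derivative (\<chi> i. - 2 * geod_coeff F i (c t) (v t))) (at t))"

definition projectively_flat :: "(real^'n) set \<Rightarrow> (real^'n \<Rightarrow> real^'n \<Rightarrow> real) \<Rightarrow> bool" where
  "projectively_flat U F \<longleftrightarrow> (\<forall>I c. geodesic_on U F I c \<longrightarrow> collinear (c ` I))"

text \<open>The Riemann curvature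
  \<open>R\<^sup>i\<^sub>k = 2 \<partial>G\<^sup>i/\<partial>x\<^sup>k - y\<^sup>j \<partial>\<^sup>2G\<^sup>i/\<partial>x\<^sup>j\<partial>y\<^sup>k + 2 G\<^sup>j \<partial>\<^sup>2G\<^sup>i/\<partial>y\<^sup>j\<partial>y\<^sup>k
    - \<partial>G\<^sup>i/\<partial>y\<^sup>j \<partial>G\<^sup>j/\<partial>y\<^sup>k\<close>, and the flag curvature of the flag with pole \<open>y\<close> spanned by
  \<open>y\<close> and \<open>u\<close>.  If \<open>G\<^sup>i = P y\<^sup>i\<close>, then the latter does not depend on \<open>u\<close> and equals
  \<open>(P\<^sup>2 - \<partial>P/\<partial>x\<^sup>m y\<^sup>m) / F\<^sup>2\<close>.\<close>

definition riemann_curv ::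
    "(real^'n \<Rightarrow> real^'n \<Rightarrow> real) \<Rightarrow> real^'n \<Rightarrow> real^'n \<Rightarrow> real^'n^'n" where
  "riemann_curv F x y = (\<chi> i k.
     2 * dx k (geod_coeff F i) x y
     - (\<Sum>j\<in>UNIV. y $ j * dy k (dx j (geod_coeff F i)) x y)
     + 2 * (\<Sum>j\<in>UNIV. geod_coeff F j x y * dy k (dy j (geod_coeff F i)) x y)
     - (\<Sum>j\<in>UNIV. dy j (geod_coeff F i) x y * dy k (geod_coeff F j) x y))"

definition flag_curv ::
    "(real^'n \<Rightarrow> real^'n \<Rightarrow> real) \<Rightarrow> real^'n \<Rightarrow> real^'n \<Rightarrow> real^'n \<Rightarrow> real" where
  "flag_curv F x y u =
     (let g = (\<lambda>v w. v \<bullet> (fund_tensor F x y *v w)) in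
        g (riemann_curv F x y *v u) u / (g y y * g u u - (g y u)^2))"

text \<open>A 1-form \<open>\<theta> = \<theta>\<^sub>i(x) y\<^sup>i\<close> is given by its smooth coefficient vector \<open>\<theta> x\<close>, so that
  its value on \<open>y\<close> is \<open>\<theta> x \<bullet> y\<close>.\<close>

definition weakly_isotropic_flag_curv ::
    "(real^'n) set \<Rightarrow> (real^'n \<Rightarrow> real^'n \<Rightarrow> real) \<Rightarrow> (real^'n \<Rightarrow> real^'n) \<Rightarrow> (real^'n \<Rightarrow> real) \<Rightarrow> bool" where
  "weakly_isotropic_flag_curv U F \<theta> \<sigma> \<longleftrightarrow>
     (\<forall>x\<in>U. \<forall>y. y \<noteq> 0 \<longrightarrow> (\<forall>u. u \<notin> span {y} \<longrightarrow>
        flag_curv F x y u = 3 * (\<theta> x \<bullet> y) / F x y + \<sigma> x))"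

text \<open>Below, \<open>\<parallel>\<beta>\<parallel>\<^sub>\<alpha>\<^sup>2 = a\<^sup>i\<^sup>j b\<^sub>i b\<^sub>j\<close>.\<close>

definition randers_metric :: "(real^'n) set \<Rightarrow> (real^'n \<Rightarrow> real^'n \<Rightarrow> real) \<Rightarrow> bool" where
  "randers_metric U F \<longleftrightarrow> finsler_metric U F \<and>
     (\<exists>(a :: real^'n \<Rightarrow> real^'n^'n) (b :: real^'n \<Rightarrow> real^'n).
        smooth_on U a \<and> smooth_on U b \<and>
        (\<forall>x\<in>U. pos_def (a x) \<and>
           sqrt (b x \<bullet> (matrix_inv (a x) *v b x)) < 1 \<and>
           (\<forall>y. F x y = sqrt (y \<bullet> (a x *v y)) + b x \<bullet> y)))"

end

theory Submission
  imports Defs "HOL-Computational_Algebra.Polynomial_Factorial" "HOL-Computational_Algebra.Field_as_Ring"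
begin

text \<open>
  Projective flatness means \<open>G\<^sup>i = P y\<^sup>i\<close>, whence Hamel's equation \<open>F\<^bsub>x\<^sup>k\<^esub> = (P F)\<^bsub>y\<^sup>k\<^esub>\<close>. Together with the
  curvature hypothesis, equality of the mixed \<open>x\<close>-derivatives of \<open>P\<close> forces \<open>\<theta>\<close> to be closed and gives a first
  integral \<open>2 \<theta> P = D\<theta> + D\<sigma> F + \<tau>(x) F\<^sup>2\<close>, where \<open>D = y\<^sup>k \<partial>/\<partial>x\<^sup>k\<close>. The functions \<open>g = - F(x, - y)\<close>,
  \<open>q = - P(x, - y)\<close> satisfy the same equations as \<open>F\<close>, \<open>P\<close>.

  Suppose \<open>\<theta>\<close> and \<open>\<tau>\<close> do not vanish at \<open>x\<close>. On a line \<open>y = z + t w\<close> with \<open>\<theta>(z) = 0\<close>, the \<open>D\<close>-derivatives of the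
  first integral provide polynomials over \<open>\<real>[t]\<close> with roots \<open>F\<close> and \<open>g\<close>. Their common divisor of least degree is
  quadratic, as its specialization at \<open>t = 0\<close> divides \<open>D\<theta> + D\<sigma> T + \<tau> T\<^sup>2\<close>. Hence \<open>F + g\<close> is linear and \<open>F g\<close>
  is quadratic in \<open>y\<close>, which means that \<open>F(x, \<cdot>)\<close> is a Randers norm.

  It remains to see that such \<open>x\<close> are dense, since the condition is closed. Where \<open>\<theta> \<noteq> 0\<close>, the quotient
  \<open>h = (P - q) / (F - g)\<close> depends on \<open>x\<close> only, and \<open>dh = \<theta>\<close>, \<open>\<tau> = h (h\<^sup>2 + \<sigma>)\<close>; so \<open>\<tau>\<close> does not vanish on an
  open set there. Moreover \<open>(\<theta>, \<tau>)\<close> solves a linear system of differential equations along straight lines,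
  so its zero set is open and closed.
\<close>

section \<open>Directional derivatives of smooth functions\<close>

text \<open>A priori the relations make F algebraic of degree up to four over the polynomials in t.
  Since D F = 2 F P, multiplying a D-derivative by \<theta> and replacing 2 \<theta> P by the first
  integral turns D into an operation on polynomials in T. Where \<theta>(y) = 0, what is left of it
  is T X d/dT with X = D\<theta> + D\<sigma> T + \<tau> T^2. There the quartic factors as X Y with Y
  = 3 \<tau> T^2 + D\<sigma> T - 3 D\<theta>, and two applications of this derivation remove Y even
  if it has a double root; the signs F > 0 > g keep X and Y coprime. The leading coefficient 3
  \<tau>^2 of the quartic does not depend on t. Therefore the degree of the common divisor does not
  drop at t = 0, and its symmetric functions are polynomials in t, not just rational functions. The
  reversed metric is there because one root of a quadratic does not determine the
  coefficients.\<close>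

definition dd :: "('a::real_normed_vector \<Rightarrow> 'b::real_normed_vector) \<Rightarrow> 'a \<Rightarrow> 'a \<Rightarrow> 'b" where
  "dd f v z = frechet_derivative f (at z) v"

lemma dd_eqI: "(f has_derivative f') (at z) \<Longrightarrow> dd f v z = f' v"
  by (metis dd_def frechet_derivative_at)

lemma Ck_on_Suc: "Ck_on (Suc k) S f \<longleftrightarrow> (\<forall>x\<in>S. f differentiable (at x)) \<and> (\<forall>v. Ck_on k S (dd f v))"
  by (simp add: Ck_on.simps(2) dd_def[abs_def])

declare Ck_on.simps(2) [simp del]

text \<open>Derivatives at a point of an open set see only values in that set. Openness makes
  \<open>Ck_on\<close>, whose derivatives are taken at the point and not within \<open>S\<close>, a
  property of the restriction to \<open>S\<close>.\<close>

lemma Ck_on_cong: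
  fixes f g :: "'a::real_normed_vector \<Rightarrow> 'b::real_normed_vector"
  assumes "open S" "\<And>x. x \<in> S \<Longrightarrow> f x = g x"
  shows "Ck_on k S f \<longleftrightarrow> Ck_on k S g"
  using assms(2)
proof (induction k arbitrary: f g)
  case 0
  then show ?case by (auto intro!: continuous_on_cong)
next
  case (Suc k)
  have imp: "Ck_on (Suc k) S g" if "Ck_on (Suc k) S f" "\<And>x. x \<in> S \<Longrightarrow> f x = g x" for f g :: "'a \<Rightarrow> 'b"
  proof -
    have d: "(g has_derivative frechet_derivative f (at x)) (at x)" if "x \<in> S" for x
      using has_derivative_transform_within_open[OF _ assms(1) that, of f "frechet_derivative f (at x)" UNIV g]
        \<open>Ck_on (Suc k) S f\<close> that \<open>\<And>x. x \<in> S \<Longrightarrow> f x = g x\<close>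
      by (auto simp: Ck_on_Suc frechet_derivative_works)
    have "dd g v x = dd f v x" if "x \<in> S" for v x
      using dd_eqI[OF d[OF that]] by (simp add: dd_def)
    then have "Ck_on k S (dd g v)" for v
      using Suc.IH[of "dd g v" "dd f v"] \<open>Ck_on (Suc k) S f\<close> by (auto simp: Ck_on_Suc)
    then show ?thesis
      using d by (auto simp: Ck_on_Suc differentiable_def)
  qed
  show ?case
    using imp[of f g] imp[of g f] Suc.prems by metis
qed

lemma Ck_on_SucD: "Ck_on (Suc k) S f \<Longrightarrow> Ck_on k S f"
proof (induction k arbitrary: f)
  case 0
  then show ?case
    by (auto simp: Ck_on_Suc intro!: continuous_at_imp_continuous_on differentiable_imp_continuous_within)
next
  case (Suc k)
  then show ?case by (auto simp: Ck_on_Suc[of "Suc k"] Ck_on_Suc[of k])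
qed

lemma Ck_on_differentiable: "Ck_on (Suc k) S f \<Longrightarrow> x \<in> S \<Longrightarrow> (f has_derivative (\<lambda>v. dd f v x)) (at x)"
  by (auto simp: Ck_on_Suc dd_def[abs_def] frechet_derivative_works[symmetric])

lemma Ck_on_SucI:
  assumes "open S" "\<And>x. x \<in> S \<Longrightarrow> (f has_derivative (\<lambda>v. f' v x)) (at x)"
    and "\<And>v. Ck_on k S (f' v)"
  shows "Ck_on (Suc k) S f"
proof -
  have "dd f v x = f' v x" if "x \<in> S" for v x
    using dd_eqI[OF assms(2)[OF that]] .
  then have "Ck_on k S (dd f v)" for v
    using assms(3) Ck_on_cong[OF assms(1), of "dd f v" "f' v"] by blast
  then show ?thesis
    using assms(2) by (auto simp: Ck_on_Suc differentiable_def)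
qed

lemma Ck_on_const: "Ck_on k S (\<lambda>x. c)"
proof (induction k arbitrary: c)
  case (Suc k c)
  have "dd (\<lambda>x::'a. c) v = (\<lambda>x. 0)" for v
    by (auto simp: dd_def)
  then show ?case using Suc by (auto simp: Ck_on_Suc)
qed simp

lemma Ck_on_linear:
  assumes "bounded_linear f"
  shows "Ck_on k S f"
proof (cases k)
  case 0
  then show ?thesis
    by (simp add: assms linear_continuous_on)
next
  case (Suc m)
  have d: "(f has_derivative f) (at x)" for x
    by (simp add: assms bounded_linear_imp_has_derivative)
  then have "dd f v = (\<lambda>x. f v)" for v
    using dd_eqI by blast
  then show ?thesis
    using d by (auto simp: Ck_on_Suc Suc differentiable_def Ck_on_const)
qed

lemma Ck_on_add:
  assumes "open S"
  shows "Ck_on k S f \<Longrightarrow> Ck_on k S g \<Longrightarrow> Ck_on k S (\<lambda>x. f x + g x)"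
proof (induction k arbitrary: f g)
  case 0
  then show ?case by (simp add: continuous_on_add)
next
  case (Suc k)
  show ?case
    by (rule Ck_on_SucI[OF assms, where f'="\<lambda>v x. dd f v x + dd g v x"])
      (use Suc in \<open>auto intro!: has_derivative_add Ck_on_differentiable Suc.IH simp: Ck_on_Suc\<close>)
qed

lemma Ck_on_bounded_bilinear:
  assumes "open S" "bounded_bilinear pr"
  shows "Ck_on k S f \<Longrightarrow> Ck_on k S g \<Longrightarrow> Ck_on k S (\<lambda>x. pr (f x) (g x))"
proof (induction k arbitrary: f g)
  case 0
  then show ?case
    by (simp add: bounded_bilinear.continuous_on[OF assms(2)])
next
  case (Suc k)
  show ?case
  proof (rule Ck_on_SucI[OF assms(1), where f'="\<lambda>v x. pr (f x) (dd g v x) + pr (dd f v x) (g x)"])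
    fix x assume "x \<in> S"
    show "((\<lambda>x. pr (f x) (g x)) has_derivative (\<lambda>v. pr (f x) (dd g v x) + pr (dd f v x) (g x))) (at x)"
      by (rule bounded_bilinear.FDERIV[OF assms(2)]) (rule Ck_on_differentiable[OF Suc.prems(1) \<open>x \<in> S\<close>] Ck_on_differentiable[OF Suc.prems(2) \<open>x \<in> S\<close>])+
  next
    fix v
    show "Ck_on k S (\<lambda>x. pr (f x) (dd g v x) + pr (dd f v x) (g x))"
      using Suc.prems[THEN Ck_on_SucD] Suc.prems[unfolded Ck_on_Suc] by (intro Ck_on_add[OF assms(1)] Suc.IH) auto
  qed
qed

lemma Ck_on_inverse:
  fixes f :: "'a::real_normed_vector \<Rightarrow> real"
  assumes "open S" "\<And>x. x \<in> S \<Longrightarrow> f x \<noteq> 0"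
  shows "Ck_on k S f \<Longrightarrow> Ck_on k S (\<lambda>x. inverse (f x))"
proof (induction k)
  case 0
  then show ?case using assms by (simp add: continuous_on_inverse)
next
  case (Suc k)
  show ?case
  proof (rule Ck_on_SucI[OF assms(1), where f'="\<lambda>v x. -1 * ((inverse (f x) * dd f v x) * inverse (f x))"])
    fix x assume "x \<in> S"
    show "((\<lambda>x. inverse (f x)) has_derivative (\<lambda>v. -1 * ((inverse (f x) * dd f v x) * inverse (f x)))) (at x)"
      using Deriv.has_derivative_inverse[OF assms(2)[OF \<open>x \<in> S\<close>] Ck_on_differentiable[OF Suc.prems \<open>x \<in> S\<close>]] by simp
  next
    fix v
    have "Ck_on k S (\<lambda>x. inverse (f x))" "Ck_on k S (dd f v)"
      using Suc Ck_on_SucD by (auto simp: Ck_on_Suc)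
    then show "Ck_on k S (\<lambda>x. -1 * ((inverse (f x) * dd f v x) * inverse (f x)))"
      by (intro Ck_on_bounded_bilinear[OF assms(1) bounded_bilinear_mult] Ck_on_const)
  qed
qed

text \<open>For an affine inner map the derivative in direction \<open>v\<close> is
  \<open>dd f (L v)\<close> composed with the same map, so the induction hypothesis applies
  directly. This covers the projection to the base, sections with fixed \<open>y\<close>, and the
  reflection of the fibre.\<close>

lemma Ck_on_compose_affine:
  assumes "open S" "open T" "bounded_linear L" "\<And>x. x \<in> S \<Longrightarrow> c + L x \<in> T"
  shows "Ck_on k T f \<Longrightarrow> Ck_on k S (\<lambda>x. f (c + L x))"
proof (induction k arbitrary: f)
  case 0
  have "continuous_on S (\<lambda>x. c + L x)"
    by (intro continuous_intros linear_continuous_on assms)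
  then show ?case
    using 0 assms(4) by (auto intro!: continuous_on_compose2[of T f])
next
  case (Suc k)
  show ?case
  proof (rule Ck_on_SucI[OF assms(1), where f'="\<lambda>v x. dd f (L v) (c + L x)"])
    fix x assume "x \<in> S"
    have "((\<lambda>x. c + L x) has_derivative L) (at x)"
      using has_derivative_add[OF has_derivative_const bounded_linear_imp_has_derivative[OF assms(3)]] by simp
    then show "((\<lambda>x. f (c + L x)) has_derivative (\<lambda>v. dd f (L v) (c + L x))) (at x)"
      by (rule has_derivative_compose) (rule Ck_on_differentiable[OF Suc.prems assms(4)[OF \<open>x \<in> S\<close>]])
  next
    fix v
    show "Ck_on k S (\<lambda>x. dd f (L v) (c + L x))"
      using Suc by (auto simp: Ck_on_Suc)
  qed
qed

lemma Ck_on_linear_compose: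
  assumes "open S" "bounded_linear A"
  shows "Ck_on k S f \<Longrightarrow> Ck_on k S (\<lambda>x. A (f x))"
proof (induction k arbitrary: f)
  case 0
  then show ?case using bounded_linear.continuous_on[OF assms(2)] by simp
next
  case (Suc k)
  show ?case
    by (rule Ck_on_SucI[OF assms(1), where f'="\<lambda>v x. A (dd f v x)"])
      (use Suc in \<open>auto intro!: bounded_linear.has_derivative[OF assms(2)] Ck_on_differentiable[OF Suc.prems] Suc.IH simp: Ck_on_Suc[of k S f]\<close>)
qed

lemma smooth_on_dd: "smooth_on S f \<Longrightarrow> smooth_on S (dd f v)"
  unfolding smooth_on_def using Ck_on_Suc by blast

lemma smooth_on_has_derivative: "smooth_on S f \<Longrightarrow> x \<in> S \<Longrightarrow> (f has_derivative (\<lambda>v. dd f v x)) (at x)"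
  unfolding smooth_on_def using Ck_on_differentiable by blast

lemma smooth_on_continuous: "smooth_on S f \<Longrightarrow> continuous_on S f"
  unfolding smooth_on_def by (metis Ck_on.simps(1))

lemma smooth_on_cong:
  "open S \<Longrightarrow> (\<And>x. x \<in> S \<Longrightarrow> f x = g x) \<Longrightarrow> smooth_on S f \<longleftrightarrow> smooth_on S g"
  unfolding smooth_on_def using Ck_on_cong by metis

lemma smooth_on_const: "smooth_on S (\<lambda>x. c)"
  by (simp add: smooth_on_def Ck_on_const)

lemma smooth_on_linear: "bounded_linear f \<Longrightarrow> smooth_on S f"
  by (simp add: smooth_on_def Ck_on_linear)

lemma smooth_on_add: "open S \<Longrightarrow> smooth_on S f \<Longrightarrow> smooth_on S g \<Longrightarrow> smooth_on S (\<lambda>x. f x + g x)"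
  by (simp add: smooth_on_def Ck_on_add)

lemma smooth_on_bounded_bilinear:
  "open S \<Longrightarrow> bounded_bilinear pr \<Longrightarrow> smooth_on S f \<Longrightarrow> smooth_on S g \<Longrightarrow> smooth_on S (\<lambda>x. pr (f x) (g x))"
  by (simp add: smooth_on_def Ck_on_bounded_bilinear)

lemmas smooth_on_scaleR = smooth_on_bounded_bilinear[OF _ bounded_bilinear_scaleR]
lemmas smooth_on_inner = smooth_on_bounded_bilinear[OF _ bounded_bilinear_inner]

lemma smooth_on_mult:
  fixes f g :: "'a::real_normed_vector \<Rightarrow> real"
  shows "open S \<Longrightarrow> smooth_on S f \<Longrightarrow> smooth_on S g \<Longrightarrow> smooth_on S (\<lambda>x. f x * g x)"
  by (rule smooth_on_bounded_bilinear[OF _ bounded_bilinear_mult])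

lemma smooth_on_minus:
  fixes f :: "'a::real_normed_vector \<Rightarrow> 'b::real_normed_vector"
  assumes "open S" "smooth_on S f"
  shows "smooth_on S (\<lambda>x. - f x)"
  using smooth_on_scaleR[OF assms(1) smooth_on_const[of S "-1"] assms(2)] by simp

lemma smooth_on_diff:
  fixes f :: "'a::real_normed_vector \<Rightarrow> 'b::real_normed_vector"
  assumes "open S" "smooth_on S f" "smooth_on S g"
  shows "smooth_on S (\<lambda>x. f x - g x)"
  using smooth_on_add[OF assms(1,2) smooth_on_minus[OF assms(1,3)]] by simp

lemma smooth_on_power:
  fixes f :: "'a::real_normed_vector \<Rightarrow> real"
  assumes "open S" "smooth_on S f"
  shows "smooth_on S (\<lambda>x. f x ^ k)"
  by (induction k) (auto simp: smooth_on_const intro!: smooth_on_mult assms)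

lemma smooth_on_divide:
  fixes f g :: "'a::real_normed_vector \<Rightarrow> real"
  assumes "open S" "smooth_on S f" "smooth_on S g" "\<And>x. x \<in> S \<Longrightarrow> g x \<noteq> 0"
  shows "smooth_on S (\<lambda>x. f x / g x)"
proof -
  have "smooth_on S (\<lambda>x. inverse (g x))"
    using assms by (simp add: smooth_on_def Ck_on_inverse)
  then show ?thesis
    unfolding divide_inverse by (intro smooth_on_mult assms)
qed

lemma smooth_on_sum:
  assumes "open S" "\<And>i. i \<in> I \<Longrightarrow> smooth_on S (f i)"
  shows "smooth_on S (\<lambda>x. \<Sum>i\<in>I. f i x)"
  using assms(2) by (induction I rule: infinite_finite_induct) (auto simp: smooth_on_const intro!: smooth_on_add assms(1))

lemma smooth_on_prod:
  fixes f :: "'i \<Rightarrow> 'a::real_normed_vector \<Rightarrow> real"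
  assumes "open S" "\<And>i. i \<in> I \<Longrightarrow> smooth_on S (f i)"
  shows "smooth_on S (\<lambda>x. \<Prod>i\<in>I. f i x)"
  using assms(2) by (induction I rule: infinite_finite_induct) (auto simp: smooth_on_const intro!: smooth_on_mult assms(1))

lemma smooth_on_compose_affine:
  "open S \<Longrightarrow> open T \<Longrightarrow> bounded_linear L \<Longrightarrow> (\<And>x. x \<in> S \<Longrightarrow> c + L x \<in> T) \<Longrightarrow> smooth_on T f
    \<Longrightarrow> smooth_on S (\<lambda>x. f (c + L x))"
  by (simp add: smooth_on_def Ck_on_compose_affine)

lemma smooth_on_vec:
  fixes f :: "'n::finite \<Rightarrow> 'a::real_normed_vector \<Rightarrow> 'b::euclidean_space"
  assumes "open S" "\<And>i. smooth_on S (f i)"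
  shows "smooth_on S (\<lambda>x. \<chi> i. f i x)"
proof -
  have lin: "bounded_linear (axis i :: 'b \<Rightarrow> 'b^'n)" for i
    by (rule linear_conv_bounded_linear[THEN iffD1], rule linearI) (auto simp: axis_def vec_eq_iff)
  have "smooth_on S (\<lambda>x. \<Sum>i\<in>UNIV. axis i (f i x))"
    using assms(2) by (intro smooth_on_sum assms(1)) (auto simp: smooth_on_def intro!: Ck_on_linear_compose[OF assms(1) lin])
  moreover have "(\<Sum>i\<in>UNIV. axis i (f i x)) = (\<chi> i. f i x)" for x
    by (auto simp: vec_eq_iff axis_def if_distrib cong: if_cong)
  ultimately show ?thesis by simp
qed

lemma smooth_on_subset: "smooth_on S f \<Longrightarrow> T \<subseteq> S \<Longrightarrow> smooth_on T f"
proof -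
  have "Ck_on k S f \<Longrightarrow> T \<subseteq> S \<Longrightarrow> Ck_on k T f" for k
    by (induction k arbitrary: f) (auto simp: Ck_on_Suc intro: continuous_on_subset)
  then show "smooth_on S f \<Longrightarrow> T \<subseteq> S \<Longrightarrow> smooth_on T f"
    by (auto simp: smooth_on_def)
qed

lemma dd_eq_on_open:
  assumes "open S" "x \<in> S" "\<And>z. z \<in> S \<Longrightarrow> f z = g z" "smooth_on S f"
  shows "dd f v x = dd g v x"
  by (rule sym, rule dd_eqI, rule has_derivative_transform_within_open[OF smooth_on_has_derivative[OF assms(4,2)] assms(1,2)])
     (use assms in auto)


lemma linear_dd: "smooth_on S f \<Longrightarrow> z \<in> S \<Longrightarrow> linear (\<lambda>v. dd f v z)"
  using smooth_on_has_derivative has_derivative_linear by blast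

lemma smooth_on_differentiable: "smooth_on S f \<Longrightarrow> z \<in> S \<Longrightarrow> f differentiable (at z)"
  using smooth_on_has_derivative differentiable_def by blast

lemma dd_has_derivative: "f differentiable (at z) \<Longrightarrow> (f has_derivative (\<lambda>v. dd f v z)) (at z)"
  by (simp add: dd_def frechet_derivative_works)

lemma dd_const: "dd (\<lambda>z. c) v z = 0"
  by (rule dd_eqI) (rule has_derivative_const)

lemma dd_linear: "bounded_linear f \<Longrightarrow> dd f v z = f v"
  by (rule dd_eqI) (rule bounded_linear_imp_has_derivative)

lemma dd_add:
  "f differentiable (at z) \<Longrightarrow> g differentiable (at z) \<Longrightarrow> dd (\<lambda>z. f z + g z) v z = dd f v z + dd g v z"
  by (rule dd_eqI, rule has_derivative_add) (auto intro: dd_has_derivative)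

lemma dd_diff:
  "f differentiable (at z) \<Longrightarrow> g differentiable (at z) \<Longrightarrow> dd (\<lambda>z. f z - g z) v z = dd f v z - dd g v z"
  by (rule dd_eqI, rule has_derivative_diff) (auto intro: dd_has_derivative)

lemma dd_minus: "f differentiable (at z) \<Longrightarrow> dd (\<lambda>z. - f z) v z = - dd f v z"
  by (rule dd_eqI, rule has_derivative_minus) (auto intro: dd_has_derivative)

lemma dd_mult:
  fixes f g :: "'a::real_normed_vector \<Rightarrow> real"
  shows "f differentiable (at z) \<Longrightarrow> g differentiable (at z) \<Longrightarrow>
    dd (\<lambda>z. f z * g z) v z = f z * dd g v z + dd f v z * g z"
  by (rule dd_eqI, rule has_derivative_mult) (auto intro: dd_has_derivative)

lemma dd_inner:
  fixes f g :: "'a::real_normed_vector \<Rightarrow> 'b::real_inner"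
  shows "f differentiable (at z) \<Longrightarrow> g differentiable (at z) \<Longrightarrow>
    dd (\<lambda>z. f z \<bullet> g z) v z = f z \<bullet> dd g v z + dd f v z \<bullet> g z"
  by (rule dd_eqI, rule has_derivative_inner) (auto intro: dd_has_derivative)

lemma dd_sum:
  "(\<And>i. i \<in> I \<Longrightarrow> f i differentiable (at z)) \<Longrightarrow> dd (\<lambda>z. \<Sum>i\<in>I. f i z) v z = (\<Sum>i\<in>I. dd (f i) v z)"
  by (rule dd_eqI, rule has_derivative_sum) (auto intro: dd_has_derivative)

lemma dd_compose_affine:
  assumes "bounded_linear L" "f differentiable (at (c + L z))"
  shows "dd (\<lambda>z. f (c + L z)) v z = dd f (L v) (c + L z)"
proof (rule dd_eqI)
  have "((\<lambda>x. c + L x) has_derivative L) (at z)"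
    using has_derivative_add[OF has_derivative_const bounded_linear_imp_has_derivative[OF assms(1)]] by simp
  then show "((\<lambda>x. f (c + L x)) has_derivative (\<lambda>v. dd f (L v) (c + L z))) (at z)"
    by (rule has_derivative_compose) (rule dd_has_derivative[OF assms(2)])
qed

lemma dd_along_line:
  fixes f :: "'a::real_normed_vector \<Rightarrow> real"
  assumes "f differentiable (at (z + s *\<^sub>R v))"
  shows "((\<lambda>s. f (z + s *\<^sub>R v)) has_real_derivative dd f v (z + s *\<^sub>R v)) (at s)"
proof -
  have "((\<lambda>s. z + s *\<^sub>R v) has_derivative (\<lambda>h. h *\<^sub>R v)) (at s)"
    by (auto intro!: derivative_eq_intros)
  from has_derivative_compose[OF this dd_has_derivative[OF assms]]
  have "((\<lambda>s. f (z + s *\<^sub>R v)) has_derivative (\<lambda>h. dd f (h *\<^sub>R v) (z + s *\<^sub>R v))) (at s)" .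
  moreover have "dd f (h *\<^sub>R v) (z + s *\<^sub>R v) = dd f v (z + s *\<^sub>R v) * h" for h
    using linear_cmul[OF has_derivative_linear[OF dd_has_derivative[OF assms]]] by (simp add: mult.commute)
  ultimately show ?thesis
    by (simp add: has_field_derivative_def)
qed

section \<open>Symmetry of second derivatives\<close>

lemma second_difference_mvt:
  fixes f :: "'a::real_normed_vector \<Rightarrow> real"
  assumes sm: "smooth_on S f" and h: "h > 0"
    and S: "\<And>s t. 0 \<le> s \<Longrightarrow> s \<le> h \<Longrightarrow> 0 \<le> t \<Longrightarrow> t \<le> h \<Longrightarrow> z + s *\<^sub>R v + t *\<^sub>R w \<in> S"
  shows "\<exists>s\<in>{0..h}. \<exists>t\<in>{0..h}. f (z + h *\<^sub>R v + h *\<^sub>R w) - f (z + h *\<^sub>R v) - f (z + h *\<^sub>R w) + f z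
    = h * h * dd (dd f v) w (z + s *\<^sub>R v + t *\<^sub>R w)"
proof -
  let ?\<phi> = "\<lambda>s. f (z + h *\<^sub>R w + s *\<^sub>R v) - f (z + s *\<^sub>R v)"
  have "DERIV ?\<phi> s :> dd f v (z + h *\<^sub>R w + s *\<^sub>R v) - dd f v (z + s *\<^sub>R v)" if "0 \<le> s" "s \<le> h" for s
  proof (intro DERIV_diff dd_along_line smooth_on_differentiable[OF sm])
    show "z + h *\<^sub>R w + s *\<^sub>R v \<in> S" "z + s *\<^sub>R v \<in> S"
      using S[OF that, of 0] S[OF that, of h] h by (simp_all add: algebra_simps)
  qed
  from MVT2[OF h, of ?\<phi>, OF this]
  obtain s where s: "0 < s" "s < h" and e1: "?\<phi> h - ?\<phi> 0 = h * (dd f v (z + h *\<^sub>R w + s *\<^sub>R v) - dd f v (z + s *\<^sub>R v))"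
    by auto
  have "DERIV (\<lambda>t. dd f v (z + s *\<^sub>R v + t *\<^sub>R w)) t :> dd (dd f v) w (z + s *\<^sub>R v + t *\<^sub>R w)" if "0 \<le> t" "t \<le> h" for t
    using S[of s t] s that
    by (auto intro!: dd_along_line smooth_on_differentiable[OF smooth_on_dd[OF sm]])
  from MVT2[OF h this]
  obtain t where t: "0 < t" "t < h" and e2: "dd f v (z + s *\<^sub>R v + h *\<^sub>R w) - dd f v (z + s *\<^sub>R v + 0 *\<^sub>R w)
      = h * dd (dd f v) w (z + s *\<^sub>R v + t *\<^sub>R w)"
    by auto
  have "?\<phi> h - ?\<phi> 0 = h * (h * dd (dd f v) w (z + s *\<^sub>R v + t *\<^sub>R w))"
    unfolding e1 e2[symmetric] by (simp add: add_ac)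
  then show ?thesis
    using s t by (intro bexI[of _ s] bexI[of _ t]) (auto simp: algebra_simps)
qed

text \<open>The second difference of \<open>f\<close> over a small parallelogram is symmetric in its
  sides. By the mean value theorem it is \<open>h * h\<close> times either mixed derivative at some
  point of the parallelogram, so continuity at \<open>z\<close> forces the two to agree.\<close>

lemma dd_commute:
  fixes f :: "'a::real_normed_vector \<Rightarrow> real"
  assumes "open S" "smooth_on S f" "z \<in> S"
  shows "dd (dd f v) w z = dd (dd f w) v z"
proof (rule ccontr)
  let ?a = "dd (dd f v) w" and ?b = "dd (dd f w) v"
  assume ne: "?a z \<noteq> ?b z"
  define e where "e = \<bar>?a z - ?b z\<bar> / 2"
  have e: "e > 0" using ne by (simp add: e_def)
  have cont: "isCont ?a z" "isCont ?b z"
    using smooth_on_continuous[OF smooth_on_dd[OF smooth_on_dd[OF assms(2)]]] assms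
    by (auto simp: continuous_on_eq_continuous_at)
  obtain d1 where d1: "d1 > 0" "\<And>p. dist p z < d1 \<Longrightarrow> dist (?a p) (?a z) < e"
    using cont(1) e unfolding continuous_at_eps_delta by blast
  obtain d2 where d2: "d2 > 0" "\<And>p. dist p z < d2 \<Longrightarrow> dist (?b p) (?b z) < e"
    using cont(2) e unfolding continuous_at_eps_delta by blast
  obtain d3 where d3: "d3 > 0" "ball z d3 \<subseteq> S"
    using assms(1,3) open_contains_ball by blast
  define d where "d = min d1 (min d2 d3)"
  \<comment> \<open>The parallelogram then lies within \<open>d / 2\<close> of \<open>z\<close>; the
    summand 1 keeps the denominator positive for \<open>v = w = 0\<close>.\<close>
  define h where "h = d / (2 * (norm v + norm w + 1))"
  have d: "d > 0" using d1 d2 d3 by (simp add: d_def)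
  have h: "h > 0" using d by (simp add: h_def add_nonneg_pos)
  have near: "dist (z + s *\<^sub>R v + t *\<^sub>R w) z < d" if "0 \<le> s" "s \<le> h" "0 \<le> t" "t \<le> h" for s t
  proof -
    have "dist (z + s *\<^sub>R v + t *\<^sub>R w) z \<le> s * norm v + t * norm w"
      using norm_triangle_ineq[of "s *\<^sub>R v" "t *\<^sub>R w"] that by (simp add: dist_norm add.assoc)
    also have "\<dots> \<le> h * (norm v + norm w + 1)"
      using that by (simp add: distrib_left add_mono mult_right_mono add_increasing2 h less_imp_le)
    also have "\<dots> = d / 2"
    proof -
      have "d / (2 * N) * N = d / 2" if "N > 0" for N :: real
        using that by simp
      from this[of "norm v + norm w + 1"] show ?thesis
        using add_nonneg_pos[of "norm v + norm w" 1] unfolding h_def by (simp only: zero_less_one add_nonneg_nonneg norm_ge_zero)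
    qed
    finally show ?thesis using d by simp
  qed
  have inS: "z + s *\<^sub>R v + t *\<^sub>R w \<in> S" if "0 \<le> s" "s \<le> h" "0 \<le> t" "t \<le> h" for s t
    using near[OF that] d3(2) by (auto simp: d_def dist_commute subset_iff)
  obtain s t where st: "s\<in>{0..h}" "t\<in>{0..h}"
    and eq1: "f (z + h *\<^sub>R v + h *\<^sub>R w) - f (z + h *\<^sub>R v) - f (z + h *\<^sub>R w) + f z = h * h * ?a (z + s *\<^sub>R v + t *\<^sub>R w)"
    using second_difference_mvt[OF assms(2) h inS] by blast
  have inS': "z + s *\<^sub>R w + t *\<^sub>R v \<in> S" if "0 \<le> s" "s \<le> h" "0 \<le> t" "t \<le> h" for s t
    using inS[OF that(3,4,1,2)] by (simp add: add_ac)
  obtain s' t' where st': "s'\<in>{0..h}" "t'\<in>{0..h}"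
    and eq2: "f (z + h *\<^sub>R w + h *\<^sub>R v) - f (z + h *\<^sub>R w) - f (z + h *\<^sub>R v) + f z = h * h * ?b (z + s' *\<^sub>R w + t' *\<^sub>R v)"
    using second_difference_mvt[OF assms(2) h inS'] by blast
  have eq: "h * h * ?a (z + s *\<^sub>R v + t *\<^sub>R w) = h * h * ?b (z + t' *\<^sub>R v + s' *\<^sub>R w)"
  proof -
    have "z + h *\<^sub>R w + h *\<^sub>R v = z + h *\<^sub>R v + h *\<^sub>R w"
      "z + s' *\<^sub>R w + t' *\<^sub>R v = z + t' *\<^sub>R v + s' *\<^sub>R w"
      by (simp_all add: add_ac)
    from eq2[unfolded this] eq1 show ?thesis by linarith
  qed
  have "dist (?a (z + s *\<^sub>R v + t *\<^sub>R w)) (?a z) < e" "dist (?b (z + t' *\<^sub>R v + s' *\<^sub>R w)) (?b z) < e"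
    using d1(2) d2(2) near st st' by (fastforce simp: d_def)+
  moreover have "?a (z + s *\<^sub>R v + t *\<^sub>R w) = ?b (z + t' *\<^sub>R v + s' *\<^sub>R w)"
    using eq h by simp
  ultimately show False
    unfolding e_def dist_real_def by (smt (verit) field_sum_of_halves)
qed

lemma dd_euclidean_sum:
  fixes f :: "'a::euclidean_space \<Rightarrow> real"
  assumes "smooth_on S f" "z \<in> S"
  shows "dd f v z = (\<Sum>b\<in>Basis. (v \<bullet> b) * dd f b z)"
  using Linear_Algebra.linear_componentwise[OF linear_dd[OF assms], of v 1] by simp

lemma smooth_on_dd_var:
  fixes f :: "'a::euclidean_space \<Rightarrow> real"
  assumes "open S" "smooth_on S f" "smooth_on S G"
  shows "smooth_on S (\<lambda>z. dd f (G z) z)"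
proof -
  have "smooth_on S (\<lambda>z. \<Sum>b\<in>Basis. (G z \<bullet> b) * dd f b z)"
    by (intro smooth_on_sum smooth_on_mult smooth_on_inner smooth_on_const smooth_on_dd assms)
  then show ?thesis
    by (subst smooth_on_cong[OF assms(1)]) (rule dd_euclidean_sum[OF assms(2)], assumption)
qed

text \<open>Product rule for a derivative whose direction varies with the point: one term
  differentiates the direction, the other the function with the direction frozen. Expansion in the
  basis reduces it to constant directions.\<close>

lemma dd_dd_var:
  fixes f :: "'a::euclidean_space \<Rightarrow> real"
  assumes "open S" "smooth_on S f" "smooth_on S G" "z \<in> S"
  shows "dd (\<lambda>z. dd f (G z) z) a z = dd f (dd G a z) z + dd (dd f (G z)) a z"
proof -
  have dG: "G differentiable (at z)" and dfb: "dd f b differentiable (at z)" for b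
    using assms smooth_on_differentiable smooth_on_dd by blast+
  have "dd (\<lambda>z. dd f (G z) z) a z = dd (\<lambda>z. \<Sum>b\<in>Basis. (G z \<bullet> b) * dd f b z) a z"
    by (rule dd_eq_on_open[OF assms(1,4)]) (use assms in \<open>auto intro!: dd_euclidean_sum smooth_on_dd_var\<close>)
  also have "\<dots> = (\<Sum>b\<in>Basis. (G z \<bullet> b) * dd (dd f b) a z + (dd G a z \<bullet> b) * dd f b z)"
    using dG dfb by (simp add: dd_sum dd_mult dd_inner dd_const differentiable_inner)
  also have "\<dots> = (\<Sum>b\<in>Basis. (G z \<bullet> b) * dd (dd f b) a z) + dd f (dd G a z) z"
    by (simp add: sum.distrib dd_euclidean_sum[OF assms(2,4), of "dd G a z"])
  also have "(\<Sum>b\<in>Basis. (G z \<bullet> b) * dd (dd f b) a z) = (\<Sum>b\<in>Basis. (G z \<bullet> b) * dd (dd f a) b z)"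
    using dd_commute[OF assms(1,2,4)] by metis
  also have "\<dots> = dd (dd f a) (G z) z"
    by (rule dd_euclidean_sum[OF smooth_on_dd[OF assms(2)] assms(4), symmetric])
  also have "\<dots> = dd (dd f (G z)) a z"
    by (rule dd_commute[OF assms(1,2,4)])
  finally show ?thesis by simp
qed

section \<open>The first integral\<close>

locale slit_bundle =
  fixes U :: "'a::euclidean_space set"
  assumes open_U: "open U"
begin

abbreviation Z :: "('a \<times> 'a) set" where "Z \<equiv> U \<times> (- {0})"

lemma open_Z: "open Z"
  by (intro open_Times open_U) (simp add: open_Compl)

lemmas smooth_Z = smooth_on_add[OF open_Z] smooth_on_diff[OF open_Z] smooth_on_minus[OF open_Z]
  smooth_on_mult[OF open_Z] smooth_on_power[OF open_Z] smooth_on_const smooth_on_dd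

lemma dd_rules:
  fixes f g :: "'a \<times> 'a \<Rightarrow> real"
  assumes "smooth_on Z f" "smooth_on Z g" "z \<in> Z"
  shows "dd (\<lambda>z. f z + g z) v z = dd f v z + dd g v z"
    and "dd (\<lambda>z. f z - g z) v z = dd f v z - dd g v z"
    and "dd (\<lambda>z. - f z) v z = - dd f v z"
    and "dd (\<lambda>z. f z * g z) v z = f z * dd g v z + dd f v z * g z"
  using assms by (auto intro!: dd_add dd_diff dd_minus dd_mult intro: smooth_on_differentiable)

lemma dd_square:
  fixes f :: "'a \<times> 'a \<Rightarrow> real"
  assumes "smooth_on Z f" "z \<in> Z"
  shows "dd (\<lambda>z. (f z)\<^sup>2) v z = 2 * f z * dd f v z"
  using dd_rules(4)[OF assms(1,1,2)] by (simp add: power2_eq_square)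

lemma dd_divide:
  fixes f g :: "'a \<times> 'a \<Rightarrow> real"
  assumes "smooth_on Z f" "smooth_on Z g" "z \<in> Z" "g z \<noteq> 0"
  shows "dd (\<lambda>z. f z / g z) v z = (dd f v z * g z - f z * dd g v z) / (g z * g z)"
  by (rule dd_eqI, rule has_derivative_divide')
     (use assms in \<open>auto intro!: dd_has_derivative smooth_on_differentiable\<close>)

lemma dd_eq_Z:
  "z \<in> Z \<Longrightarrow> smooth_on Z f \<Longrightarrow> (\<And>z. z \<in> Z \<Longrightarrow> f z = g z) \<Longrightarrow> dd f v z = dd g v z"
  by (rule dd_eq_on_open[OF open_Z])

lemma smooth_hor: "smooth_on Z f \<Longrightarrow> smooth_on Z (\<lambda>z. dd f (snd z, 0) z)" for f :: "'a \<times> 'a \<Rightarrow> real"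
  by (rule smooth_on_dd_var[OF open_Z])
     (auto intro!: smooth_on_linear bounded_linear_Pair bounded_linear_snd bounded_linear_zero)

lemma smooth_euler: "smooth_on Z f \<Longrightarrow> smooth_on Z (\<lambda>z. dd f (0, snd z) z)" for f :: "'a \<times> 'a \<Rightarrow> real"
  by (rule smooth_on_dd_var[OF open_Z])
     (auto intro!: smooth_on_linear bounded_linear_Pair bounded_linear_snd bounded_linear_zero)

text \<open>\<open>dd f (snd z, 0) z\<close> is \<open>D f\<close>. The coefficients of
  \<open>D\<close> depend on \<open>y\<close>, which gives the commutator: a fibre derivative in
  direction \<open>v\<close> passes through \<open>D\<close> at the cost of the base derivative in
  direction \<open>v\<close>.\<close>

lemma dd_hor:
  fixes f :: "'a \<times> 'a \<Rightarrow> real"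
  assumes "smooth_on Z f" "z \<in> Z"
  shows "dd (\<lambda>z. dd f (snd z, 0) z) a z = dd f (snd a, 0) z + dd (dd f a) (snd z, 0) z"
proof -
  have lin: "bounded_linear (\<lambda>z. (snd z, 0) :: 'a \<times> 'a)"
    by (intro bounded_linear_Pair bounded_linear_snd bounded_linear_zero)
  show ?thesis
    using dd_dd_var[OF open_Z assms(1) smooth_on_linear[OF lin] assms(2), of a]
      dd_linear[OF lin, of a z] dd_commute[OF open_Z assms] by simp
qed

lemma dd_euler:
  fixes f :: "'a \<times> 'a \<Rightarrow> real"
  assumes "smooth_on Z f" "z \<in> Z"
  shows "dd (\<lambda>z. dd f (0, snd z) z) a z = dd f (0, snd a) z + dd (dd f a) (0, snd z) z"
proof -
  have lin: "bounded_linear (\<lambda>z. (0, snd z) :: 'a \<times> 'a)"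
    by (intro bounded_linear_Pair bounded_linear_snd bounded_linear_zero)
  show ?thesis
    using dd_dd_var[OF open_Z assms(1) smooth_on_linear[OF lin] assms(2), of a]
      dd_linear[OF lin, of a z] dd_commute[OF open_Z assms] by simp
qed

lemma smooth_base:
  assumes "smooth_on U f"
  shows "smooth_on Z (\<lambda>z. f (fst z))"
  using smooth_on_compose_affine[OF open_Z open_U bounded_linear_fst _ assms, of 0] by auto

lemma smooth_section:
  assumes "smooth_on Z f" "y \<noteq> 0"
  shows "smooth_on U (\<lambda>x. f (x, y))"
proof -
  have "smooth_on U (\<lambda>x. f ((0, y) + (x, 0)))"
    using assms(2)
    by (intro smooth_on_compose_affine[OF open_U open_Z _ _ assms(1)] bounded_linear_Pair bounded_linear_zero bounded_linear_ident) auto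
  then show ?thesis by simp
qed

lemma dd_base:
  assumes "smooth_on U f" "z \<in> Z"
  shows "dd (\<lambda>z. f (fst z)) a z = dd f (fst a) (fst z)"
  using dd_compose_affine[OF bounded_linear_fst, of f 0 z a] smooth_on_differentiable[OF assms(1), of "fst z"] assms(2)
  by auto

end

text \<open>\<open>EuP\<close> and \<open>EuF\<close> are homogeneity of degree one in infinitesimal
  form. \<open>F\<close> is only required not to vanish, so that the pair made from
  \<open>- F(x, - y)\<close> is again an instance.\<close>

locale flat_pair = slit_bundle U for U :: "'a::euclidean_space set" +
  fixes F P :: "'a \<times> 'a \<Rightarrow> real" and \<theta> :: "'a \<Rightarrow> 'a" and \<sigma> :: "'a \<Rightarrow> real"
  assumes smF: "smooth_on Z F" and smP: "smooth_on Z P"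
    and sm_theta: "smooth_on U \<theta>" and sm_sigma: "smooth_on U \<sigma>"
    and EuP: "z \<in> Z \<Longrightarrow> dd P (0, snd z) z = P z"
    and EuF: "z \<in> Z \<Longrightarrow> dd F (0, snd z) z = F z"
    and F_nonzero: "z \<in> Z \<Longrightarrow> F z \<noteq> 0"
    and hamel: "z \<in> Z \<Longrightarrow> dd F (v, 0) z = dd P (0, v) z * F z + P z * dd F (0, v) z"
    and horP: "z \<in> Z \<Longrightarrow> dd P (snd z, 0) z = (P z)\<^sup>2 - 3 * (\<theta> (fst z) \<bullet> snd z) * F z - \<sigma> (fst z) * (F z)\<^sup>2"
begin

definition TH :: "'a \<times> 'a \<Rightarrow> real" where "TH z = \<theta> (fst z) \<bullet> snd z"
definition SG :: "'a \<times> 'a \<Rightarrow> real" where "SG z = \<sigma> (fst z)"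
definition A :: "'a \<times> 'a \<Rightarrow> real" where "A z = dd TH (snd z, 0) z"
definition S0 :: "'a \<times> 'a \<Rightarrow> real" where "S0 z = dd SG (snd z, 0) z"

lemma smTH: "smooth_on Z TH"
  unfolding TH_def[abs_def]
  by (intro smooth_on_inner[OF open_Z] smooth_base sm_theta smooth_on_linear bounded_linear_snd)

lemma smSG: "smooth_on Z SG"
  unfolding SG_def[abs_def] by (intro smooth_base sm_sigma)

lemma smA: "smooth_on Z A"
  unfolding A_def[abs_def] by (rule smooth_hor[OF smTH])

lemma smS0: "smooth_on Z S0"
  unfolding S0_def[abs_def] by (rule smooth_hor[OF smSG])

lemma smt: "smooth_on Z (\<lambda>z. \<theta> (fst z) \<bullet> v)"
  by (intro smooth_on_inner[OF open_Z] smooth_base sm_theta smooth_on_const)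

lemmas sm = smF smP smTH smSG smA smS0 smt smooth_Z

lemma dd_TH: "z \<in> Z \<Longrightarrow> dd TH a z = \<theta> (fst z) \<bullet> snd a + dd \<theta> (fst a) (fst z) \<bullet> snd z"
  unfolding TH_def[abs_def]
  by (subst dd_inner)
     (auto intro!: smooth_on_differentiable[OF smooth_base[OF sm_theta]] bounded_linear_imp_differentiable[OF bounded_linear_snd]
       simp: dd_linear[OF bounded_linear_snd] dd_base[OF sm_theta])

lemma dd_t: "z \<in> Z \<Longrightarrow> dd (\<lambda>z. \<theta> (fst z) \<bullet> v) a z = dd \<theta> (fst a) (fst z) \<bullet> v"
  by (subst dd_inner)
     (auto intro!: smooth_on_differentiable[OF smooth_base[OF sm_theta]] simp: dd_const dd_base[OF sm_theta])

lemma dd_SG: "z \<in> Z \<Longrightarrow> dd SG a z = dd \<sigma> (fst a) (fst z)"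
  unfolding SG_def[abs_def] by (rule dd_base[OF sm_sigma])

lemma horF: "z \<in> Z \<Longrightarrow> dd F (snd z, 0) z = 2 * F z * P z"
  using hamel[of z "snd z"] EuP[of z] EuF[of z] by simp

lemma horP': "z \<in> Z \<Longrightarrow> dd P (snd z, 0) z = (P z)\<^sup>2 - 3 * TH z * F z - SG z * (F z)\<^sup>2"
  using horP by (simp add: TH_def SG_def)

text \<open>Take fibre derivatives of \<open>D F = 2 F P\<close> and of the equation for
  \<open>D P\<close>, the base derivative of the former, and \<open>D\<close> of Hamel's equation.
  Eliminating \<open>D\<close> of the fibre derivatives leaves \<open>3 F\<close> times the base
  derivative of \<open>P\<close>: two parts come from \<open>2 F P\<close>, one from the
  commutator.\<close>

lemma dd_P_base:
  assumes z: "z \<in> Z"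
  shows "dd P (v, 0) z = P z * dd P (0, v) z - (\<theta> (fst z) \<bullet> v) * F z - (2 * TH z + SG z * F z) * dd F (0, v) z"
proof -
  let ?DF = "\<lambda>z. dd F (snd z, 0) z" and ?DP = "\<lambda>z. dd P (snd z, 0) z"
  have fz: "fst z \<in> U" using z by auto
  note [simp] = linear_0[OF linear_dd[OF sm_theta fz]] linear_0[OF linear_dd[OF sm_sigma fz]]
  have a: "dd ?DF (v, 0) z = 2 * F z * dd P (v, 0) z + 2 * P z * dd F (v, 0) z"
    by (subst dd_eq_Z[OF z smooth_hor[OF smF], where g = "\<lambda>z. 2 * F z * P z"])
       (auto simp: horF dd_rules sm z dd_const)
  have b: "dd ?DF (0, v) z = 2 * F z * dd P (0, v) z + 2 * P z * dd F (0, v) z"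
    by (subst dd_eq_Z[OF z smooth_hor[OF smF], where g = "\<lambda>z. 2 * F z * P z"])
       (auto simp: horF dd_rules sm z dd_const)
  have c: "dd ?DP (0, v) z = 2 * P z * dd P (0, v) z - 3 * (\<theta> (fst z) \<bullet> v) * F z - 3 * TH z * dd F (0, v) z
      - SG z * (2 * F z * dd F (0, v) z)"
    by (subst dd_eq_Z[OF z smooth_hor[OF smP], where g = "\<lambda>z. (P z)\<^sup>2 - 3 * TH z * F z - SG z * (F z)\<^sup>2"])
       (use z in \<open>auto simp: horP' dd_rules dd_square sm z dd_const dd_TH dd_SG algebra_simps\<close>)
  have d: "dd (dd F (v, 0)) (snd z, 0) z = dd (dd P (0, v)) (snd z, 0) z * F z + dd P (0, v) z * (2 * F z * P z)
      + dd P (snd z, 0) z * dd F (0, v) z + P z * dd (dd F (0, v)) (snd z, 0) z"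
    by (subst dd_eq_Z[OF z smooth_on_dd[OF smF], where g = "\<lambda>z. dd P (0, v) z * F z + P z * dd F (0, v) z"])
       (auto simp: hamel dd_rules sm z EuP EuF algebra_simps)
  have "dd ?DF (v, 0) z = dd (dd F (v, 0)) (snd z, 0) z"
    using dd_hor[OF smF z, of "(v, 0)"] linear_0[OF linear_dd[OF smF z]] by (simp add: zero_prod_def)
  moreover have "dd ?DF (0, v) z = dd F (v, 0) z + dd (dd F (0, v)) (snd z, 0) z"
    using dd_hor[OF smF z, of "(0, v)"] by simp
  moreover have "dd ?DP (0, v) z = dd P (v, 0) z + dd (dd P (0, v)) (snd z, 0) z"
    using dd_hor[OF smP z, of "(0, v)"] by simp
  ultimately have "3 * F z * dd P (v, 0) z =
      3 * F z * (P z * dd P (0, v) z - (\<theta> (fst z) \<bullet> v) * F z - (2 * TH z + SG z * F z) * dd F (0, v) z)"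
    using a b c d hamel[OF z, of v] horP'[OF z] by algebra
  then show ?thesis using F_nonzero[OF z] by simp
qed

text \<open>Equality of the derivatives of \<open>P\<close> in base directions \<open>v\<close> and
  \<open>w\<close> taken in either order. All second derivatives of \<open>F\<close> and
  \<open>P\<close> cancel.\<close>

lemma integrability:
  assumes z: "z \<in> Z"
  shows "2 * TH z * (dd P (0,w) z * dd F (0,v) z - dd P (0,v) z * dd F (0,w) z)
    + 2 * P z * ((\<theta> (fst z) \<bullet> w) * dd F (0,v) z - (\<theta> (fst z) \<bullet> v) * dd F (0,w) z)
    - F z * (dd \<theta> w (fst z) \<bullet> v - dd \<theta> v (fst z) \<bullet> w)
    - 2 * ((dd \<theta> w (fst z) \<bullet> snd z) * dd F (0,v) z - (dd \<theta> v (fst z) \<bullet> snd z) * dd F (0,w) z)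
    - F z * (dd \<sigma> w (fst z) * dd F (0,v) z - dd \<sigma> v (fst z) * dd F (0,w) z) = 0"
proof -
  have fz: "fst z \<in> U" using z by auto
  note [simp] = linear_0[OF linear_dd[OF sm_theta fz]] linear_0[OF linear_dd[OF sm_sigma fz]]
  have PP: "dd (dd P (v,0)) (w,0) z =
      dd P (w,0) z * dd P (0,v) z + P z * dd (dd P (w,0)) (0,v) z - (dd \<theta> w (fst z) \<bullet> v) * F z
      - (\<theta> (fst z) \<bullet> v) * dd F (w,0) z - (2 * (dd \<theta> w (fst z) \<bullet> snd z) + dd \<sigma> w (fst z) * F z + SG z * dd F (w,0) z) * dd F (0,v) z
      - (2 * TH z + SG z * F z) * dd (dd F (w,0)) (0,v) z" for v w
    by (subst dd_eq_Z[OF z smooth_on_dd[OF smP], where g = "\<lambda>z. P z * dd P (0, v) z - (\<theta> (fst z) \<bullet> v) * F z - (2 * TH z + SG z * F z) * dd F (0, v) z"])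
       (use fz in \<open>simp_all add: dd_P_base dd_rules sm z dd_const dd_TH dd_t dd_SG
          dd_commute[OF open_Z smP z, of "(0,v)" "(w,0)"] dd_commute[OF open_Z smF z, of "(0,v)" "(w,0)"] algebra_simps\<close>)
  \<comment> \<open>The mixed base-fibre derivatives occurring in \<open>PP\<close> are reduced to
    pure fibre derivatives, which are symmetric.\<close>
  have PY: "dd (dd P (w,0)) (0,v) z = dd P (0,v) z * dd P (0,w) z + P z * dd (dd P (0,w)) (0,v) z
      - (\<theta> (fst z) \<bullet> w) * dd F (0,v) z - (2 * (\<theta> (fst z) \<bullet> v) + SG z * dd F (0,v) z) * dd F (0,w) z
      - (2 * TH z + SG z * F z) * dd (dd F (0,w)) (0,v) z" for v w
    by (subst dd_eq_Z[OF z smooth_on_dd[OF smP], where g = "\<lambda>z. P z * dd P (0, w) z - (\<theta> (fst z) \<bullet> w) * F z - (2 * TH z + SG z * F z) * dd F (0, w) z"])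
       (use fz in \<open>simp_all add: dd_P_base dd_rules sm z dd_const dd_TH dd_t dd_SG algebra_simps\<close>)
  have FY: "dd (dd F (w,0)) (0,v) z = dd (dd P (0,w)) (0,v) z * F z + dd P (0,w) z * dd F (0,v) z
      + dd P (0,v) z * dd F (0,w) z + P z * dd (dd F (0,w)) (0,v) z" for v w
    by (subst dd_eq_Z[OF z smooth_on_dd[OF smF], where g = "\<lambda>z. dd P (0, w) z * F z + P z * dd F (0, w) z"])
       (simp_all add: hamel dd_rules sm z algebra_simps)
  show ?thesis
    using PP[of v w] PP[of w v] PY[of v w] PY[of w v] FY[of v w] FY[of w v]
      dd_P_base[OF z, of v] dd_P_base[OF z, of w] hamel[OF z, of v] hamel[OF z, of w]
      dd_commute[OF open_Z smP z, of "(v,0)" "(w,0)"] dd_commute[OF open_Z smP z, of "(0,v)" "(0,w)"]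
      dd_commute[OF open_Z smF z, of "(0,v)" "(0,w)"]
    by algebra
qed

text \<open>The first integral solved for the coefficient of \<open>F\<^sup>2\<close>; it has to be
  shown that this depends on the base point only.\<close>

definition \<Phi> :: "'a \<times> 'a \<Rightarrow> real" where
  "\<Phi> z = (2 * TH z * P z - A z - S0 z * F z) / (F z)\<^sup>2"

lemma sm_Phi: "smooth_on Z \<Phi>"
  unfolding \<Phi>_def[abs_def] using F_nonzero
  by (intro smooth_on_divide[OF open_Z]) (auto intro!: sm)

text \<open>Put \<open>v = y\<close> in the integrability condition and use homogeneity. The terms
  with derivatives of \<open>P\<close> and \<sigma> combine into the derivative of the quotient;
  what is left over is the exterior derivative of \<theta> on \<open>(w, y)\<close>.\<close>

lemma dd_Phi:
  assumes z: "z \<in> Z"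
  shows "dd \<Phi> (0, w) z = 2 * (dd \<theta> w (fst z) \<bullet> snd z - dd \<theta> (snd z) (fst z) \<bullet> w) / (F z)\<^sup>2"
proof -
  have fz: "fst z \<in> U" using z by auto
  note [simp] = linear_0[OF linear_dd[OF sm_theta fz]] linear_0[OF linear_dd[OF sm_sigma fz]]
  have dTHw: "dd (dd TH (0, w)) (snd z, 0) z = dd \<theta> (snd z) (fst z) \<bullet> w"
    by (subst dd_eq_Z[OF z smooth_on_dd[OF smTH], where g = "\<lambda>z. \<theta> (fst z) \<bullet> w"])
       (use linear_0[OF linear_dd[OF sm_theta]] z in \<open>auto simp: dd_TH dd_t\<close>)
  have dSGw: "dd (dd SG (0, w)) (snd z, 0) z = 0"
    by (subst dd_eq_Z[OF z smooth_on_dd[OF smSG], where g = "\<lambda>z. 0"])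
       (use linear_0[OF linear_dd[OF sm_sigma]] z in \<open>auto simp: dd_SG dd_const\<close>)
  have Aw: "dd A (0, w) z = dd \<theta> w (fst z) \<bullet> snd z + dd \<theta> (snd z) (fst z) \<bullet> w"
    unfolding A_def[abs_def] using dd_hor[OF smTH z, of "(0, w)"] dTHw by (simp add: dd_TH z)
  have S0w: "dd S0 (0, w) z = dd \<sigma> w (fst z)"
    unfolding S0_def[abs_def] using dd_hor[OF smSG z, of "(0, w)"] dSGw by (simp add: dd_SG z)
  have Az: "A z = dd \<theta> (snd z) (fst z) \<bullet> snd z" and S0z: "S0 z = dd \<sigma> (snd z) (fst z)"
    by (simp_all add: A_def S0_def dd_TH dd_SG z)
  define N where "N = (\<lambda>z. 2 * TH z * P z - A z - S0 z * F z)"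
  have N_z: "N z = 2 * TH z * P z - A z - S0 z * F z" by (simp add: N_def)
  have Nw: "dd N (0, w) z = 2 * (\<theta> (fst z) \<bullet> w) * P z + 2 * TH z * dd P (0, w) z
      - (dd \<theta> w (fst z) \<bullet> snd z + dd \<theta> (snd z) (fst z) \<bullet> w) - (dd \<sigma> w (fst z) * F z + S0 z * dd F (0, w) z)"
    unfolding N_def by (simp add: dd_rules sm z dd_const dd_TH Aw S0w algebra_simps)
  have "F z * dd N (0, w) z - 2 * N z * dd F (0, w) z
      = 2 * F z * (dd \<theta> w (fst z) \<bullet> snd z - dd \<theta> (snd z) (fst z) \<bullet> w)"
    using integrability[OF z, of w "snd z"] EuP[OF z] EuF[OF z] Az S0z Nw N_z TH_def[of z]
    by algebra
  moreover have "dd \<Phi> (0, w) z = (dd N (0, w) z * (F z)\<^sup>2 - N z * (2 * F z * dd F (0, w) z)) / ((F z)\<^sup>2 * (F z)\<^sup>2)"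
    unfolding \<Phi>_def[abs_def] N_def[symmetric]
    by (subst dd_divide) (use z F_nonzero in \<open>auto simp: N_def sm dd_square\<close>)
  moreover have "dd N (0, w) z * (F z)\<^sup>2 - N z * (2 * F z * dd F (0, w) z)
      = 2 * (dd \<theta> w (fst z) \<bullet> snd z - dd \<theta> (snd z) (fst z) \<bullet> w) * (F z)\<^sup>2"
    using calculation(1) by algebra
  ultimately have "dd \<Phi> (0, w) z = (2 * (dd \<theta> w (fst z) \<bullet> snd z - dd \<theta> (snd z) (fst z) \<bullet> w) * (F z)\<^sup>2) / ((F z)\<^sup>2 * (F z)\<^sup>2)"
    by (simp only:)
  then show ?thesis
    using nonzero_mult_divide_mult_cancel_right[OF power_not_zero[OF F_nonzero[OF z]]] by (simp only:)
qed

text \<open>Otherwise \<open>\<Phi>\<close> would be strictly monotone along the closed curve \<open>cos t u + sin t v\<close>.\<close>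

lemma closed_theta:
  assumes x: "x \<in> U"
  shows "dd \<theta> u x \<bullet> v = dd \<theta> v x \<bullet> u"
proof (rule ccontr)
  define om where "om a b = dd \<theta> a x \<bullet> b - dd \<theta> b x \<bullet> a" for a b
  assume "dd \<theta> u x \<bullet> v \<noteq> dd \<theta> v x \<bullet> u"
  then have om0: "om u v \<noteq> 0" by (simp add: om_def)
  have lin: "linear (\<lambda>v. dd \<theta> v x)" by (rule linear_dd[OF sm_theta x])
  note L = linear_add[OF lin] linear_cmul[OF lin] linear_diff[OF lin] linear_neg[OF lin]
  define y where "y t = cos t *\<^sub>R u + sin t *\<^sub>R v" for t
  define y' where "y' t = - sin t *\<^sub>R u + cos t *\<^sub>R v" for t
  \<comment> \<open>\<open>y'\<close> is the derivative of \<open>y\<close>, and the two arise from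
    \<open>u\<close> and \<open>v\<close> by a matrix of determinant -1. The derivative of
    \<open>\<Phi>\<close> along the curve therefore has constant sign.\<close>
  have om_y: "om (y' t) (y t) = - om u v" for t
  proof -
    have "om (y' t) (y t) = - (sin t * sin t + cos t * cos t) * om u v"
      by (simp add: om_def y_def y'_def L inner_simps) algebra
    then show ?thesis using sin_cos_squared_add[of t] by algebra
  qed
  have y0: "y t \<noteq> 0" for t
    using om_y[of t] om0 linear_0[OF lin] by (auto simp: om_def)
  have zin: "(x, y t) \<in> Z" for t using x y0 by auto
  have dy: "((\<lambda>t. (x, y t)) has_derivative (\<lambda>h. (0, h *\<^sub>R y' t))) (at t)" for t
    unfolding y_def y'_def
    by (auto intro!: derivative_eq_intros has_derivative_Pair simp: algebra_simps)
  have der: "DERIV (\<lambda>t. \<Phi> (x, y t)) t :> 2 * om (y' t) (y t) / (F (x, y t))\<^sup>2" for t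
  proof -
    have "((\<lambda>t. \<Phi> (x, y t)) has_derivative (\<lambda>h. dd \<Phi> (0, h *\<^sub>R y' t) (x, y t))) (at t)"
      by (rule has_derivative_compose[OF dy smooth_on_has_derivative[OF sm_Phi zin]])
    moreover have "dd \<Phi> (0, h *\<^sub>R y' t) (x, y t) = 2 * om (y' t) (y t) / (F (x, y t))\<^sup>2 * h" for h
      using linear_cmul[OF linear_dd[OF sm_Phi zin[of t]], of h "(0, y' t)"] dd_Phi[OF zin[of t], of "y' t"]
      by (simp add: om_def)
    ultimately show ?thesis unfolding has_field_derivative_def by (simp only:)
  qed
  \<comment> \<open>The curve closes up after \<open>2 * pi\<close>, so \<open>\<Phi>\<close> has
    increment 0 and its derivative vanishes somewhere.\<close>
  have "\<exists>t. t > 0 \<and> t < 2 * pi \<and> \<Phi> (x, y (2 * pi)) - \<Phi> (x, y 0) = (2 * pi - 0) * (2 * om (y' t) (y t) / (F (x, y t))\<^sup>2)"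
    by (rule MVT2) (auto simp: der)
  then obtain t where "(2 * pi) * (2 * om (y' t) (y t) / (F (x, y t))\<^sup>2) = 0"
    by (auto simp: y_def)
  then show False
    using om_y[of t] om0 F_nonzero[OF zin[of t]] by simp
qed

text \<open>In dimension at least two the fibre without its origin is connected, and closedness of
  \<theta> makes the fibre derivative of \<open>\<Phi>\<close> vanish there.\<close>

lemma Phi_const:
  assumes dim: "DIM('a) \<ge> 2" and x: "x \<in> U" and y: "y \<noteq> 0" "y' \<noteq> 0"
  shows "\<Phi> (x, y) = \<Phi> (x, y')"
proof (rule has_derivative_zero_unique_connected[where f = "\<lambda>y. \<Phi> (x, y)" and s = "- {0::'a}"])
  show "open (- {0::'a})" by (simp add: open_Compl)
  show "connected (- {0::'a})" using connected_punctured_universe[of "0::'a"] dim by (simp add: Compl_eq_Diff_UNIV)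
next
  fix w :: 'a assume "w \<in> - {0}"
  then have zin: "(x, w) \<in> Z" using x by auto
  have "((\<lambda>y. (x, y)) has_derivative (\<lambda>h. (0, h))) (at w)"
    by (auto intro!: derivative_eq_intros)
  from has_derivative_compose[OF this smooth_on_has_derivative[OF sm_Phi zin]]
  show "((\<lambda>y. \<Phi> (x, y)) has_derivative (\<lambda>h. 0)) (at w)"
    using dd_Phi[OF zin] closed_theta[OF x] by simp
qed (use y in auto)

text \<open>Evaluation at one fixed nonzero direction makes smoothness in \<open>x\<close> immediate
  from that of \<open>\<Phi>\<close>.\<close>

definition \<tau> :: "'a \<Rightarrow> real" where "\<tau> x = \<Phi> (x, SOME b. b \<in> Basis)"

lemma some_Basis: "(SOME b. b \<in> Basis) \<in> (Basis :: 'a set)"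
  using some_in_eq nonempty_Basis by blast

lemma sm_tau: "smooth_on U \<tau>"
  unfolding \<tau>_def[abs_def] using some_Basis nonzero_Basis by (intro smooth_section[OF sm_Phi]) blast

lemma first_integral:
  assumes dim: "DIM('a) \<ge> 2" and z: "z \<in> Z"
  shows "2 * TH z * P z = A z + S0 z * F z + \<tau> (fst z) * (F z)\<^sup>2"
proof -
  have b: "(SOME b. b \<in> Basis) \<noteq> (0::'a)" using some_Basis nonzero_Basis by blast
  have "\<Phi> z = \<tau> (fst z)"
    using Phi_const[OF dim, of "fst z" "snd z" "SOME b. b \<in> Basis"] z b by (auto simp: \<tau>_def)
  then show ?thesis
    using F_nonzero[OF z] by (auto simp: \<Phi>_def field_simps)
qed

end

section \<open>Polynomial relations on lines in a fibre\<close>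

text \<open>A \<open>real poly poly\<close> is read as an element of \<real>[t][T]: the outer
  variable is \<open>T\<close>, and the coefficients are polynomials in \<open>t\<close>.\<close>

definition spec :: "real \<Rightarrow> real poly poly \<Rightarrow> real poly" where
  "spec t B = map_poly (\<lambda>c. poly c t) B"

lemma coeff_spec: "coeff (spec t B) i = poly (coeff B i) t"
  by (simp add: spec_def coeff_map_poly)

lemma spec_pCons [simp]: "spec t (pCons a B) = pCons (poly a t) (spec t B)"
  by (rule poly_eqI) (simp add: coeff_spec coeff_pCons split: nat.split)

lemma spec_0 [simp]: "spec t 0 = 0"
  by (simp add: spec_def)

lemma spec_add [simp]: "spec t (A + B) = spec t A + spec t B"
  by (rule poly_eqI) (simp add: coeff_spec)

lemma spec_smult [simp]: "spec t (smult a B) = smult (poly a t) (spec t B)"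
  by (rule poly_eqI) (simp add: coeff_spec)

lemma spec_mult [simp]: "spec t (A * B) = spec t A * spec t B"
  by (induction A) simp_all

lemma spec_dvd: "A dvd B \<Longrightarrow> spec t A dvd spec t B"
  by (metis dvd_def spec_mult)

lemma eventually_cofinite_poly_nonzero:
  fixes c :: "real poly"
  shows "c \<noteq> 0 \<Longrightarrow> eventually (\<lambda>t. poly c t \<noteq> 0) cofinite"
  by (simp add: eventually_cofinite poly_roots_finite)

text \<open>Gauss' lemma: the content is multiplicative and \<open>M\<close> has content 1, so
  \<open>a\<close> divides the content of the cofactor and can be cancelled there.\<close>

lemma content_one_dvd_cancel:
  fixes M B :: "real poly poly"
  assumes "content M = 1" "a \<noteq> 0" "M dvd smult a B"
  shows "M dvd B"
proof -
  obtain q where q: "smult a B = M * q" using assms(3) by (auto elim: dvdE)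
  have "a dvd content (smult a B)" by simp
  then have "a dvd content q" using assms(1) by (simp add: q content_mult)
  then obtain q' where "q = [:a:] * q'"
    using const_poly_dvd_iff_dvd_content by (blast elim: dvdE)
  then have "smult a B = smult a (M * q')" using q by simp
  then have "smult a (B - M * q') = 0" by (simp add: smult_diff_right)
  then have "B = M * q'" using assms(2) by simp
  then show ?thesis by simp
qed

text \<open>A primitive polynomial of least degree in \<open>T\<close> works, by pseudo-division and Gauss' lemma.\<close>

lemma least_degree_annihilator:
  fixes f g :: "real \<Rightarrow> real" and Q :: "real poly poly"
  defines "J \<equiv> (\<lambda>B. eventually (\<lambda>t. poly (spec t B) (f t) = 0 \<and> poly (spec t B) (g t) = 0) cofinite)"
  assumes "Q \<noteq> 0" "J Q"
  obtains M where "M \<noteq> 0" "J M" "\<And>B. J B \<Longrightarrow> M dvd B"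
proof -
  obtain M0 where M0: "M0 \<noteq> 0" "J M0" and least: "\<And>B. B \<noteq> 0 \<Longrightarrow> J B \<Longrightarrow> degree M0 \<le> degree B"
    using ex_has_least_nat[of "\<lambda>B. B \<noteq> 0 \<and> J B" Q degree] assms(2,3) by blast
  define M where "M = primitive_part M0"
  have M0_eq: "M0 = smult (content M0) M" by (simp add: M_def)
  have M: "M \<noteq> 0" "content M = 1" "degree M = degree M0"
    using M0(1) by (auto simp: M_def content_primitive_part)
  \<comment> \<open>Passing to the primitive part may lose the relation at the roots of the content;
    this is why \<open>J\<close> asks for cofinitely many \<open>t\<close> only.\<close>
  have "eventually (\<lambda>t. poly (content M0) t \<noteq> 0) cofinite"
    using M0(1) by (intro eventually_cofinite_poly_nonzero) simp
  then have JM: "J M"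
    using M0(2) unfolding J_def by eventually_elim (subst (asm) M0_eq, subst (asm) (2) M0_eq, simp)
  have "M dvd B" if "J B" for B
  proof -
    obtain a q where aq: "a \<noteq> 0" "smult a B = M * q + pseudo_mod B M"
      using pseudo_mod(1)[OF M(1), of B] by blast
    define R where "R = pseudo_mod B M"
    \<comment> \<open>The pseudo-remainder is a combination of \<open>B\<close> and
      \<open>M\<close>, so it is annihilated too; by minimality of the degree it must be 0.\<close>
    have "J R"
      using that JM unfolding J_def
    proof eventually_elim
      case (elim t)
      have "smult (poly a t) (spec t B) = spec t M * spec t q + spec t R"
        using arg_cong[OF aq(2), of "spec t"] by (simp add: R_def)
      from arg_cong[OF this, of "\<lambda>p. poly p (f t)"] arg_cong[OF this, of "\<lambda>p. poly p (g t)"] elim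
      show ?case by simp
    qed
    moreover have "R = 0 \<or> degree R < degree M"
      using pseudo_mod(2)[OF M(1)] by (simp add: R_def)
    ultimately have "R = 0" using least[of R] M(3) by (metis leD)
    then show ?thesis
      using content_one_dvd_cancel[OF M(2) aq(1), of B] aq(2) by (simp add: R_def)
  qed
  then show thesis using that M(1) JM by blast
qed

lemma coprime_linear_poly:
  fixes Y :: "real poly"
  assumes "poly Y a \<noteq> 0"
  shows "coprime [:- a, 1:] Y"
proof (rule coprimeI)
  fix d assume d: "d dvd [:- a, 1:]" "d dvd Y"
  then obtain e where e: "[:- a, 1:] = d * e" by (auto elim: dvdE)
  then have ne: "d \<noteq> 0" "e \<noteq> 0" by auto
  then have "degree d + degree e = 1"
    using degree_mult_eq[of d e] unfolding e[symmetric] by simp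
  moreover have "degree e \<noteq> 0"
  proof
    assume "degree e = 0"
    then obtain k where "e = [:k:]" by (metis degree_eq_zeroE)
    with e ne have "poly d a = 0" by (auto dest: arg_cong[of _ _ "\<lambda>p. poly p a"])
    then show False using d(2) assms by (auto elim!: dvdE)
  qed
  ultimately show "is_unit d"
    using ne by (simp add: is_unit_iff_degree)
qed

text \<open>Applying the derivation \<open>T X d/dT\<close> lowers the multiplicity of the roots of \<open>Y\<close> only,
  so that a common divisor of \<open>X Y\<close> and its first two derivatives divides \<open>X\<close>.\<close>

lemma common_divisor_derivation:
  fixes X Y D :: "real poly"
  defines "L \<equiv> (\<lambda>B. [:0, 1:] * X * pderiv B)"
  assumes cop: "coprime X Y" "poly Y 0 \<noteq> 0" and Y2: "pderiv (pderiv Y) = [:c:]" "c \<noteq> 0"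
    and D: "D dvd X * Y" "D dvd L (X * Y)" "D dvd L (L (X * Y))"
  shows "D dvd X"
proof -
  define T :: "real poly" where "T = [:0, 1:]"
  have pT: "pderiv T = 1" by (simp add: T_def pderiv_pCons)
  have L: "L = (\<lambda>B. T * X * pderiv B)" by (simp add: L_def T_def)
  \<comment> \<open>Modulo \<open>X * Y\<close> only the term in which \<open>Y\<close> is
    differentiated survives. Repeating this modulo that term brings in
    \<open>pderiv (pderiv Y)\<close>, a nonzero constant.\<close>
  have e1: "T * X * X * pderiv Y = L (X * Y) - T * pderiv X * (X * Y)"
    by (simp add: L pderiv_mult algebra_simps)
  then have D1: "D dvd T * X * X * pderiv Y"
    using D(1,2) by simp
  have "L (L (X * Y) - T * pderiv X * (X * Y)) = L (L (X * Y)) - pderiv (T * pderiv X) * T * X * (X * Y) - T * pderiv X * L (X * Y)"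
    unfolding L pderiv_diff pderiv_mult by algebra
  then have D2: "D dvd L (T * X * X * pderiv Y)"
    using D unfolding e1 by simp
  have "T * X * T * X * X * pderiv (pderiv Y) = L (T * X * X * pderiv Y) - (X + 2 * T * pderiv X) * (T * X * X * pderiv Y)"
    unfolding L pderiv_mult pT by algebra
  then have "D dvd T * X * T * X * X * [:c:]"
    using D1 D2 unfolding Y2(1) by simp
  then have "D dvd smult c (X * (T * X * T * X))"
    by (simp add: mult_ac)
  then have D3: "D dvd X * (T * X * T * X)"
    using Y2(2) by (rule dvd_smult_cancel)
  have "coprime T Y"
    using coprime_linear_poly[OF cop(2)] by (simp add: T_def)
  then have "coprime (T * X * T * X) Y"
    using cop(1) by (simp add: coprime_mult_left_iff)
  \<comment> \<open>\<open>D\<close> divides both arguments, and the factors besides the first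
    \<open>X\<close> on the left are coprime to \<open>Y\<close>.\<close>
  then have "gcd (X * (T * X * T * X)) (X * Y) = normalize X"
    using gcd_mult_left[of X "T * X * T * X" Y] by (simp add: coprime_iff_gcd_eq_1)
  then show ?thesis
    using D3 D(1) by (metis gcd_greatest dvd_normalize_iff)
qed

text \<open>The three relations are multiples of a least annihilator \<open>M\<close>. At
  \<open>t = 0\<close> it divides \<open>X\<close>, so its degree there is at most 2, and a constant
  leading coefficient carries this bound to every \<open>t\<close>. Having two different roots, it
  is quadratic, and Vieta's formulas give the sum and the product.\<close>

lemma symmetric_functions_polynomial:
  fixes f g :: "real \<Rightarrow> real" and Q Q1 Q2 :: "real poly poly" and X Y :: "real poly"
  defines "L \<equiv> (\<lambda>B. [:0, 1:] * X * pderiv B)"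
  assumes van: "\<And>t B. B \<in> {Q, Q1, Q2} \<Longrightarrow> poly (spec t B) (f t) = 0 \<and> poly (spec t B) (g t) = 0"
    and lead: "lead_coeff Q = [:k:]" "k \<noteq> 0"
    and Q: "spec 0 Q = X * Y" "spec 0 Q1 = L (X * Y)" "spec 0 Q2 = L (L (X * Y))"
    and cop: "coprime X Y" "poly Y 0 \<noteq> 0" and Y2: "pderiv (pderiv Y) = [:c:]" "c \<noteq> 0"
    and degX: "degree X = 2" and fg: "\<And>t. f t \<noteq> g t"
  shows "\<exists>m n. eventually (\<lambda>t. f t + g t = poly m t \<and> f t * g t = poly n t) cofinite"
proof -
  define J where "J = (\<lambda>B. eventually (\<lambda>t. poly (spec t B) (f t) = 0 \<and> poly (spec t B) (g t) = 0) cofinite)"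
  have JQ: "J B" if "B \<in> {Q, Q1, Q2}" for B
    using van[OF that] by (simp add: J_def)
  have "Q \<noteq> 0" using lead by auto
  then obtain M where M: "M \<noteq> 0" "J M" "\<forall>B. J B \<longrightarrow> M dvd B"
    using least_degree_annihilator[of Q f g] JQ[of Q] unfolding J_def by (smt (verit, ccfv_threshold) insertI1)
  have dvd: "M dvd Q" "M dvd Q1" "M dvd Q2" using M(3) JQ by simp_all
  then obtain q where "Q = M * q" by (auto elim: dvdE)
  \<comment> \<open>A divisor of a nonzero constant in \<real>[t] is constant. So all
    specializations have the same degree in \<open>T\<close>, and the division by \<open>l\<close>
    below stays polynomial.\<close>
  then have "lead_coeff M * lead_coeff q = [:k:]"
    using lead(1) by (simp add: lead_coeff_mult)
  then have "lead_coeff M dvd [:k:]" by (metis dvd_triv_left)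
  then have "degree (lead_coeff M) = 0"
    using lead(2) by (metis degree_pCons_0 dvd_imp_degree_le le_zero_eq pCons_eq_0_iff)
  then obtain l where l: "lead_coeff M = [:l:]" by (metis degree_eq_zeroE)
  with M(1) have l0: "l \<noteq> 0" by auto
  have degs: "degree (spec t M) = degree M" for t
    using l l0 by (intro antisym degree_le le_degree) (auto simp: coeff_spec coeff_eq_0)
  have "spec 0 M dvd X"
    using common_divisor_derivation[OF cop Y2, of "spec 0 M"] dvd[THEN spec_dvd[of _ _ 0]] Q
    unfolding L_def by simp
  moreover have "X \<noteq> 0" using degX by auto
  ultimately have "degree M \<le> 2"
    using degs[of 0] degX dvd_imp_degree_le by metis
  then have M_eq: "M = [:coeff M 0, coeff M 1, coeff M 2:]"
    by (intro poly_eqI) (auto simp: coeff_pCons coeff_eq_0 numeral_2_eq_2 split: nat.split)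
  have ev: "eventually (\<lambda>t. poly (spec t M) (f t) = 0 \<and> poly (spec t M) (g t) = 0) cofinite"
    using M(2) by (simp add: J_def)
  have val: "poly (spec t M) s = poly (coeff M 0) t + s * (poly (coeff M 1) t + s * poly (coeff M 2) t)" for t s
    by (subst M_eq) simp
  have "degree M = 2"
  proof (rule ccontr)
    assume "degree M \<noteq> 2"
    then have "degree M < 2" using \<open>degree M \<le> 2\<close> by simp
    then have c2: "coeff M 2 = 0" by (simp add: coeff_eq_0)
    \<comment> \<open>At one such \<open>t\<close> a polynomial of degree below 2 has two distinct
      roots, hence vanishes, against its nonzero leading coefficient.\<close>
    have "\<exists>t. poly (spec t M) (f t) = 0 \<and> poly (spec t M) (g t) = 0"
    proof (rule ccontr)
      assume "\<not> ?thesis"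
      then have "{t. \<not> (poly (spec t M) (f t) = 0 \<and> poly (spec t M) (g t) = 0)} = UNIV" by auto
      then show False using ev infinite_UNIV_char_0 unfolding eventually_cofinite by metis
    qed
    then obtain t where t: "poly (coeff M 0) t + f t * poly (coeff M 1) t = 0" "poly (coeff M 0) t + g t * poly (coeff M 1) t = 0"
      by (auto simp: val c2)
    then have "(f t - g t) * poly (coeff M 1) t = 0" by algebra
    then have "poly (coeff M 1) t = 0" "poly (coeff M 0) t = 0" using fg[of t] t by auto
    then have "spec t M = 0" by (subst M_eq) (simp add: c2)
    then show False using degs[of t] l l0 coeff_spec[of t M "degree M"] by auto
  qed
  then have c2: "coeff M 2 = [:l:]" using l by simp
  have "eventually (\<lambda>t. f t + g t = poly (smult (- (1/l)) (coeff M 1)) t \<and> f t * g t = poly (smult (1/l) (coeff M 0)) t) cofinite"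
    using ev
  proof eventually_elim
    case (elim t)
    then have e: "poly (coeff M 0) t + f t * (poly (coeff M 1) t + f t * l) = 0"
      "poly (coeff M 0) t + g t * (poly (coeff M 1) t + g t * l) = 0"
      by (auto simp: val c2)
    then have "(f t - g t) * (poly (coeff M 1) t + l * (f t + g t)) = 0" by algebra
    then have 1: "poly (coeff M 1) t = - l * (f t + g t)" using fg[of t] by simp
    then have 2: "poly (coeff M 0) t = l * (f t * g t)" using e(1) by algebra
    show ?case unfolding poly_smult 1 2 using l0 by simp
  qed
  then show ?thesis by blast
qed

text \<open>Here \<open>x\<close> is a base point, \<open>t\<close> the parameter of a line \<open>y = z + t w\<close> in the fibre, and \<open>T\<close> an
  unknown that stands for the value of \<open>F\<close> at \<open>(x, y)\<close>.\<close>

inductive pencil_poly :: "'a::real_normed_vector set \<Rightarrow> ('a \<Rightarrow> real \<Rightarrow> real \<Rightarrow> real) \<Rightarrow> bool" for U where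
  base: "smooth_on U c \<Longrightarrow> pencil_poly U (\<lambda>x t T. c x)"
| fst: "pencil_poly U (\<lambda>x t T. t)"
| snd: "pencil_poly U (\<lambda>x t T. T)"
| add: "pencil_poly U B \<Longrightarrow> pencil_poly U C \<Longrightarrow> pencil_poly U (\<lambda>x t T. B x t T + C x t T)"
| mult: "pencil_poly U B \<Longrightarrow> pencil_poly U C \<Longrightarrow> pencil_poly U (\<lambda>x t T. B x t T * C x t T)"

lemma pencil_poly_const: "pencil_poly U (\<lambda>x t T. k)"
  by (rule pencil_poly.base) (rule smooth_on_const)

lemma pencil_poly_diff:
  assumes "pencil_poly U B" "pencil_poly U C"
  shows "pencil_poly U (\<lambda>x t T. B x t T - C x t T)"
  using pencil_poly.add[OF assms(1) pencil_poly.mult[OF pencil_poly_const[of U "-1"] assms(2)]] by simp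

lemma pencil_poly_power: "pencil_poly U B \<Longrightarrow> pencil_poly U (\<lambda>x t T. B x t T ^ k)"
  by (induction k) (auto intro: pencil_poly_const pencil_poly.mult)

lemmas pencil_poly_intros = pencil_poly.fst pencil_poly.snd pencil_poly.add pencil_poly.mult pencil_poly_const
  pencil_poly_diff pencil_poly_power

lemma pencil_poly_at_0: "pencil_poly U B \<Longrightarrow> pencil_poly U (\<lambda>x t T. B x t 0)"
  by (induction rule: pencil_poly.induct) (auto intro: pencil_poly.intros pencil_poly_const)

lemma pencil_poly_spec: "pencil_poly U B \<Longrightarrow> \<exists>p. \<forall>t T. poly (spec t p) T = B x t T"
proof (induction rule: pencil_poly.induct)
  case (base c)
  then show ?case by (intro exI[of _ "[:[:c x:]:]"]) simp
next
  case fst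
  then show ?case by (intro exI[of _ "[:[:0, 1:]:]"]) simp
next
  case snd
  then show ?case by (intro exI[of _ "[:0, 1:]"]) simp
next
  case (add B C)
  then show ?case by (metis poly_add spec_add)
next
  case (mult B C)
  then show ?case by (metis poly_mult spec_mult)
qed

text \<open>\<open>DB\<close> is the derivative in \<open>x\<close> along \<open>z + t w\<close>
  with \<open>T\<close> held fixed, \<open>BT\<close> the partial derivative in \<open>T\<close>.
  The middle clause is the chain rule for \<open>T\<close> moving along a curve
  \<open>\<phi>\<close>, such as the values of \<open>F\<close> on the line.\<close>

definition pencil_derivs ::
    "'a::real_normed_vector set \<Rightarrow> 'a \<Rightarrow> 'a \<Rightarrow> ('a \<Rightarrow> real \<Rightarrow> real \<Rightarrow> real) \<Rightarrow> ('a \<Rightarrow> real \<Rightarrow> real \<Rightarrow> real) \<Rightarrow> ('a \<Rightarrow> real \<Rightarrow> real \<Rightarrow> real) \<Rightarrow> bool"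
where
  "pencil_derivs U z w B DB BT \<longleftrightarrow> pencil_poly U DB \<and> pencil_poly U BT
    \<and> (\<forall>x\<in>U. \<forall>t \<phi> \<phi>'. (\<phi> has_real_derivative \<phi>') (at 0) \<longrightarrow>
        ((\<lambda>s. B (x + s *\<^sub>R (z + t *\<^sub>R w)) t (\<phi> s)) has_real_derivative DB x t (\<phi> 0) + BT x t (\<phi> 0) * \<phi>') (at 0))
    \<and> (\<forall>x t T. ((\<lambda>T. B x t T) has_real_derivative BT x t T) (at T))"

lemma pencil_derivsD:
  assumes "pencil_derivs U z w B DB BT"
  shows "pencil_poly U DB" "pencil_poly U BT"
    and "x \<in> U \<Longrightarrow> (\<phi> has_real_derivative \<phi>') (at 0) \<Longrightarrow>
      ((\<lambda>s. B (x + s *\<^sub>R (z + t *\<^sub>R w)) t (\<phi> s)) has_real_derivative DB x t (\<phi> 0) + BT x t (\<phi> 0) * \<phi>') (at 0)"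
    and "((\<lambda>T. B x t T) has_real_derivative BT x t T) (at T)"
  using assms unfolding pencil_derivs_def by auto

text \<open>A smooth coefficient differentiated in direction \<open>z + t w\<close> becomes linear
  in \<open>t\<close>, so the class is closed under this derivation; sums and products follow by the
  Leibniz rule.\<close>

lemma pencil_derivs_exist:
  fixes U :: "'a::real_normed_vector set"
  assumes "open U" "pencil_poly U B"
  shows "\<exists>DB BT. pencil_derivs U z w B DB BT"
  using assms(2)
proof (induction rule: pencil_poly.induct)
  case (base c)
  have "((\<lambda>s. c (x + s *\<^sub>R (z + t *\<^sub>R w))) has_real_derivative dd c z x + t * dd c w x) (at 0)" if "x \<in> U" for x t
    using dd_along_line[of c x 0 "z + t *\<^sub>R w"] smooth_on_differentiable[OF base that]
      linear_add[OF linear_dd[OF base that]] linear_cmul[OF linear_dd[OF base that]] by simp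
  then have "pencil_derivs U z w (\<lambda>x t T. c x) (\<lambda>x t T. dd c z x + t * dd c w x) (\<lambda>x t T. 0)"
    unfolding pencil_derivs_def
    by (auto intro!: pencil_poly_intros pencil_poly.base smooth_on_dd base)
  then show ?case by blast
next
  case fst
  have "pencil_derivs U z w (\<lambda>x t T. t) (\<lambda>x t T. 0) (\<lambda>x t T. 0)"
    unfolding pencil_derivs_def by (auto intro!: pencil_poly_intros)
  then show ?case by blast
next
  case snd
  have "pencil_derivs U z w (\<lambda>x t T. T) (\<lambda>x t T. 0) (\<lambda>x t T. 1)"
    unfolding pencil_derivs_def by (auto intro!: pencil_poly_intros)
  then show ?case by blast
next
  case (add B C)
  then obtain DB BT DC CT where d: "pencil_derivs U z w B DB BT" "pencil_derivs U z w C DC CT"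
    by blast
  note B = pencil_derivsD[OF d(1)] and C = pencil_derivsD[OF d(2)]
  have "pencil_derivs U z w (\<lambda>x t T. B x t T + C x t T) (\<lambda>x t T. DB x t T + DC x t T) (\<lambda>x t T. BT x t T + CT x t T)"
    unfolding pencil_derivs_def
    by (intro conjI ballI allI impI pencil_poly_intros B(1,2) C(1,2) DERIV_add[OF B(4) C(4)])
       (rule DERIV_cong[OF DERIV_add[OF B(3) C(3)]], assumption+, algebra)
  then show ?case by blast
next
  case (mult B C)
  then obtain DB BT DC CT where d: "pencil_derivs U z w B DB BT" "pencil_derivs U z w C DC CT"
    by blast
  note B = pencil_derivsD[OF d(1)] and C = pencil_derivsD[OF d(2)]
  have "pencil_derivs U z w (\<lambda>x t T. B x t T * C x t T) (\<lambda>x t T. DB x t T * C x t T + DC x t T * B x t T)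
      (\<lambda>x t T. BT x t T * C x t T + CT x t T * B x t T)"
    unfolding pencil_derivs_def
    by (intro conjI ballI allI impI pencil_poly_intros mult.hyps B(1,2) C(1,2) DERIV_mult[OF B(4) C(4)])
       (rule DERIV_cong[OF DERIV_mult[OF B(3) C(3)]], assumption+, simp, algebra)
  then show ?case by blast
qed

section \<open>Differentiating relations along a line in the fibre\<close>

locale pencil =
  fixes U :: "'a::euclidean_space set" and \<theta> :: "'a \<Rightarrow> 'a" and \<sigma> \<tau> :: "'a \<Rightarrow> real" and z w :: 'a
  assumes open_U: "open U" and sm_theta: "smooth_on U \<theta>" and sm_sigma: "smooth_on U \<sigma>" and sm_tau: "smooth_on U \<tau>"
begin

definition th :: "'a \<Rightarrow> real \<Rightarrow> real" where "th x t = \<theta> x \<bullet> z + t * (\<theta> x \<bullet> w)"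
definition a :: "'a \<Rightarrow> real \<Rightarrow> real" where
  "a x t = dd \<theta> z x \<bullet> z + t * (dd \<theta> z x \<bullet> w + dd \<theta> w x \<bullet> z) + t * t * (dd \<theta> w x \<bullet> w)"
definition s0 :: "'a \<Rightarrow> real \<Rightarrow> real" where "s0 x t = dd \<sigma> z x + t * dd \<sigma> w x"
definition X :: "'a \<Rightarrow> real \<Rightarrow> real \<Rightarrow> real" where "X x t T = a x t + s0 x t * T + \<tau> x * T\<^sup>2"

lemma pp_th: "pencil_poly U (\<lambda>x t T. th x t)"
  unfolding th_def by (intro pencil_poly_intros pencil_poly.base smooth_on_inner[OF open_U] sm_theta smooth_on_const)

lemma pp_a: "pencil_poly U (\<lambda>x t T. a x t)"
  unfolding a_def
  by (intro pencil_poly_intros pencil_poly.base smooth_on_inner[OF open_U] smooth_on_dd sm_theta smooth_on_const)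

lemma pp_s0: "pencil_poly U (\<lambda>x t T. s0 x t)"
  unfolding s0_def by (intro pencil_poly_intros pencil_poly.base smooth_on_dd sm_sigma)

lemmas pp = pp_th pp_a pp_s0 pencil_poly.base[OF sm_sigma] pencil_poly.base[OF sm_tau]

lemma pp_X: "pencil_poly U X"
  unfolding X_def by (intro pencil_poly_intros pp)

text \<open>The equations are required at every base point of \<open>U\<close>, since relations
  derived from them are differentiated in \<open>x\<close>; \<open>t\<close> stays fixed while
  \<open>x\<close> moves in direction \<open>z + t w\<close>.\<close>

definition solution :: "('a \<Rightarrow> real \<Rightarrow> real) \<Rightarrow> ('a \<Rightarrow> real \<Rightarrow> real) \<Rightarrow> bool" where
  "solution f p \<longleftrightarrow> (\<forall>x\<in>U. \<forall>t.
     ((\<lambda>s. f (x + s *\<^sub>R (z + t *\<^sub>R w)) t) has_real_derivative 2 * f x t * p x t) (at 0) \<and>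
     ((\<lambda>s. p (x + s *\<^sub>R (z + t *\<^sub>R w)) t) has_real_derivative (p x t)\<^sup>2 - 3 * th x t * f x t - \<sigma> x * (f x t)\<^sup>2) (at 0) \<and>
     2 * th x t * p x t = X x t (f x t))"

lemma th_has_derivative:
  assumes "x \<in> U"
  shows "((\<lambda>s. th (x + s *\<^sub>R (z + t *\<^sub>R w)) t) has_real_derivative a x t) (at 0)"
proof -
  let ?c = "\<lambda>x. \<theta> x \<bullet> (z + t *\<^sub>R w)"
  have sm: "smooth_on U ?c" by (intro smooth_on_inner[OF open_U] sm_theta smooth_on_const)
  have "dd ?c (z + t *\<^sub>R w) x = dd \<theta> (z + t *\<^sub>R w) x \<bullet> (z + t *\<^sub>R w)"
    using smooth_on_differentiable[OF sm_theta assms] by (subst dd_inner) (auto simp: dd_const)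
  also have "\<dots> = a x t"
    using linear_add[OF linear_dd[OF sm_theta assms]] linear_cmul[OF linear_dd[OF sm_theta assms]]
    by (simp add: a_def algebra_simps inner_simps)
  moreover have "?c x = th x t" for x by (simp add: th_def inner_simps)
  ultimately show ?thesis
    using dd_along_line[of ?c x 0 "z + t *\<^sub>R w"] smooth_on_differentiable[OF sm assms] by simp
qed

text \<open>Differentiating \<open>B = 0\<close> gives \<open>DB + BT * (2 f p) = 0\<close>.
  Multiplying by \<open>th\<close> and replacing \<open>2 * th * p\<close> by \<open>X\<close>
  removes \<open>p\<close>. Where \<open>th\<close> vanishes at \<open>t = 0\<close>, only
  \<open>T X\<close> times the derivative in \<open>T\<close> is left.\<close>

lemma next_relation:
  assumes "pencil_poly U B"
  shows "\<exists>C. pencil_poly U C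
    \<and> (\<forall>f p. solution f p \<longrightarrow> (\<forall>x\<in>U. \<forall>t. B x t (f x t) = 0) \<longrightarrow> (\<forall>x\<in>U. \<forall>t. C x t (f x t) = 0))
    \<and> (\<forall>x b. \<theta> x \<bullet> z = 0 \<longrightarrow> (\<forall>T. B x 0 T = poly b T) \<longrightarrow> (\<forall>T. C x 0 T = T * X x 0 T * poly (pderiv b) T))"
proof -
  obtain DB BT where "pencil_derivs U z w B DB BT"
    using pencil_derivs_exist[OF open_U assms] by blast
  note D = pencil_derivsD[OF this]
  define C where "C = (\<lambda>x t T. th x t * DB x t T + T * X x t T * BT x t T)"
  have "pencil_poly U C"
    unfolding C_def by (intro pencil_poly_intros pp pp_X D(1,2))
  moreover have "C x t (f x t) = 0"
    if sol: "solution f p" and B0: "\<And>x t. x \<in> U \<Longrightarrow> B x t (f x t) = 0" and x: "x \<in> U" for f p x t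
  proof -
    have f: "((\<lambda>s. f (x + s *\<^sub>R (z + t *\<^sub>R w)) t) has_real_derivative 2 * f x t * p x t) (at 0)"
      and e: "2 * th x t * p x t = X x t (f x t)"
      using sol x by (auto simp: solution_def)
    have "((\<lambda>s. B (x + s *\<^sub>R (z + t *\<^sub>R w)) t (f (x + s *\<^sub>R (z + t *\<^sub>R w)) t)) has_real_derivative
        DB x t (f x t) + BT x t (f x t) * (2 * f x t * p x t)) (at 0)"
      using D(3)[OF x f] by simp
    moreover have "eventually (\<lambda>s. x + s *\<^sub>R (z + t *\<^sub>R w) \<in> U) (nhds 0)"
      by (rule eventually_nhds_in_open[of "(\<lambda>s. x + s *\<^sub>R (z + t *\<^sub>R w)) -` U", simplified])
         (use open_U x in \<open>auto intro!: open_vimage continuous_intros\<close>)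
    then have "((\<lambda>s. B (x + s *\<^sub>R (z + t *\<^sub>R w)) t (f (x + s *\<^sub>R (z + t *\<^sub>R w)) t)) has_real_derivative 0) (at 0)"
      by (subst DERIV_cong_ev[where g = "\<lambda>s. 0"]) (auto elim!: eventually_mono simp: B0)
    ultimately have "DB x t (f x t) + BT x t (f x t) * (2 * f x t * p x t) = 0"
      by (rule DERIV_unique)
    then show ?thesis
      using e unfolding C_def by algebra
  qed
  moreover have "C x 0 T = T * X x 0 T * poly (pderiv b) T"
    if "\<theta> x \<bullet> z = 0" "\<And>T. B x 0 T = poly b T" for x b T
  proof -
    have "((\<lambda>T. B x 0 T) has_real_derivative poly (pderiv b) T) (at T)"
      unfolding that(2) by (rule poly_DERIV)
    then have "BT x 0 T = poly (pderiv b) T"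
      using D(4)[of x 0 T] DERIV_unique by blast
    then show ?thesis using that(1) by (simp add: C_def th_def)
  qed
  ultimately show ?thesis by blast
qed

text \<open>Differentiating the first integral once more along the line eliminates \<open>p\<close>.\<close>

lemma quartic_relation:
  "\<exists>Q q3 q2 q1 q0. pencil_poly U Q
    \<and> (\<forall>f p. solution f p \<longrightarrow> (\<forall>x\<in>U. \<forall>t. Q x t (f x t) = 0))
    \<and> pencil_poly U (\<lambda>x t T. q3 x t) \<and> pencil_poly U (\<lambda>x t T. q2 x t) \<and> pencil_poly U (\<lambda>x t T. q1 x t) \<and> pencil_poly U (\<lambda>x t T. q0 x t)
    \<and> (\<forall>x\<in>U. \<forall>t T. Q x t T = 3 * (\<tau> x)\<^sup>2 * T ^ 4 + q3 x t * T ^ 3 + q2 x t * T\<^sup>2 + q1 x t * T + q0 x t)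
    \<and> (\<forall>x\<in>U. \<theta> x \<bullet> z = 0 \<longrightarrow> (\<forall>T. Q x 0 T = X x 0 T * (3 * \<tau> x * T\<^sup>2 + s0 x 0 * T - 3 * a x 0)))"
proof -
  have ex: "\<exists>D. pencil_poly U (\<lambda>x t T. D x t) \<and>
      (\<forall>x\<in>U. \<forall>t. ((\<lambda>s. c (x + s *\<^sub>R (z + t *\<^sub>R w)) t) has_real_derivative D x t) (at 0))"
    if c: "pencil_poly U (\<lambda>x t T. c x t)" for c
  proof -
    obtain DB BT where "pencil_derivs U z w (\<lambda>x t T. c x t) DB BT"
      using pencil_derivs_exist[OF open_U c] by blast
    note D = pencil_derivsD[OF this]
    show ?thesis
      using D(3)[OF _ DERIV_const[of 0]] by (intro exI[of _ "\<lambda>x t. DB x t 0"]) (auto intro!: pencil_poly_at_0 D(1))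
  qed
  obtain a1 where a1: "pencil_poly U (\<lambda>x t T. a1 x t)"
    "\<And>x t. x \<in> U \<Longrightarrow> ((\<lambda>s. a (x + s *\<^sub>R (z + t *\<^sub>R w)) t) has_real_derivative a1 x t) (at 0)"
    using ex[OF pp_a] by blast
  obtain s1 where s1: "pencil_poly U (\<lambda>x t T. s1 x t)"
    "\<And>x t. x \<in> U \<Longrightarrow> ((\<lambda>s. s0 (x + s *\<^sub>R (z + t *\<^sub>R w)) t) has_real_derivative s1 x t) (at 0)"
    using ex[OF pp_s0] by blast
  obtain t1 where t1: "pencil_poly U (\<lambda>x t T. t1 x t)"
    "\<And>x t. x \<in> U \<Longrightarrow> ((\<lambda>s. \<tau> (x + s *\<^sub>R (z + t *\<^sub>R w))) has_real_derivative t1 x t) (at 0)"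
    using ex[of "\<lambda>x t. \<tau> x"] pencil_poly.base[OF sm_tau] by blast
  \<comment> \<open>Apply \<open>D\<close> to \<open>2 * th * p = X\<close>, multiply by
    \<open>2 * th\<close>, and replace every \<open>2 * th * p\<close> by \<open>X\<close>; the last
    two terms come from the equation for \<open>D p\<close>.\<close>
  define Q where "Q = (\<lambda>x t T. 2 * (th x t * (a1 x t + s1 x t * T + t1 x t * T\<^sup>2) + T * X x t T * (s0 x t + 2 * \<tau> x * T))
     - 2 * a x t * X x t T - (X x t T)\<^sup>2 + 12 * (th x t) ^ 3 * T + 4 * \<sigma> x * (th x t)\<^sup>2 * T\<^sup>2)"
  have "pencil_poly U Q"
    unfolding Q_def by (intro pencil_poly_intros pp pp_X a1(1) s1(1) t1(1))
  moreover have "Q x t (f x t) = 0" if sol: "solution f p" and x: "x \<in> U" for f p x t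
  proof -
    have f: "((\<lambda>s. f (x + s *\<^sub>R (z + t *\<^sub>R w)) t) has_real_derivative 2 * f x t * p x t) (at 0)"
      and p: "((\<lambda>s. p (x + s *\<^sub>R (z + t *\<^sub>R w)) t) has_real_derivative (p x t)\<^sup>2 - 3 * th x t * f x t - \<sigma> x * (f x t)\<^sup>2) (at 0)"
      and e: "2 * th x t * p x t = X x t (f x t)"
      using sol x by (auto simp: solution_def)
    have "((\<lambda>s. X (x + s *\<^sub>R (z + t *\<^sub>R w)) t (f (x + s *\<^sub>R (z + t *\<^sub>R w)) t)) has_real_derivative
        a1 x t + s1 x t * f x t + t1 x t * (f x t)\<^sup>2 + (s0 x t + 2 * \<tau> x * f x t) * (2 * f x t * p x t)) (at 0)"
      unfolding X_def power2_eq_square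
      by (rule DERIV_cong, (rule DERIV_add DERIV_mult a1(2) s1(2) t1(2) f x)+) (simp add: algebra_simps)
    moreover have "eventually (\<lambda>s. x + s *\<^sub>R (z + t *\<^sub>R w) \<in> U) (nhds 0)"
      by (rule eventually_nhds_in_open[of "(\<lambda>s. x + s *\<^sub>R (z + t *\<^sub>R w)) -` U", simplified])
         (use open_U x in \<open>auto intro!: open_vimage continuous_intros\<close>)
    then have "((\<lambda>s. X (x + s *\<^sub>R (z + t *\<^sub>R w)) t (f (x + s *\<^sub>R (z + t *\<^sub>R w)) t)) has_real_derivative
        2 * (a x t * p x t + th x t * ((p x t)\<^sup>2 - 3 * th x t * f x t - \<sigma> x * (f x t)\<^sup>2))) (at 0)"
    proof (subst DERIV_cong_ev[where g = "\<lambda>s. 2 * (th (x + s *\<^sub>R (z + t *\<^sub>R w)) t * p (x + s *\<^sub>R (z + t *\<^sub>R w)) t)"])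
      show "((\<lambda>s. 2 * (th (x + s *\<^sub>R (z + t *\<^sub>R w)) t * p (x + s *\<^sub>R (z + t *\<^sub>R w)) t)) has_real_derivative
        2 * (a x t * p x t + th x t * ((p x t)\<^sup>2 - 3 * th x t * f x t - \<sigma> x * (f x t)\<^sup>2))) (at 0)"
        by (rule DERIV_cmult, rule DERIV_cong, rule DERIV_mult[OF th_has_derivative[OF x] p]) simp
    qed (use sol in \<open>auto elim!: eventually_mono simp: solution_def mult.assoc\<close>)
    ultimately have "a1 x t + s1 x t * f x t + t1 x t * (f x t)\<^sup>2 + (s0 x t + 2 * \<tau> x * f x t) * (2 * f x t * p x t)
       = 2 * (a x t * p x t + th x t * ((p x t)\<^sup>2 - 3 * th x t * f x t - \<sigma> x * (f x t)\<^sup>2))"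
      by (rule DERIV_unique)
    then show ?thesis
      unfolding Q_def using e by algebra
  qed
  \<comment> \<open>The leading coefficient is \<open>4 * (\<tau> x)\<^sup>2\<close> from
    \<open>2 * T * X * (2 * \<tau> * T)\<close>, less \<open>(\<tau> x)\<^sup>2\<close> from the
    square of \<open>X\<close>.\<close>
  moreover have "Q x t T = 3 * (\<tau> x)\<^sup>2 * T ^ 4 + (4 * s0 x t * \<tau> x) * T ^ 3
      + (2 * th x t * t1 x t + (s0 x t)\<^sup>2 + 4 * \<sigma> x * (th x t)\<^sup>2) * T\<^sup>2
      + (2 * th x t * s1 x t - 2 * a x t * s0 x t + 12 * (th x t) ^ 3) * T
      + (2 * th x t * a1 x t - 3 * (a x t)\<^sup>2)" for x t T
    unfolding Q_def X_def by algebra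
  moreover have "Q x 0 T = X x 0 T * (3 * \<tau> x * T\<^sup>2 + s0 x 0 * T - 3 * a x 0)" if "\<theta> x \<bullet> z = 0" for x T
  proof -
    have th0: "th x 0 = 0" using that by (simp add: th_def)
    show ?thesis unfolding Q_def X_def th0 by (simp add: power2_eq_square algebra_simps)
  qed
  moreover have "pencil_poly U (\<lambda>x t T. 4 * s0 x t * \<tau> x)"
     "pencil_poly U (\<lambda>x t T. 2 * th x t * t1 x t + (s0 x t)\<^sup>2 + 4 * \<sigma> x * (th x t)\<^sup>2)"
     "pencil_poly U (\<lambda>x t T. 2 * th x t * s1 x t - 2 * a x t * s0 x t + 12 * (th x t) ^ 3)"
     "pencil_poly U (\<lambda>x t T. 2 * th x t * a1 x t - 3 * (a x t)\<^sup>2)"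
    by (intro pencil_poly_intros pp a1(1) s1(1) t1(1))+
  ultimately show ?thesis
    by (intro exI[of _ Q] exI[of _ "\<lambda>x t. 4 * s0 x t * \<tau> x"]
        exI[of _ "\<lambda>x t. 2 * th x t * t1 x t + (s0 x t)\<^sup>2 + 4 * \<sigma> x * (th x t)\<^sup>2"]
        exI[of _ "\<lambda>x t. 2 * th x t * s1 x t - 2 * a x t * s0 x t + 12 * (th x t) ^ 3"]
        exI[of _ "\<lambda>x t. 2 * th x t * a1 x t - 3 * (a x t)\<^sup>2"] conjI allI ballI impI)
qed

theorem pencil_symmetric_functions:
  assumes sol: "solution f p" "solution g q" and x: "x \<in> U" and z: "\<theta> x \<bullet> z = 0" and tau: "\<tau> x \<noteq> 0"
    and pos: "\<And>t. f x t > 0" "\<And>t. g x t < 0"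
  shows "\<exists>m n. eventually (\<lambda>t. f x t + g x t = poly m t \<and> f x t * g x t = poly n t) cofinite"
proof -
  obtain Q q3 q2 q1 q0 where Q: "pencil_poly U Q"
    "\<forall>f p. solution f p \<longrightarrow> (\<forall>x\<in>U. \<forall>t. Q x t (f x t) = 0)"
    and q: "pencil_poly U (\<lambda>x t T. q3 x t)" "pencil_poly U (\<lambda>x t T. q2 x t)" "pencil_poly U (\<lambda>x t T. q1 x t)" "pencil_poly U (\<lambda>x t T. q0 x t)"
    and Qq: "\<forall>x\<in>U. \<forall>t T. Q x t T = 3 * (\<tau> x)\<^sup>2 * T ^ 4 + q3 x t * T ^ 3 + q2 x t * T\<^sup>2 + q1 x t * T + q0 x t"
    and Q0: "\<forall>x\<in>U. \<theta> x \<bullet> z = 0 \<longrightarrow> (\<forall>T. Q x 0 T = X x 0 T * (3 * \<tau> x * T\<^sup>2 + s0 x 0 * T - 3 * a x 0))"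
    using quartic_relation by (elim exE conjE) (rule that, assumption+)
  note Qq = Qq[rule_format] and Q0 = Q0[rule_format]
  have coeff: "\<exists>c. \<forall>t. poly c t = r x t" if r: "pencil_poly U (\<lambda>x t T. r x t)" for r
  proof -
    obtain P where "\<And>t T. poly (spec t P) T = r x t" using pencil_poly_spec[OF r, of x] by blast
    then have "poly (spec t P) 0 = r x t" for t by blast
    then show ?thesis by (intro exI[of _ "coeff P 0"]) (simp add: poly_0_coeff_0 coeff_spec)
  qed
  obtain c3 c2 c1 c0 where c: "\<And>t. poly c3 t = q3 x t" "\<And>t. poly c2 t = q2 x t" "\<And>t. poly c1 t = q1 x t" "\<And>t. poly c0 t = q0 x t"
    using coeff[OF q(1)] coeff[OF q(2)] coeff[OF q(3)] coeff[OF q(4)] by metis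
  \<comment> \<open>Built from explicit coefficients in order to read off that the leading one is
    constant.\<close>
  define PQ where "PQ = [:c0, c1, c2, c3, [:3 * (\<tau> x)\<^sup>2:]:]"
  have PQ: "poly (spec t PQ) T = Q x t T" for t T
    unfolding PQ_def Qq[OF x] by (simp add: c algebra_simps power2_eq_square power3_eq_cube power4_eq_xxxx)
  obtain Q1 where Q1: "pencil_poly U Q1"
    "\<forall>f p. solution f p \<longrightarrow> (\<forall>x\<in>U. \<forall>t. Q x t (f x t) = 0) \<longrightarrow> (\<forall>x\<in>U. \<forall>t. Q1 x t (f x t) = 0)"
    "\<forall>x b. \<theta> x \<bullet> z = 0 \<longrightarrow> (\<forall>T. Q x 0 T = poly b T) \<longrightarrow> (\<forall>T. Q1 x 0 T = T * X x 0 T * poly (pderiv b) T)"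
    using next_relation[OF Q(1)] by (elim exE conjE) (rule that)
  obtain Q2 where Q2: "pencil_poly U Q2"
    "\<forall>f p. solution f p \<longrightarrow> (\<forall>x\<in>U. \<forall>t. Q1 x t (f x t) = 0) \<longrightarrow> (\<forall>x\<in>U. \<forall>t. Q2 x t (f x t) = 0)"
    "\<forall>x b. \<theta> x \<bullet> z = 0 \<longrightarrow> (\<forall>T. Q1 x 0 T = poly b T) \<longrightarrow> (\<forall>T. Q2 x 0 T = T * X x 0 T * poly (pderiv b) T)"
    using next_relation[OF Q1(1)] by (elim exE conjE) (rule that)
  obtain P1 where P1: "\<And>t T. poly (spec t P1) T = Q1 x t T" using pencil_poly_spec[OF Q1(1)] by blast
  obtain P2 where P2: "\<And>t T. poly (spec t P2) T = Q2 x t T" using pencil_poly_spec[OF Q2(1)] by blast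
  define X0 where "X0 = [:a x 0, s0 x 0, \<tau> x:]"
  define Y0 where "Y0 = [:- 3 * a x 0, s0 x 0, 3 * \<tau> x:]"
  have X0: "poly X0 T = X x 0 T" for T by (simp add: X0_def X_def algebra_simps power2_eq_square)
  have e0: "spec 0 PQ = X0 * Y0"
    by (intro poly_eqI_degree_lead_coeff poly_ext) (simp_all add: PQ Q0[OF x z] X0 Y0_def algebra_simps power2_eq_square)
  have e1: "spec 0 P1 = [:0, 1:] * X0 * pderiv (X0 * Y0)"
    by (rule poly_ext) (use Q1(3)[rule_format, OF z, of "X0 * Y0"] PQ[of 0] e0 in \<open>auto simp: P1 X0\<close>)
  have e2: "spec 0 P2 = [:0, 1:] * X0 * pderiv ([:0, 1:] * X0 * pderiv (X0 * Y0))"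
    by (rule poly_ext) (use Q2(3)[rule_format, OF z, of "[:0, 1:] * X0 * pderiv (X0 * Y0)"] P1[of 0] e1 in \<open>auto simp: P2 X0\<close>)
  \<comment> \<open>At \<open>t = 0\<close> the left side of the first integral vanishes, so both
    values are roots of \<open>X0\<close>; being distinct, they determine \<open>s0\<close> and
    \<open>a\<close>.\<close>
  have r: "X x 0 (f x 0) = 0" "X x 0 (g x 0) = 0"
    using sol x z by (auto simp: solution_def th_def dest!: bspec[of _ _ x] spec[of _ "0::real"])
  have ne: "f x 0 \<noteq> g x 0" "f x 0 > 0" "g x 0 < 0" using pos[of 0] by auto
  from r have "(f x 0 - g x 0) * (s0 x 0 + \<tau> x * (f x 0 + g x 0)) = 0" unfolding X_def by algebra
  then have s: "s0 x 0 = - \<tau> x * (f x 0 + g x 0)" using ne by simp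
  then have A: "a x 0 = \<tau> x * (f x 0 * g x 0)" using r(1) unfolding X_def by algebra
  have X0_eq: "X0 = [:\<tau> x:] * ([:- f x 0, 1:] * [:- g x 0, 1:])"
    by (simp add: X0_def s A algebra_simps)
  \<comment> \<open>Neither value is 0 because \<open>f\<close> and \<open>g\<close> have opposite
    signs: \<open>f - 2 g\<close> is positive and \<open>g - 2 f\<close> negative.\<close>
  have "poly Y0 (f x 0) = 2 * \<tau> x * f x 0 * (f x 0 - 2 * g x 0)"
    "poly Y0 (g x 0) = 2 * \<tau> x * g x 0 * (g x 0 - 2 * f x 0)"
    by (simp_all add: Y0_def s A algebra_simps)
  then have "coprime [:- f x 0, 1:] Y0" "coprime [:- g x 0, 1:] Y0"
    using ne tau by (auto intro!: coprime_linear_poly)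
  moreover have "coprime [:\<tau> x:] Y0"
    using tau by (intro is_unit_left_imp_coprime) (simp add: is_unit_const_poly_iff dvd_field_iff)
  ultimately have "coprime X0 Y0"
    unfolding X0_eq coprime_mult_left_iff by simp
  moreover have "poly Y0 0 \<noteq> 0" using ne tau by (simp add: Y0_def A)
  moreover have "pderiv (pderiv Y0) = [:6 * \<tau> x:]" by (simp add: Y0_def pderiv_pCons)
  moreover have "degree X0 = 2" using tau by (simp add: X0_def)
  moreover have "poly (spec t B) (f x t) = 0 \<and> poly (spec t B) (g x t) = 0" if "B \<in> {PQ, P1, P2}" for t B
  proof -
    have "Q x t (f x t) = 0" "Q x t (g x t) = 0" "Q1 x t (f x t) = 0" "Q1 x t (g x t) = 0" "Q2 x t (f x t) = 0" "Q2 x t (g x t) = 0"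
      using Q(2)[rule_format] Q1(2)[rule_format] Q2(2)[rule_format] sol x by metis+
    then show ?thesis using that by (auto simp: PQ P1 P2)
  qed
  moreover have "lead_coeff PQ = [:3 * (\<tau> x)\<^sup>2:]" using tau by (simp add: PQ_def)
  moreover have "f x t \<noteq> g x t" for t using pos[of t] by simp
  ultimately show ?thesis
    using symmetric_functions_polynomial[of PQ P1 P2 "f x" "g x" "3 * (\<tau> x)\<^sup>2" X0 Y0 "6 * \<tau> x"] e0 e1 e2 tau by simp
qed

end

section \<open>The two solutions of the first integral\<close>

lemma degree_le_of_limit:
  fixes m :: "real poly"
  assumes eq: "\<And>s. s > 0 \<Longrightarrow> s ^ k * poly m (1 / s) = \<rho> s" and lim: "(\<rho> \<longlongrightarrow> L) (at_right 0)"
  shows "degree m \<le> k" "coeff m k = L"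
proof -
  \<comment> \<open>Reversing the coefficients turns growth at infinity into behaviour at 0:
    \<open>poly ?r\<close> tends to the leading coefficient, and for \<open>s > 0\<close> it differs
    from \<open>\<rho> s\<close> by a power of \<open>s\<close>.\<close>
  let ?r = "reflect_poly m"
  have r0: "(poly ?r \<longlongrightarrow> lead_coeff m) (at_right 0)"
    using poly_isCont[where p = ?r and x = 0] by (auto simp: isCont_def poly_reflect_poly_0 intro: tendsto_within_subset)
  have rs: "poly ?r s = s ^ degree m * poly m (1 / s)" if "s > 0" for s
    using poly_reflect_poly_nz[of s m] that by (simp add: inverse_eq_divide)
  have id: "((\<lambda>s::real. s) \<longlongrightarrow> 0) (at_right 0)" by (rule tendsto_ident_at)
  show le: "degree m \<le> k"
  proof (rule ccontr)
    assume "\<not> degree m \<le> k"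
    then obtain j where j: "degree m = k + Suc j" by (metis less_iff_Suc_add not_le add_Suc_right)
    have "((\<lambda>s. s ^ Suc j * \<rho> s) \<longlongrightarrow> 0 ^ Suc j * L) (at_right 0)"
      by (intro tendsto_intros id lim)
    moreover have "eventually (\<lambda>s. s ^ Suc j * \<rho> s = poly ?r s) (at_right 0)"
      by (rule eventually_at_right_less[THEN eventually_mono]) (simp add: rs eq[symmetric] j power_add)
    ultimately have "(poly ?r \<longlongrightarrow> 0) (at_right 0)"
      by (auto intro: Lim_transform_eventually)
    then have "lead_coeff m = 0" using r0 tendsto_unique trivial_limit_at_right_real by blast
    then have "m = 0" by (simp only: leading_coeff_0_iff)
    then show False using j by simp
  qed
  then obtain j where j: "k = degree m + j" using le_iff_add by blast
  have "((\<lambda>s. s ^ j * poly ?r s) \<longlongrightarrow> 0 ^ j * lead_coeff m) (at_right 0)"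
    by (intro tendsto_intros id r0)
  moreover have "eventually (\<lambda>s. s ^ j * poly ?r s = \<rho> s) (at_right 0)"
    by (rule eventually_at_right_less[THEN eventually_mono]) (simp add: rs eq[symmetric] j power_add)
  ultimately have "(\<rho> \<longlongrightarrow> 0 ^ j * lead_coeff m) (at_right 0)"
    by (rule Lim_transform_eventually)
  then have "L = 0 ^ j * lead_coeff m"
    using lim tendsto_unique trivial_limit_at_right_real by blast
  then show "coeff m k = L"
    by (cases j) (auto simp: j coeff_eq_0)
qed

lemma eventually_cofinite_eq_continuous:
  fixes f g :: "real \<Rightarrow> real"
  assumes "eventually (\<lambda>t. f t = g t) cofinite" "continuous_on UNIV f" "continuous_on UNIV g"
  shows "f t = g t"
proof -
  have "closed {t. f t = g t}" using assms by (intro closed_Collect_eq)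
  moreover have "closure {t. f t = g t} = UNIV"
  proof -
    have "finite (- {t. f t = g t})" using assms(1) by (simp add: eventually_cofinite Collect_neg_eq)
    then have "interior (- {t. f t = g t}) = {}" by (rule empty_interior_finite)
    then show ?thesis using closure_complement[of "- {t. f t = g t}"] by simp
  qed
  ultimately show ?thesis using closure_closed by blast
qed

lemma continuous_zero_on_closure:
  fixes f :: "'a::metric_space \<Rightarrow> real"
  assumes "open U" "continuous_on U f" "\<And>x. x \<in> V \<Longrightarrow> x \<in> U \<Longrightarrow> f x = 0" "x \<in> U" "x \<in> closure V"
  shows "f x = 0"
proof (rule ccontr)
  assume "f x \<noteq> 0"
  then have "x \<in> U \<inter> f -` (- {0})" using assms(4) by auto
  moreover have "open (U \<inter> f -` (- {0}))"
    using continuous_open_preimage[OF assms(2,1), of "- {0}"] by (simp add: open_Compl)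
  ultimately obtain y where "y \<in> V" "y \<in> U" "f y \<noteq> 0"
    using assms(5) by (auto simp: closure_iff_nhds_not_empty)
  then show False using assms(3) by blast
qed

text \<open>Gronwall's argument: with \<open>K\<close> bounding the coefficients, the derivative of
  \<open>a\<^sup>2 + b\<^sup>2\<close> is at most \<open>4 * K\<close> times itself, so the weighted
  energy \<open>E\<close> does not increase from its initial value 0.\<close>

lemma linear_system_zero:
  fixes a b :: "real \<Rightarrow> real"
  assumes a: "\<And>t. 0 \<le> t \<Longrightarrow> t \<le> 1 \<Longrightarrow> (a has_real_derivative \<alpha> t * a t + \<beta> t * b t) (at t)"
    and b: "\<And>t. 0 \<le> t \<Longrightarrow> t \<le> 1 \<Longrightarrow> (b has_real_derivative \<gamma> t * a t) (at t)"
    and cont: "continuous_on {0..1} \<alpha>" "continuous_on {0..1} \<beta>" "continuous_on {0..1} \<gamma>"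
    and zero: "a 0 = 0" "b 0 = 0"
  shows "a 1 = 0" "b 1 = 0"
proof -
  have "\<exists>K. \<forall>t\<in>{0..1}. \<bar>f t\<bar> \<le> K" if "continuous_on {0..1} f" for f :: "real \<Rightarrow> real"
    using compact_imp_bounded[OF compact_continuous_image[OF that compact_Icc]]
    by (auto simp: bounded_iff)
  then obtain K1 K2 K3 where K': "\<And>t. t \<in> {0..1} \<Longrightarrow> \<bar>\<alpha> t\<bar> \<le> K1" "\<And>t. t \<in> {0..1} \<Longrightarrow> \<bar>\<beta> t\<bar> \<le> K2" "\<And>t. t \<in> {0..1} \<Longrightarrow> \<bar>\<gamma> t\<bar> \<le> K3"
    using cont by meson
  define K where "K = max K1 (max K2 K3)"
  have K: "\<bar>\<alpha> t\<bar> \<le> K" "\<bar>\<beta> t\<bar> \<le> K" "\<bar>\<gamma> t\<bar> \<le> K" if "0 \<le> t" "t \<le> 1" for t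
    using K'[of t] that by (auto simp: K_def le_max_iff_disj)
  define E where "E = (\<lambda>t. ((a t)\<^sup>2 + (b t)\<^sup>2) * exp (- (4 * K) * t))"
  have "E 1 \<le> E 0"
  proof (rule DERIV_nonpos_imp_nonincreasing[of 0 1 E])
    fix t :: real assume t: "0 \<le> t" "t \<le> 1"
    let ?d = "2 * a t * (\<alpha> t * a t + \<beta> t * b t) + 2 * b t * (\<gamma> t * a t) - 4 * K * ((a t)\<^sup>2 + (b t)\<^sup>2)"
    have "(E has_real_derivative ?d * exp (- (4 * K) * t)) (at t)"
      unfolding E_def
      by (auto intro!: derivative_eq_intros a[OF t] b[OF t] simp: algebra_simps power2_eq_square)
    moreover have "?d \<le> 0"
    proof -
      have 1: "\<alpha> t * (a t)\<^sup>2 \<le> K * (a t)\<^sup>2"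
        using K(1)[OF t] by (intro mult_right_mono) auto
      have ab: "2 * \<bar>a t * b t\<bar> \<le> (a t)\<^sup>2 + (b t)\<^sup>2"
        using sum_squares_bound[of "\<bar>a t\<bar>" "\<bar>b t\<bar>"] by (simp add: abs_mult)
      have "(\<beta> t + \<gamma> t) * (a t * b t) \<le> (2 * K) * \<bar>a t * b t\<bar>"
      proof -
        have "(\<beta> t + \<gamma> t) * (a t * b t) \<le> \<bar>\<beta> t + \<gamma> t\<bar> * \<bar>a t * b t\<bar>"
          unfolding abs_mult[symmetric] by (rule abs_ge_self)
        also have "\<dots> \<le> (2 * K) * \<bar>a t * b t\<bar>"
          by (rule mult_right_mono) (use K[OF t] in auto)
        finally show ?thesis .
      qed
      also have "\<dots> \<le> K * ((a t)\<^sup>2 + (b t)\<^sup>2)"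
        using mult_left_mono[OF ab, of K] K(1)[OF t] by (simp add: algebra_simps)
      finally have 2: "(\<beta> t + \<gamma> t) * (a t * b t) \<le> K * ((a t)\<^sup>2 + (b t)\<^sup>2)" .
      have 3: "K * (a t)\<^sup>2 \<le> K * ((a t)\<^sup>2 + (b t)\<^sup>2)"
        using K(1)[OF t] by (intro mult_left_mono) auto
      have "?d = 2 * (\<alpha> t * (a t)\<^sup>2) + 2 * ((\<beta> t + \<gamma> t) * (a t * b t)) - 4 * (K * ((a t)\<^sup>2 + (b t)\<^sup>2))"
        by algebra
      then show ?thesis using 1 2 3 by linarith
    qed
    ultimately show "\<exists>y. (E has_real_derivative y) (at t) \<and> y \<le> 0"
      by (meson exp_ge_zero mult_nonpos_nonneg)
  qed simp
  then have "(a 1)\<^sup>2 + (b 1)\<^sup>2 \<le> 0"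
    by (simp add: E_def zero mult_le_0_iff)
  then show "a 1 = 0" "b 1 = 0"
    by (simp_all add: sum_power2_le_zero_iff)
qed

lemma dense_complement_eq:
  fixes f g :: "'a::euclidean_space \<Rightarrow> real"
  assumes "continuous_on UNIV f" "continuous_on UNIV g" "\<And>w. w \<notin> S \<Longrightarrow> f w = g w" "interior S = {}"
  shows "f w = g w"
proof -
  have "closed {w. f w = g w}" using assms by (intro closed_Collect_eq)
  moreover have "closure (- S) = UNIV" using assms(4) by (simp add: closure_complement)
  moreover have "- S \<subseteq> {w. f w = g w}" using assms(3) by auto
  ultimately have "UNIV \<subseteq> {w. f w = g w}" using closure_minimal by metis
  then show ?thesis by auto
qed

lemma not_in_span_singleton_swap:
  assumes "y \<noteq> 0" "w \<notin> span {y}"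
  shows "y \<notin> span {w}"
proof
  assume "y \<in> span {w}"
  then obtain k where k: "y = k *\<^sub>R w" by (auto simp: span_singleton)
  with assms(1) have "w = (1 / k) *\<^sub>R y" by auto
  then show False using assms(2) by (auto simp: span_singleton)
qed

section \<open>The metric and its reverse\<close>

locale finsler_pair = flat_pair +
  assumes dim: "DIM('a) \<ge> 2"
    and F_pos: "z \<in> Z \<Longrightarrow> F z > 0"
    and F_zero: "F (x, 0) = 0"
    and F_hom: "x \<in> U \<Longrightarrow> l > 0 \<Longrightarrow> F (x, l *\<^sub>R y) = l * F (x, y)"
begin

text \<open>\<open>(FN, PN)\<close> is a second, negative solution of the equations for \<open>(F, P)\<close>; every polynomial relation
  that follows from these equations therefore has two roots.\<close>

definition FN :: "'a \<times> 'a \<Rightarrow> real" where "FN z = - F (fst z, - snd z)"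
definition PN :: "'a \<times> 'a \<Rightarrow> real" where "PN z = - P (fst z, - snd z)"

lemma reflect_in_Z: "z \<in> Z \<Longrightarrow> (fst z, - snd z) \<in> Z"
  by auto

lemma reflect:
  fixes f :: "'a \<times> 'a \<Rightarrow> real"
  assumes "smooth_on Z f"
  shows "smooth_on Z (\<lambda>z. - f (fst z, - snd z))"
    and "z \<in> Z \<Longrightarrow> dd (\<lambda>z. - f (fst z, - snd z)) v z = - dd f (fst v, - snd v) (fst z, - snd z)"
proof -
  have L: "bounded_linear (\<lambda>z. (fst z, - snd z) :: 'a \<times> 'a)"
    by (intro bounded_linear_Pair bounded_linear_fst bounded_linear_minus bounded_linear_snd)
  have sm: "smooth_on Z (\<lambda>z. f (fst z, - snd z))"
    using smooth_on_compose_affine[OF open_Z open_Z L _ assms, of 0] by auto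
  then show "smooth_on Z (\<lambda>z. - f (fst z, - snd z))"
    by (rule smooth_on_minus[OF open_Z])
  show "dd (\<lambda>z. - f (fst z, - snd z)) v z = - dd f (fst v, - snd v) (fst z, - snd z)" if "z \<in> Z"
    using dd_compose_affine[OF L, of f 0 z v] smooth_on_differentiable[OF assms reflect_in_Z[OF that]]
      dd_minus[OF smooth_on_differentiable[OF sm that]] by simp
qed

lemma dd_FN: "z \<in> Z \<Longrightarrow> dd FN v z = - dd F (fst v, - snd v) (fst z, - snd z)"
  unfolding FN_def[abs_def] by (rule reflect(2)[OF smF])

lemma dd_PN: "z \<in> Z \<Longrightarrow> dd PN v z = - dd P (fst v, - snd v) (fst z, - snd z)"
  unfolding PN_def[abs_def] by (rule reflect(2)[OF smP])

lemma dd_neg: "smooth_on Z f \<Longrightarrow> z \<in> Z \<Longrightarrow> dd f (- v) z = - dd f v z" for f :: "'a \<times> 'a \<Rightarrow> real"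
  using linear_neg[OF linear_dd] by blast

text \<open>Reflecting the fibre changes the signs of \<open>D\<close> and \<theta>; with the
  additional signs in \<open>FN\<close> and \<open>PN\<close> each equation returns to its original
  form.\<close>

sublocale N: flat_pair U FN PN \<theta> \<sigma>
proof
  fix z v assume z: "z \<in> Z"
  then have nz: "(fst z, - snd z) \<in> Z" by auto
  have n: "dd F (0, - v) (fst z, - snd z) = - dd F (0, v) (fst z, - snd z)"
    "dd P (0, - v) (fst z, - snd z) = - dd P (0, v) (fst z, - snd z)"
    "dd P (- v, 0) (fst z, - snd z) = - dd P (v, 0) (fst z, - snd z)" for v
    using dd_neg[OF smF nz, of "(0, v)"] dd_neg[OF smP nz, of "(0, v)"] dd_neg[OF smP nz, of "(v, 0)"] by simp_all
  show "dd PN (0, snd z) z = PN z" using EuP[OF nz] by (simp add: dd_PN z PN_def)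
  show "dd FN (0, snd z) z = FN z" using EuF[OF nz] by (simp add: dd_FN z FN_def)
  show "FN z \<noteq> 0" using F_nonzero[OF nz] by (simp add: FN_def)
  show "dd FN (v, 0) z = dd PN (0, v) z * FN z + PN z * dd FN (0, v) z"
    using hamel[OF nz, of v] by (simp add: dd_FN dd_PN z FN_def PN_def n)
  show "dd PN (snd z, 0) z = (PN z)\<^sup>2 - 3 * (\<theta> (fst z) \<bullet> snd z) * FN z - \<sigma> (fst z) * (FN z)\<^sup>2"
    using horP[OF nz] by (simp add: dd_PN z FN_def PN_def n)
qed (use sm_theta sm_sigma reflect(1)[OF smF] reflect(1)[OF smP] in \<open>auto simp: FN_def[abs_def] PN_def[abs_def]\<close>)

lemma FN_neg: "z \<in> Z \<Longrightarrow> FN z < 0"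
  using F_pos[OF reflect_in_Z] by (simp add: FN_def)

lemma A_eq: "z \<in> Z \<Longrightarrow> A z = dd \<theta> (snd z) (fst z) \<bullet> snd z"
  using linear_0[OF linear_dd[OF sm_theta]] by (auto simp: A_def dd_TH)

lemma S0_eq: "z \<in> Z \<Longrightarrow> S0 z = dd \<sigma> (snd z) (fst z)"
  by (auto simp: S0_def dd_SG)

text \<open>The sublocale alone would give an integral with its own coefficient
  \<open>N.\<tau>\<close>. Evaluating the integral of \<open>F\<close> at \<open>- y\<close> shows
  that the reversed pair has the same \<open>\<tau>\<close>.\<close>

lemma first_integral_FN:
  assumes z: "z \<in> Z"
  shows "2 * TH z * PN z = A z + S0 z * FN z + \<tau> (fst z) * (FN z)\<^sup>2"
proof -
  have nz: "(fst z, - snd z) \<in> Z" and x: "fst z \<in> U" using z by auto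
  show ?thesis
    using first_integral[OF dim nz] linear_neg[OF linear_dd[OF sm_theta x]] linear_neg[OF linear_dd[OF sm_sigma x]]
    by (simp add: A_eq[OF nz] S0_eq[OF nz] A_eq[OF z] S0_eq[OF z] FN_def PN_def TH_def)
qed

text \<open>\<open>u\<close> and \<open>r\<close> are twice the even and the odd part of
  \<open>F\<close> in \<open>y\<close>. For a Randers metric they are \<open>2 \<alpha>\<close> and
  \<open>2 \<beta>\<close>.\<close>

definition u :: "'a \<times> 'a \<Rightarrow> real" where "u z = F z - FN z"
definition r :: "'a \<times> 'a \<Rightarrow> real" where "r z = F z + FN z"
definition h :: "'a \<times> 'a \<Rightarrow> real" where "h z = (P z - PN z) / u z"

lemma u_pos: "z \<in> Z \<Longrightarrow> u z > 0"
  using F_pos[of z] FN_neg[of z] by (simp add: u_def)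

lemma sm_u: "smooth_on Z u" and sm_r: "smooth_on Z r"
  unfolding u_def[abs_def] r_def[abs_def] by (intro sm N.sm)+

lemma sm_h: "smooth_on Z h"
  unfolding h_def[abs_def] using u_pos
  by (intro smooth_on_divide[OF open_Z] sm N.sm sm_u) force

lemma h_u: "z \<in> Z \<Longrightarrow> P z - PN z = h z * u z"
  using u_pos[of z] by (simp add: h_def)

text \<open>The difference of the two first integrals, divided by \<open>F - FN\<close>.\<close>

lemma two_h_TH:
  assumes z: "z \<in> Z"
  shows "2 * h z * TH z = S0 z + \<tau> (fst z) * r z"
proof -
  have "u z * (2 * h z * TH z - (S0 z + \<tau> (fst z) * r z)) = 0"
    using first_integral[OF dim z] first_integral_FN[OF z] h_u[OF z] unfolding u_def r_def by algebra
  then show ?thesis using u_pos[OF z] by simp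
qed

lemma F_line_derivative:
  assumes x: "x \<in> U" and y: "y \<noteq> 0" and f: "smooth_on Z f"
  shows "((\<lambda>s. f (x + s *\<^sub>R y, y)) has_real_derivative dd f (y, 0) (x, y)) (at 0)"
  using dd_along_line[of f "(x, y)" 0 "(y, 0)"] smooth_on_differentiable[OF f, of "(x, y)"] x y by simp

lemma F_fibre_bound:
  assumes x: "x \<in> U"
  shows "\<exists>C. \<forall>y. \<bar>F (x, y)\<bar> \<le> C * norm y"
proof -
  have "continuous_on (sphere (0::'a) 1) (\<lambda>y. F (x, y))"
    by (rule continuous_on_compose2[OF smooth_on_continuous[OF smF]]) (use x in \<open>auto intro!: continuous_intros\<close>)
  then obtain C where C: "\<And>y. norm y = 1 \<Longrightarrow> \<bar>F (x, y)\<bar> \<le> C"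
    using compact_imp_bounded[OF compact_continuous_image[OF _ compact_sphere]] by (fastforce simp: bounded_iff)
  have "\<bar>F (x, y)\<bar> \<le> C * norm y" for y
  proof (cases "y = 0")
    case False
    have "F (x, y) = norm y * F (x, y /\<^sub>R norm y)"
      using F_hom[OF x, of "norm y" "y /\<^sub>R norm y"] False by simp
    then show ?thesis
      using C[of "y /\<^sub>R norm y"] False by (simp add: abs_mult mult.commute)
  qed (simp add: F_zero)
  then show ?thesis by blast
qed

lemma F_fibre_continuous:
  assumes x: "x \<in> U"
  shows "continuous_on UNIV (\<lambda>y. F (x, y))"
proof (rule continuous_at_imp_continuous_on, rule ballI)
  fix y :: 'a
  show "isCont (\<lambda>y. F (x, y)) y"
  proof (cases "y = 0")
    case True
    obtain C where C: "\<And>y. \<bar>F (x, y)\<bar> \<le> C * norm y" using F_fibre_bound[OF x] by blast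
    have "((\<lambda>y::'a. C * norm y) \<longlongrightarrow> C * norm (0::'a)) (at 0)"
      by (intro tendsto_mult tendsto_const) (rule tendsto_norm[OF tendsto_ident_at])
    then have "((\<lambda>y. F (x, y)) \<longlongrightarrow> 0) (at 0)"
      by (intro Lim_null_comparison[of "\<lambda>y. F (x, y)" "\<lambda>y. C * norm y"]) (use C in auto)
    then show ?thesis by (simp add: True isCont_def F_zero)
  next
    case False
    have "continuous_on (- {0}) (\<lambda>y. F (x, y))"
      by (rule continuous_on_compose2[OF smooth_on_continuous[OF smF]]) (use x in \<open>auto intro!: continuous_intros\<close>)
    then show ?thesis using False by (simp add: continuous_on_eq_continuous_at open_Compl)
  qed
qed

lemma F_hom0: "x \<in> U \<Longrightarrow> l \<ge> 0 \<Longrightarrow> F (x, l *\<^sub>R y) = l * F (x, y)"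
  using F_hom[of x l y] F_zero[of x] by (cases "l = 0") auto

lemma FN_hom0: "x \<in> U \<Longrightarrow> l \<ge> 0 \<Longrightarrow> FN (x, l *\<^sub>R y) = l * FN (x, y)"
  using F_hom0[of x l "- y"] by (simp add: FN_def)

lemma FN_fibre_continuous: "x \<in> U \<Longrightarrow> continuous_on UNIV (\<lambda>y. FN (x, y))"
  unfolding FN_def fst_conv snd_conv
  by (intro continuous_on_minus continuous_on_compose2[OF F_fibre_continuous, of x UNIV uminus]) (auto intro!: continuous_intros)

lemma r_odd: "r (x, - y) = - r (x, y)"
  by (simp add: r_def FN_def)

lemma r_scale: "x \<in> U \<Longrightarrow> r (x, l *\<^sub>R y) = l * r (x, y)"
proof -
  assume x: "x \<in> U"
  have pos: "r (x, l *\<^sub>R y) = l * r (x, y)" if "l \<ge> 0" for l y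
    using F_hom0[OF x that] FN_hom0[OF x that] by (simp add: r_def algebra_simps)
  show ?thesis
    using pos[of l y] pos[of "- l" "- y"] r_odd[of x y] by (cases "l \<ge> 0") auto
qed

text \<open>The product of the two roots; the projective factor called \<open>q\<close> in the
  overview is \<open>PN\<close>.\<close>

definition q :: "'a \<times> 'a \<Rightarrow> real" where "q z = F z * FN z"

lemma sm_q: "smooth_on Z q"
  unfolding q_def[abs_def] by (intro sm N.sm)

lemma q_scale: "x \<in> U \<Longrightarrow> q (x, l *\<^sub>R y) = l\<^sup>2 * q (x, y)"
proof -
  assume x: "x \<in> U"
  have pos: "q (x, l *\<^sub>R y) = l\<^sup>2 * q (x, y)" if "l \<ge> 0" for l y
    using F_hom0[OF x that] FN_hom0[OF x that] by (simp add: q_def power2_eq_square)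
  have "q (x, - y) = q (x, y)" for y by (simp add: q_def FN_def)
  then show ?thesis
    using pos[of l y] pos[of "- l" "- y"] by (cases "l \<ge> 0") auto
qed

lemma r_fibre_continuous: "x \<in> U \<Longrightarrow> continuous_on UNIV (\<lambda>y. r (x, y))"
  unfolding r_def by (intro continuous_intros F_fibre_continuous FN_fibre_continuous)

lemma q_fibre_continuous: "x \<in> U \<Longrightarrow> continuous_on UNIV (\<lambda>y. q (x, y))"
  unfolding q_def by (intro continuous_intros F_fibre_continuous FN_fibre_continuous)

text \<open>On a line transverse to the kernel of \<theta> that misses the origin, \<open>r\<close>
  and \<open>q\<close> are polynomials in the parameter. Homogeneity bounds their degrees by 1 and 2
  and identifies the top coefficients with the values at \<open>w\<close>.\<close>

lemma pencil_expansion: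
  assumes x: "x \<in> U" and tau: "\<tau> x \<noteq> 0" and w: "\<theta> x \<bullet> w \<noteq> 0" and y: "y \<notin> span {w}"
  shows "r (x, y + s *\<^sub>R w) = r (x, y) + s * r (x, w)"
    and "\<exists>c. \<forall>s. q (x, y + s *\<^sub>R w) = q (x, y) + s * c + s\<^sup>2 * q (x, w)"
proof -
  \<comment> \<open>\<open>z0\<close> is the point where the line meets the kernel of \<theta>, as
    the pencil requires at \<open>t = 0\<close>.\<close>
  define t0 where "t0 = (\<theta> x \<bullet> y) / (\<theta> x \<bullet> w)"
  define z0 where "z0 = y - t0 *\<^sub>R w"
  have ne: "z0 + t *\<^sub>R w \<noteq> 0" for t
  proof
    assume "z0 + t *\<^sub>R w = 0"
    then have "y = (t0 - t) *\<^sub>R w" by (simp add: z0_def algebra_simps)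
    then show False using y by (metis span_mul span_base singletonI)
  qed
  have Zt: "(x', z0 + t *\<^sub>R w) \<in> Z" if "x' \<in> U" for x' t using that ne by auto
  interpret pen: pencil U \<theta> \<sigma> \<tau> z0 w
    by unfold_locales (rule open_U sm_theta sm_sigma sm_tau)+
  have th: "pen.th x' t = TH (x', z0 + t *\<^sub>R w)" for x' t
    by (simp add: pen.th_def TH_def inner_simps)
  have a: "pen.a x' t = A (x', z0 + t *\<^sub>R w)" if "x' \<in> U" for x' t
    using linear_add[OF linear_dd[OF sm_theta that]] linear_cmul[OF linear_dd[OF sm_theta that]]
    by (simp add: pen.a_def A_eq[OF Zt[OF that]] inner_simps algebra_simps)
  have s0: "pen.s0 x' t = S0 (x', z0 + t *\<^sub>R w)" if "x' \<in> U" for x' t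
    using linear_add[OF linear_dd[OF sm_sigma that]] linear_cmul[OF linear_dd[OF sm_sigma that]]
    by (simp add: pen.s0_def S0_eq[OF Zt[OF that]])
  have sol: "pen.solution (\<lambda>x t. F (x, z0 + t *\<^sub>R w)) (\<lambda>x t. P (x, z0 + t *\<^sub>R w))"
    unfolding pen.solution_def
  proof (intro ballI allI conjI)
    fix x' t assume x': "x' \<in> U"
    note z = Zt[OF x', of t]
    show "((\<lambda>s. F (x' + s *\<^sub>R (z0 + t *\<^sub>R w), z0 + t *\<^sub>R w)) has_real_derivative 2 * F (x', z0 + t *\<^sub>R w) * P (x', z0 + t *\<^sub>R w)) (at 0)"
      using F_line_derivative[OF x' ne smF, of t] horF[OF z] by simp
    show "((\<lambda>s. P (x' + s *\<^sub>R (z0 + t *\<^sub>R w), z0 + t *\<^sub>R w)) has_real_derivative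
        (P (x', z0 + t *\<^sub>R w))\<^sup>2 - 3 * pen.th x' t * F (x', z0 + t *\<^sub>R w) - \<sigma> x' * (F (x', z0 + t *\<^sub>R w))\<^sup>2) (at 0)"
      using F_line_derivative[OF x' ne smP, of t] horP'[OF z] by (simp add: th SG_def)
    show "2 * pen.th x' t * P (x', z0 + t *\<^sub>R w) = pen.X x' t (F (x', z0 + t *\<^sub>R w))"
      using first_integral[OF dim z] by (simp add: pen.X_def th a[OF x'] s0[OF x'])
  qed
  have solN: "pen.solution (\<lambda>x t. FN (x, z0 + t *\<^sub>R w)) (\<lambda>x t. PN (x, z0 + t *\<^sub>R w))"
    unfolding pen.solution_def
  proof (intro ballI allI conjI)
    fix x' t assume x': "x' \<in> U"
    note z = Zt[OF x', of t]
    show "((\<lambda>s. FN (x' + s *\<^sub>R (z0 + t *\<^sub>R w), z0 + t *\<^sub>R w)) has_real_derivative 2 * FN (x', z0 + t *\<^sub>R w) * PN (x', z0 + t *\<^sub>R w)) (at 0)"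
      using F_line_derivative[OF x' ne N.smF, of t] N.horF[OF z] by simp
    show "((\<lambda>s. PN (x' + s *\<^sub>R (z0 + t *\<^sub>R w), z0 + t *\<^sub>R w)) has_real_derivative
        (PN (x', z0 + t *\<^sub>R w))\<^sup>2 - 3 * pen.th x' t * FN (x', z0 + t *\<^sub>R w) - \<sigma> x' * (FN (x', z0 + t *\<^sub>R w))\<^sup>2) (at 0)"
      using F_line_derivative[OF x' ne N.smP, of t] N.horP'[OF z] by (simp add: th SG_def)
    show "2 * pen.th x' t * PN (x', z0 + t *\<^sub>R w) = pen.X x' t (FN (x', z0 + t *\<^sub>R w))"
      using first_integral_FN[OF z] by (simp add: pen.X_def th a[OF x'] s0[OF x'])
  qed
  have "\<theta> x \<bullet> z0 = 0" using w by (simp add: z0_def t0_def inner_simps)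
  then obtain m n where mn: "eventually (\<lambda>t. r (x, z0 + t *\<^sub>R w) = poly m t \<and> q (x, z0 + t *\<^sub>R w) = poly n t) cofinite"
    using pen.pencil_symmetric_functions[OF sol solN x _ tau] F_pos[OF Zt[OF x]] FN_neg[OF Zt[OF x]]
    unfolding r_def q_def by blast
  have line: "continuous_on UNIV (\<lambda>t. z0 + t *\<^sub>R w)" "continuous_on UNIV (\<lambda>t. t *\<^sub>R z0 + w)"
    by (intro continuous_intros)+
  have m: "r (x, z0 + t *\<^sub>R w) = poly m t" for t
    by (rule eventually_cofinite_eq_continuous[OF eventually_mono[OF mn]])
       (auto intro!: continuous_intros continuous_on_compose2[OF r_fibre_continuous[OF x] line(1)])
  have n: "q (x, z0 + t *\<^sub>R w) = poly n t" for t
    by (rule eventually_cofinite_eq_continuous[OF eventually_mono[OF mn]])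
       (auto intro!: continuous_intros continuous_on_compose2[OF q_fibre_continuous[OF x] line(1)])
  \<comment> \<open>Homogeneity gives \<open>s * r(z0 + w / s) = r(s z0 + w)\<close>, and likewise
    for \<open>q\<close> with \<open>s\<^sup>2\<close>; this tends to the value at \<open>w\<close>
    as \<open>s\<close> tends to 0.\<close>
  have rescale: "s *\<^sub>R (z0 + (1/s) *\<^sub>R w) = s *\<^sub>R z0 + w" if "s > 0" for s
    using that by (simp add: algebra_simps)
  have rlim: "((\<lambda>s. r (x, s *\<^sub>R z0 + w)) \<longlongrightarrow> r (x, w)) (at_right 0)"
    using continuous_on_compose2[OF r_fibre_continuous[OF x] line(2)]
    by (auto simp: continuous_on_eq_continuous_at isCont_def dest!: spec[of _ "0::real"] intro: tendsto_within_subset)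
  have qlim: "((\<lambda>s. q (x, s *\<^sub>R z0 + w)) \<longlongrightarrow> q (x, w)) (at_right 0)"
    using continuous_on_compose2[OF q_fibre_continuous[OF x] line(2)]
    by (auto simp: continuous_on_eq_continuous_at isCont_def dest!: spec[of _ "0::real"] intro: tendsto_within_subset)
  have dm: "degree m \<le> 1" "coeff m 1 = r (x, w)"
    by (rule degree_le_of_limit[OF _ rlim], use m r_scale[OF x] rescale in \<open>metis power_one_right\<close>)+
  have dn: "degree n \<le> 2" "coeff n 2 = q (x, w)"
    by (rule degree_le_of_limit[OF _ qlim], use n q_scale[OF x] rescale in \<open>metis\<close>)+
  have "m = [:coeff m 0, r (x, w):]"
    using dm by (intro poly_eqI) (auto simp: coeff_pCons coeff_eq_0 split: nat.split)
  then have mt: "r (x, z0 + t *\<^sub>R w) = coeff m 0 + t * r (x, w)" for t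
    unfolding m by (metis add.right_neutral mult_zero_right poly_0 poly_pCons)
  have "n = [:coeff n 0, coeff n 1, q (x, w):]"
    using dn by (intro poly_eqI) (auto simp: coeff_pCons coeff_eq_0 numeral_2_eq_2 split: nat.split)
  then have "poly n t = poly [:coeff n 0, coeff n 1, q (x, w):] t" for t by simp
  then have nt: "q (x, z0 + t *\<^sub>R w) = coeff n 0 + t * coeff n 1 + t\<^sup>2 * q (x, w)" for t
    unfolding n by (simp add: algebra_simps power2_eq_square)
  have ys: "y + s *\<^sub>R w = z0 + (t0 + s) *\<^sub>R w" for s
    by (simp add: z0_def algebra_simps)
  show "r (x, y + s *\<^sub>R w) = r (x, y) + s * r (x, w)"
    using mt[of "t0 + s"] mt[of t0] ys[of s] ys[of 0] by (simp add: algebra_simps)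
  show "\<exists>c. \<forall>s. q (x, y + s *\<^sub>R w) = q (x, y) + s * c + s\<^sup>2 * q (x, w)"
  proof (intro exI allI)
    fix s
    have "q (x, y) = coeff n 0 + t0 * coeff n 1 + t0\<^sup>2 * q (x, w)"
      using nt[of t0] ys[of 0] by simp
    moreover have "q (x, y + s *\<^sub>R w) = coeff n 0 + (t0 + s) * coeff n 1 + (t0 + s)\<^sup>2 * q (x, w)"
      using nt[of "t0 + s"] ys[of s] by simp
    ultimately show "q (x, y + s *\<^sub>R w) = q (x, y) + s * (coeff n 1 + 2 * t0 * q (x, w)) + s\<^sup>2 * q (x, w)"
      by algebra
  qed
qed

lemma interior_exceptional_directions:
  assumes "v \<noteq> (0::'a)"
  shows "interior ({w. v \<bullet> w = 0} \<union> span {y}) = {}"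
proof -
  have "interior (span {y}) = {}"
    by (rule empty_interior_lowdim) (use dim dim_singleton[of y] in auto)
  then show ?thesis
    using interior_closed_Un_empty_interior[of "{w. v \<bullet> w = 0}" "span {y}"] assms
    by (simp add: closed_hyperplane)
qed

text \<open>\<open>pencil_expansion\<close> with \<open>s = 1\<close> covers all \<open>w\<close>
  outside a hyperplane and a line; the rest follows by continuity in \<open>w\<close>.\<close>

lemma r_additive_generic:
  assumes x: "x \<in> U" and ne: "\<theta> x \<noteq> 0" "\<tau> x \<noteq> 0"
  shows "r (x, y + w) = r (x, y) + r (x, w)"
proof (cases "y = 0")
  case True
  then show ?thesis by (simp add: r_def FN_def F_zero)
next
  case False
  show ?thesis
  proof (rule dense_complement_eq[where f = "\<lambda>w. r (x, y + w)" and g = "\<lambda>w. r (x, y) + r (x, w)",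
        OF _ _ _ interior_exceptional_directions[OF ne(1), of y]])
    fix w assume "w \<notin> {w. \<theta> x \<bullet> w = 0} \<union> span {y}"
    moreover from this have "y \<notin> span {w}"
      using not_in_span_singleton_swap[OF False] by blast
    ultimately show "r (x, y + w) = r (x, y) + r (x, w)"
      using pencil_expansion(1)[OF x ne(2), of w y 1] by simp
  qed (intro continuous_intros r_fibre_continuous[OF x] continuous_on_compose2[OF r_fibre_continuous[OF x]] subset_UNIV)+
qed

text \<open>The middle coefficient of the quadratic expansion along \<open>w\<close> is the fibre
  derivative of \<open>q\<close> at \<open>y\<close>. This exhibits the polar form of
  \<open>q\<close> as linear in \<open>w\<close>.\<close>

lemma q_polar_generic:
  assumes x: "x \<in> U" and ne: "\<theta> x \<noteq> 0" "\<tau> x \<noteq> 0" and y: "y \<noteq> 0"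
  shows "q (x, y + w) - q (x, y) - q (x, w) = dd q (0, w) (x, y)"
proof (rule dense_complement_eq[where f = "\<lambda>w. q (x, y + w) - q (x, y) - q (x, w)" and g = "\<lambda>w. dd q (0, w) (x, y)",
      OF _ _ _ interior_exceptional_directions[OF ne(1), of y]])
  have z: "(x, y) \<in> Z" using x y by auto
  fix w assume w: "w \<notin> {w. \<theta> x \<bullet> w = 0} \<union> span {y}"
  then have "y \<notin> span {w}"
    using not_in_span_singleton_swap[OF y] by blast
  then obtain c where c: "\<And>s. q (x, y + s *\<^sub>R w) = q (x, y) + s * c + s\<^sup>2 * q (x, w)"
    using pencil_expansion(2)[OF x ne(2), of w y] w by blast
  have "((\<lambda>s. q (x, y + s *\<^sub>R w)) has_real_derivative c) (at 0)"
    unfolding c by (auto intro!: derivative_eq_intros)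
  moreover have "((\<lambda>s. q (x, y + s *\<^sub>R w)) has_real_derivative dd q (0, w) (x, y)) (at 0)"
    using dd_along_line[of q "(x, y)" 0 "(0, w)"] smooth_on_differentiable[OF sm_q z] by simp
  ultimately have "c = dd q (0, w) (x, y)" by (rule DERIV_unique)
  then show "q (x, y + w) - q (x, y) - q (x, w) = dd q (0, w) (x, y)"
    using c[of 1] by simp
next
  have z: "(x, y) \<in> Z" using x y by auto
  have "linear (\<lambda>w. dd q (0, w) (x, y))"
    using linear_compose[OF _ linear_dd[OF sm_q z], of "\<lambda>w. (0, w)"] by (simp add: o_def linear_iff)
  then show "continuous_on UNIV (\<lambda>w. dd q (0, w) (x, y))"
    by (rule linear_continuous_on[OF linear_conv_bounded_linear[THEN iffD1]])
qed (intro continuous_intros q_fibre_continuous[OF x] continuous_on_compose2[OF q_fibre_continuous[OF x]] subset_UNIV)+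

end

section \<open>The region where \<theta> does not vanish\<close>

context finsler_pair
begin

abbreviation V :: "'a set" where "V \<equiv> {x \<in> U. \<theta> x \<noteq> 0}"

abbreviation VZ :: "('a \<times> 'a) set" where "VZ \<equiv> V \<times> (- {0})"

lemma open_V: "open V"
proof -
  have "V = U \<inter> \<theta> -` (- {0})" by auto
  then show ?thesis
    using continuous_open_preimage[OF smooth_on_continuous[OF sm_theta] open_U, of "- {0}"] by (simp add: open_Compl)
qed

lemma open_VZ: "open VZ"
  by (intro open_Times open_V) (simp add: open_Compl)

text \<open>The function \<open>L\<close> is linear: either \<open>\<tau>\<close> vanishes and only
  \<open>D \<sigma>\<close> remains, or \<open>r\<close> is additive. As
  \<open>L = 2 h \<theta>\<close> vanishes on the kernel of \<theta>, it is a multiple of \<theta>,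
  so \<open>h\<close> is constant off that kernel and by continuity on it.\<close>

lemma h_fibre_constant:
  assumes x: "x \<in> V" and y: "y \<noteq> 0"
  shows "h (x, y) = h (x, \<theta> x)"
proof -
  have xU: "x \<in> U" and w0: "\<theta> x \<noteq> 0" using x by auto
  define L where "L y = dd \<sigma> y x + \<tau> x * r (x, y)" for y
  have L: "L y = 2 * h (x, y) * (\<theta> x \<bullet> y)" if "y \<noteq> 0" for y
    using two_h_TH[of "(x, y)"] S0_eq[of "(x, y)"] xU that by (simp add: L_def TH_def)
  have Ladd: "L (y + y') = L y + L y'" for y y'
    using r_additive_generic[OF xU w0] linear_add[OF linear_dd[OF sm_sigma xU]]
    by (cases "\<tau> x = 0") (simp_all add: L_def algebra_simps)
  have Lscale: "L (k *\<^sub>R y) = k * L y" for k y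
    using r_scale[OF xU] linear_cmul[OF linear_dd[OF sm_sigma xU]] by (simp add: L_def algebra_simps)
  have main: "h (x, y) = h (x, \<theta> x)" if ty: "\<theta> x \<bullet> y \<noteq> 0" for y
  proof -
    define k where "k = (\<theta> x \<bullet> y) / (\<theta> x \<bullet> \<theta> x)"
    define z where "z = y - k *\<^sub>R \<theta> x"
    have "\<theta> x \<bullet> z = 0" using w0 by (simp add: z_def k_def inner_simps)
    then have "L z = 0" using L[of z] Lscale[of 0 0] by (cases "z = 0") auto
    then have "L y = k * L (\<theta> x)"
      using Ladd[of z "k *\<^sub>R \<theta> x"] Lscale by (simp add: z_def)
    then have "2 * h (x, y) * (\<theta> x \<bullet> y) = k * (2 * h (x, \<theta> x) * (\<theta> x \<bullet> \<theta> x))"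
    proof -
      have "y \<noteq> 0" using ty by auto
      then show ?thesis using L[of y] L[OF w0] \<open>L y = k * L (\<theta> x)\<close> by metis
    qed
    also have "\<dots> = 2 * h (x, \<theta> x) * (\<theta> x \<bullet> y)"
      using w0 by (simp add: k_def)
    finally show ?thesis using ty by simp
  qed
  show ?thesis
  proof (cases "\<theta> x \<bullet> y = 0")
    case True
    have "((\<lambda>s. y + s *\<^sub>R \<theta> x) \<longlongrightarrow> y + 0 *\<^sub>R \<theta> x) (at 0)" by (intro tendsto_intros)
    moreover have "isCont h (x, y)"
      using smooth_on_continuous[OF sm_h] open_Z xU y by (simp add: continuous_on_eq_continuous_at)
    ultimately have "((\<lambda>s. h (x, y + s *\<^sub>R \<theta> x)) \<longlongrightarrow> h (x, y)) (at 0)"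
      by (intro isCont_tendsto_compose[of _ h] tendsto_Pair tendsto_const) simp_all
    moreover have "eventually (\<lambda>s. h (x, y + s *\<^sub>R \<theta> x) = h (x, \<theta> x)) (at (0::real))"
      using True w0 by (auto simp: eventually_at_filter inner_simps intro!: main always_eventually)
    ultimately have "((\<lambda>s::real. h (x, \<theta> x)) \<longlongrightarrow> h (x, y)) (at 0)"
      by (rule Lim_transform_eventually)
    then show ?thesis using tendsto_unique[OF _ _ tendsto_const] trivial_limit_at by metis
  qed (rule main)
qed

definition H :: "'a \<Rightarrow> real" where "H x = h (x, SOME b. b \<in> Basis)"

lemma sm_H: "smooth_on U H"
  unfolding H_def[abs_def] using some_Basis nonzero_Basis by (intro smooth_section[OF sm_h]) blast

lemma h_H: "x \<in> V \<Longrightarrow> y \<noteq> 0 \<Longrightarrow> h (x, y) = H x"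
  using h_fibre_constant[of x y] h_fibre_constant[of x "SOME b. b \<in> Basis"] some_Basis nonzero_Basis
  unfolding H_def by metis

lemma h_VZ: "z \<in> VZ \<Longrightarrow> h z = H (fst z)"
  by (cases z) (simp add: h_H)

lemma dd_h:
  assumes "x \<in> V" "y \<noteq> 0"
  shows "dd h v (x, y) = dd H (fst v) x"
proof -
  have "dd (\<lambda>z. H (fst z)) v (x, y) = dd h v (x, y)"
  proof (rule dd_eq_on_open[OF open_VZ])
    show "smooth_on VZ (\<lambda>z. H (fst z))"
      by (rule smooth_on_subset[OF smooth_base[OF sm_H]]) auto
  qed (use assms in \<open>simp_all add: h_VZ\<close>)
  then show ?thesis using dd_base[OF sm_H, of "(x, y)" v] assms by simp
qed

lemma dd_u: "z \<in> Z \<Longrightarrow> dd u v z = dd F v z - dd FN v z"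
  unfolding u_def[abs_def] by (simp add: dd_rules sm N.sm)

lemma dd_r: "z \<in> Z \<Longrightarrow> dd r v z = dd F v z + dd FN v z"
  unfolding r_def[abs_def] by (simp add: dd_rules sm N.sm)

text \<open>Base and fibre derivatives of \<open>P - PN = h * u\<close>, where \<open>h\<close>
  depends on \<open>x\<close> only; \<open>dd_P_base\<close> and Hamel's equation turn the base
  derivatives of \<open>F\<close>, \<open>P\<close>, \<open>FN\<close>, \<open>PN\<close> into fibre
  derivatives.\<close>

lemma dd_H_relation:
  assumes x: "x \<in> V" and y: "y \<noteq> 0"
  defines "z \<equiv> (x, y)"
  shows "dd H v x * u z = - ((H x)\<^sup>2 + \<sigma> x) * (F z * dd F (0, v) z - FN z * dd FN (0, v) z)
    - (\<theta> x \<bullet> v) * u z - 2 * (\<theta> x \<bullet> y) * (dd F (0, v) z - dd FN (0, v) z)"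
proof -
  have z: "z \<in> Z" using x y by (simp add: z_def)
  have P: "dd P a z - dd PN a z = h z * dd u a z + dd h a z * u z" for a
  proof -
    have "dd (\<lambda>z. P z - PN z) a z = dd (\<lambda>z. h z * u z) a z"
      by (rule dd_eq_Z[OF z]) (auto intro!: sm N.sm simp: h_u)
    then show ?thesis by (simp add: dd_rules sm N.sm sm_h sm_u z)
  qed
  have d: "dd h (v, 0) z = dd H v x" "dd h (0, v) z = 0" "h z = H x"
    using dd_h[OF x y] h_H[OF x y] linear_0[OF linear_dd[OF sm_H]] x by (auto simp: z_def)
  have e: "TH z = \<theta> x \<bullet> y" "SG z = \<sigma> x" "fst z = x" by (simp_all add: TH_def SG_def z_def)
  note f = P[of "(v, 0)", unfolded d dd_u[OF z]] P[of "(0, v)", unfolded d dd_u[OF z]] h_u[OF z, unfolded d]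
    dd_P_base[OF z, of v, unfolded e] N.dd_P_base[OF z, of v, unfolded e] hamel[OF z, of v] N.hamel[OF z, of v]
  show ?thesis using f unfolding u_def by algebra
qed

text \<open>Taking \<open>v = y\<close> in \<open>dd_H_relation\<close> makes
  \<open>((H x)\<^sup>2 + \<sigma> x) * r\<close> a linear form, and its fibre derivative gives a
  second equation. In dimension at least two some \<open>y \<noteq> 0\<close> has
  \<open>dd H y x = \<theta> x \<bullet> y\<close>; for this \<open>y\<close> the fibre derivatives
  of \<open>F\<close> and \<open>FN\<close> cancel and leave the first claim for every
  \<open>v\<close>.\<close>

lemma dd_H:
  assumes x: "x \<in> V"
  shows "dd H v x = \<theta> x \<bullet> v"
    and "((H x)\<^sup>2 + \<sigma> x) * r (x, y) = - 4 * (\<theta> x \<bullet> y)"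
proof -
  have xU: "x \<in> U" using x by simp
  let ?s = "(H x)\<^sup>2 + \<sigma> x"
  note lin = linear_dd[OF sm_H xU]
  have two: "?s * r (x, y) = - (dd H y x + 3 * (\<theta> x \<bullet> y))" for y
  proof (cases "y = 0")
    case True
    then show ?thesis using linear_0[OF lin] by (simp add: r_def FN_def F_zero)
  next
    case False
    then have z: "(x, y) \<in> Z" using xU by simp
    have "u (x, y) * (dd H y x + ?s * r (x, y) + 3 * (\<theta> x \<bullet> y)) = 0"
      using dd_H_relation[OF x False, of y] EuF[OF z] N.EuF[OF z] unfolding u_def r_def fst_conv snd_conv by algebra
    then show ?thesis using u_pos[OF z] by simp
  qed
  have three: "?s * dd r (0, v) (x, y) = - (dd H v x + 3 * (\<theta> x \<bullet> v))" if "y \<noteq> 0" for y v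
  proof -
    have "((\<lambda>t. r (x, y + t *\<^sub>R v)) has_real_derivative dd r (0, v) (x, y)) (at 0)"
      using dd_along_line[of r "(x, y)" 0 "(0, v)"] smooth_on_differentiable[OF sm_r, of "(x, y)"] xU that by simp
    then have "((\<lambda>t. ?s * r (x, y + t *\<^sub>R v)) has_real_derivative ?s * dd r (0, v) (x, y)) (at 0)"
      by (rule DERIV_cmult)
    moreover have "((\<lambda>t. - (dd H y x + 3 * (\<theta> x \<bullet> y)) - t * (dd H v x + 3 * (\<theta> x \<bullet> v))) has_real_derivative
        - (dd H v x + 3 * (\<theta> x \<bullet> v))) (at 0)"
      by (auto intro!: derivative_eq_intros)
    moreover have "?s * r (x, y + t *\<^sub>R v) = - (dd H y x + 3 * (\<theta> x \<bullet> y)) - t * (dd H v x + 3 * (\<theta> x \<bullet> v))" for t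
      unfolding two linear_add[OF lin] linear_cmul[OF lin] by (simp add: inner_simps algebra_simps)
    ultimately show ?thesis using DERIV_unique by simp
  qed
  obtain c where c: "\<And>v. dd H v x - \<theta> x \<bullet> v = c \<bullet> v"
  proof
    fix v
    show "dd H v x - \<theta> x \<bullet> v = ((\<Sum>b\<in>Basis. dd H b x *\<^sub>R b) - \<theta> x) \<bullet> v"
      using dd_euclidean_sum[OF sm_H xU, of v] by (simp add: inner_diff_left inner_sum_left inner_commute[of v] mult.commute)
  qed
  obtain y where y: "y \<noteq> 0" "c \<bullet> y = 0"
    using orthogonal_to_vector_exists[of c] dim by (auto simp: orthogonal_def)
  then have z: "(x, y) \<in> Z" using xU by simp
  have lam: "dd H v x = \<theta> x \<bullet> v" for v
  proof -
    have e: "dd H y x = \<theta> x \<bullet> y" using c[of y] y by simp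
    have "(f - g) * (l - t) = 0" if "l * (f - g) = - s * (f * f1 - g * g1) - t * (f - g) - 2 * ty * (f1 - g1)"
      "s * (f + g) = - (ty + 3 * ty)" "s * (f1 + g1) = - (l + 3 * t)" for f g f1 g1 l t ty s :: real
      using that by algebra
    from this[OF dd_H_relation[OF x y(1), of v, unfolded u_def] two[of y, unfolded r_def e] three[OF y(1), of v, unfolded dd_r[OF z]]]
    have "u (x, y) * (dd H v x - \<theta> x \<bullet> v) = 0"
      unfolding u_def .
    then show ?thesis using u_pos[OF z] by simp
  qed
  then show "dd H v x = \<theta> x \<bullet> v" .
  show "?s * r (x, y) = - 4 * (\<theta> x \<bullet> y)" for y
    using two[of y] lam[of y] by simp
qed

text \<open>Apply \<open>D\<close> to \<open>(h\<^sup>2 + \<sigma>) r = - 4 \<theta>\<close> and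
  eliminate \<open>D \<theta>\<close>, \<open>P\<close> and \<open>PN\<close> by the two first
  integrals and the definition of \<open>h\<close>. What remains is \<open>u * u\<close> times the
  difference of the two sides.\<close>

lemma tau_H:
  assumes x: "x \<in> V" and y: "y \<noteq> 0"
  shows "\<tau> x = ((H x)\<^sup>2 + \<sigma> x) * H x" "S0 (x, y) = 6 * H x * (\<theta> x \<bullet> y)"
proof -
  define z where "z = (x, y)"
  have z: "z \<in> Z" using x y by (simp add: z_def)
  have zV: "z \<in> VZ" using x y by (simp add: z_def)
  have e: "TH z = \<theta> x \<bullet> y" "SG z = \<sigma> x" "fst z = x" "snd z = y" "h z = H x"
    using h_H[OF x y] by (simp_all add: TH_def SG_def z_def)
  have dh: "dd h (y, 0) z = \<theta> x \<bullet> y"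
    using dd_h[OF x y, of "(y, 0)"] dd_H(1)[OF x, of y] by (simp add: z_def)
  have "dd (\<lambda>z. 0) (y, 0) z = dd (\<lambda>z. ((h z)\<^sup>2 + SG z) * r z + 4 * TH z) (y, 0) z"
  proof (rule dd_eq_on_open[OF open_VZ zV])
    fix z assume "z \<in> VZ"
    then show "0 = ((h z)\<^sup>2 + SG z) * r z + 4 * TH z"
      using dd_H(2)[of "fst z" "snd z"] h_VZ[of z] by (cases z) (simp add: SG_def TH_def)
  qed (rule smooth_on_const)
  then have D: "(2 * h z * dd h (y, 0) z + S0 z) * r z + ((h z)\<^sup>2 + SG z) * (2 * F z * P z + 2 * FN z * PN z) + 4 * A z = 0"
    using horF[OF z] N.horF[OF z]
    by (simp add: dd_rules dd_square sm sm_h sm_r z dd_const dd_r[OF z] S0_def A_def e algebra_simps)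
  have sr: "((H x)\<^sup>2 + \<sigma> x) * r z = - 4 * (\<theta> x \<bullet> y)"
    unfolding z_def by (rule dd_H(2)[OF x])
  have "u z * u z * (((H x)\<^sup>2 + \<sigma> x) * H x - \<tau> x) = 0"
    using D[unfolded dh e] sr first_integral[OF dim z, unfolded e] first_integral_FN[OF z, unfolded e] h_u[OF z, unfolded e]
      two_h_TH[OF z, unfolded e]
    unfolding u_def r_def by algebra
  then show tau: "\<tau> x = ((H x)\<^sup>2 + \<sigma> x) * H x" using u_pos[OF z] by simp
  show "S0 (x, y) = 6 * H x * (\<theta> x \<bullet> y)"
    using two_h_TH[OF z, unfolded e] sr unfolding tau z_def[symmetric] by algebra
qed

text \<open>In this form the consequences of \<open>tau_H\<close> are equations between functions
  continuous on \<open>U\<close>, so they persist on the closure. The 9 is \<open>3 + 6\<close>: 3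
  from the derivative of \<open>H\<^sup>3\<close>, 6 from
  \<open>D \<sigma> = 6 H \<theta>\<close>.\<close>

lemma V_relations:
  assumes x: "x \<in> V" and y: "y \<noteq> 0"
  shows "2 * S0 (x, y) + 3 * \<tau> x * r (x, y) = 0"
    and "dd \<tau> y x - (9 * (h (x, y))\<^sup>2 + \<sigma> x) * (\<theta> x \<bullet> y) = 0"
proof -
  show "2 * S0 (x, y) + 3 * \<tau> x * r (x, y) = 0"
    using tau_H[OF x y] dd_H(2)[OF x, of y] by algebra
  define z where "z = (x, y)"
  have z: "z \<in> Z" and zV: "z \<in> VZ" using x y by (simp_all add: z_def)
  have e: "SG z = \<sigma> x" "fst z = x" "snd z = y" "h z = H x" and dh: "dd h (y, 0) z = \<theta> x \<bullet> y"
    using h_H[OF x y] dd_h[OF x y, of "(y, 0)"] dd_H(1)[OF x, of y] by (simp_all add: SG_def z_def)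
  have "dd (\<lambda>z. \<tau> (fst z)) (y, 0) z = dd (\<lambda>z. ((h z)\<^sup>2 + SG z) * h z) (y, 0) z"
  proof (rule dd_eq_on_open[OF open_VZ zV])
    show "smooth_on VZ (\<lambda>z. \<tau> (fst z))"
      by (rule smooth_on_subset[OF smooth_base[OF sm_tau]]) auto
    fix z assume "z \<in> VZ"
    then show "\<tau> (fst z) = ((h z)\<^sup>2 + SG z) * h z"
      using tau_H(1)[of "fst z" "snd z"] h_VZ[of z] by (cases z) (simp add: SG_def)
  qed
  then have "dd \<tau> y x = (3 * (H x)\<^sup>2 + \<sigma> x) * (\<theta> x \<bullet> y) + S0 z * H x"
    using dd_base[OF sm_tau z, of "(y, 0)"]
    by (simp add: dd_rules dd_square sm sm_h z dh e S0_def[of z] algebra_simps power2_eq_square)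
  then show "dd \<tau> y x - (9 * (h (x, y))\<^sup>2 + \<sigma> x) * (\<theta> x \<bullet> y) = 0"
    using tau_H(2)[OF x y] e(4) unfolding z_def by algebra
qed

section \<open>Density of the points where \<theta> and \<tau> do not vanish\<close>

lemma tau_not_locally_zero:
  assumes "open O'" "O' \<subseteq> V" "x \<in> O'"
  shows "\<exists>x\<in>O'. \<tau> x \<noteq> 0"
proof (rule ccontr)
  assume "\<not> ?thesis"
  then have t0: "\<tau> x = 0" if "x \<in> O'" for x using that by blast
  \<comment> \<open>The factor \<open>(H x)\<^sup>2 + \<sigma> x\<close> is nonzero, since its
    product with \<open>r (x, \<theta> x)\<close> is
    \<open>- 4 * (\<theta> x \<bullet> \<theta> x)\<close>. So \<open>H\<close> vanishes on the open
    set, which contradicts \<open>dH = \<theta>\<close>.\<close>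
  have H0: "H x = 0" if x: "x \<in> O'" for x
  proof -
    have xV: "x \<in> V" using x assms(2) by auto
    then have "(H x)\<^sup>2 + \<sigma> x \<noteq> 0" using dd_H(2)[OF xV, of "\<theta> x"] by auto
    then show ?thesis using tau_H(1)[OF xV, of "\<theta> x"] xV t0[OF x] by auto
  qed
  have "dd (\<lambda>z. 0) (\<theta> x) x = dd H (\<theta> x) x"
    by (rule dd_eq_on_open[OF assms(1,3)]) (auto simp: H0 smooth_on_const)
  then show False
    using dd_H(1)[of x "\<theta> x"] assms(2,3) by (auto simp: dd_const)
qed

lemma outside_V:
  assumes x: "x \<in> U" "x \<notin> closure V" and y: "y \<noteq> 0"
  shows "A (x, y) = 0" "\<theta> x = 0" "\<tau> x = 0" "S0 (x, y) = 0"
proof -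
  have z: "(x, y) \<in> Z" using x y by simp
  let ?O = "U - closure V"
  have O: "open ?O" "x \<in> ?O" using x open_U by auto
  have th: "\<theta> x = 0" if xO: "x \<in> ?O" for x
  proof (rule ccontr)
    assume "\<theta> x \<noteq> 0"
    then have "x \<in> V" using xO by simp
    then have "x \<in> closure V" by (rule closure_subset[THEN subsetD])
    then show False using xO by simp
  qed
  then show t: "\<theta> x = 0" using O by blast
  have "dd (\<lambda>z. 0) y x = dd \<theta> y x"
    by (rule dd_eq_on_open[OF O th[symmetric] smooth_on_const])
  then show A0: "A (x, y) = 0" using A_eq[OF z] by (simp add: dd_const)
  \<comment> \<open>With \<theta> and \<open>D \<theta>\<close> zero, the first integrals read
    \<open>D \<sigma> + \<tau> T = 0\<close> for the two different values \<open>F\<close> and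
    \<open>FN\<close> of \<open>T\<close>.\<close>
  have "S0 (x, y) * F (x, y) + \<tau> x * (F (x, y))\<^sup>2 = 0" "S0 (x, y) * FN (x, y) + \<tau> x * (FN (x, y))\<^sup>2 = 0"
    using first_integral[OF dim z] first_integral_FN[OF z] A0 t by (simp_all add: TH_def)
  then have e: "S0 (x, y) + \<tau> x * F (x, y) = 0" "S0 (x, y) + \<tau> x * FN (x, y) = 0"
    using F_nonzero[OF z] N.F_nonzero[OF z] by (simp_all add: power2_eq_square flip: distrib_right mult.assoc)
  then have "\<tau> x * u (x, y) = 0" unfolding u_def by algebra
  then show "\<tau> x = 0" using u_pos[OF z] by simp
  with e show "S0 (x, y) = 0" by simp
qed

lemma U_relations:
  assumes x: "x \<in> U" and y: "y \<noteq> 0"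
  shows "2 * S0 (x, y) + 3 * \<tau> x * r (x, y) = 0"
    and "dd \<tau> y x - (9 * (h (x, y))\<^sup>2 + \<sigma> x) * (\<theta> x \<bullet> y) = 0"
proof -
  note c = smooth_on_continuous[OF smooth_section[OF _ y]]
  note cU = smooth_on_continuous
  have "2 * S0 (x, y) + 3 * \<tau> x * r (x, y) = 0 \<and> dd \<tau> y x - (9 * (h (x, y))\<^sup>2 + \<sigma> x) * (\<theta> x \<bullet> y) = 0"
  proof (cases "x \<in> closure V")
    case True
    have "2 * S0 (x, y) + 3 * \<tau> x * r (x, y) = 0"
      by (rule continuous_zero_on_closure[OF open_U _ _ x True])
         (use V_relations(1)[OF _ y] in \<open>auto intro!: continuous_intros c[OF smS0] c[OF sm_r] cU[OF sm_tau]\<close>)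
    moreover have "dd \<tau> y x - (9 * (h (x, y))\<^sup>2 + \<sigma> x) * (\<theta> x \<bullet> y) = 0"
      by (rule continuous_zero_on_closure[OF open_U _ _ x True])
         (use V_relations(2)[OF _ y] in \<open>auto intro!: continuous_intros c[OF sm_h] cU[OF sm_sigma] cU[OF sm_theta] cU[OF smooth_on_dd[OF sm_tau]]\<close>)
    ultimately show ?thesis by blast
  next
    case False
    let ?O = "U - closure V"
    have "0 = \<tau> z" if "z \<in> ?O" for z
      using outside_V(3)[OF _ _ y, of z] that by (metis Diff_iff)
    then have "dd (\<lambda>z. 0) y x = dd \<tau> y x"
      using x False by (intro dd_eq_on_open[of ?O] open_Diff open_U closed_closure smooth_on_const) auto
    then show ?thesis using outside_V[OF x False y] by (simp add: dd_const)
  qed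
  then show "2 * S0 (x, y) + 3 * \<tau> x * r (x, y) = 0"
    and "dd \<tau> y x - (9 * (h (x, y))\<^sup>2 + \<sigma> x) * (\<theta> x \<bullet> y) = 0" by blast+
qed

text \<open>Along the line, the first integral with \<open>D \<sigma>\<close> replaced by
  \<open>- 3/2 \<tau> r\<close>, together with the formula for \<open>D \<tau>\<close>, is a
  homogeneous linear system for \<open>\<theta>(y)\<close> and \<open>\<tau>\<close>. It controls
  only the component of \<theta> in direction \<open>y\<close>, hence the conclusion about
  \<open>\<tau>\<close> alone.\<close>

lemma zero_propagates:
  assumes x: "x \<in> U" "\<theta> x = 0" "\<tau> x = 0" and y: "y \<noteq> 0" and seg: "\<And>s. 0 \<le> s \<Longrightarrow> s \<le> 1 \<Longrightarrow> x + s *\<^sub>R y \<in> U"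
  shows "\<tau> (x + y) = 0"
proof -
  let ?p = "\<lambda>s. (x + s *\<^sub>R y, y)"
  have seg': "?p s \<in> Z" if "0 \<le> s" "s \<le> 1" for s using seg[OF that] y by simp
  have c: "continuous_on {0..1} (\<lambda>s. f (?p s))" if "smooth_on Z f" for f :: "'a \<times> 'a \<Rightarrow> real"
    by (rule continuous_on_compose2[OF smooth_on_continuous[OF that]]) (use seg' in \<open>auto intro!: continuous_intros\<close>)
  have "\<tau> (x + 1 *\<^sub>R y) = 0"
  proof (rule linear_system_zero(2)[where a = "\<lambda>s. TH (?p s)" and b = "\<lambda>s. \<tau> (x + s *\<^sub>R y)" and \<alpha> = "\<lambda>s. 2 * P (?p s)"
        and \<beta> = "\<lambda>s. (3/2) * r (?p s) * F (?p s) - (F (?p s))\<^sup>2" and \<gamma> = "\<lambda>s. 9 * (h (?p s))\<^sup>2 + SG (?p s)"])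
    fix s :: real assume s: "0 \<le> s" "s \<le> 1"
    have z: "?p s \<in> Z" by (rule seg'[OF s])
    have "((\<lambda>s. TH (?p s)) has_real_derivative A (?p s)) (at s)"
      using dd_along_line[of TH "(x, y)" s "(y, 0)"] smooth_on_differentiable[OF smTH z] by (simp add: A_def)
    moreover have "A (?p s) = 2 * P (?p s) * TH (?p s) + ((3/2) * r (?p s) * F (?p s) - (F (?p s))\<^sup>2) * \<tau> (x + s *\<^sub>R y)"
      using first_integral[OF dim z] U_relations(1)[OF seg[OF s] y] unfolding fst_conv by algebra
    ultimately show "((\<lambda>s. TH (?p s)) has_real_derivative 2 * P (?p s) * TH (?p s) + ((3/2) * r (?p s) * F (?p s) - (F (?p s))\<^sup>2) * \<tau> (x + s *\<^sub>R y)) (at s)"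
      by simp
    show "((\<lambda>s. \<tau> (x + s *\<^sub>R y)) has_real_derivative (9 * (h (?p s))\<^sup>2 + SG (?p s)) * TH (?p s)) (at s)"
      using dd_along_line[of \<tau> x s y] smooth_on_differentiable[OF sm_tau seg[OF s]] U_relations(2)[OF seg[OF s] y]
      by (simp add: SG_def TH_def)
  qed (use x in \<open>auto intro!: continuous_intros c[OF smP] c[OF smF] c[OF smSG] c[OF sm_h] c[OF sm_r] simp: TH_def\<close>)
  then show ?thesis by simp
qed

lemma dense_V:
  assumes conn: "connected U" and ne: "V \<noteq> {}"
  shows "U \<subseteq> closure V"
proof -
  define K where "K = {x \<in> U. \<theta> x = 0 \<and> \<tau> x = 0}"
  have "openin (top_of_set U) K"
  proof -
    have "open K"
    proof (rule openI)
      fix x assume x: "x \<in> K"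
      then have x': "x \<in> U" "\<theta> x = 0" "\<tau> x = 0" by (auto simp: K_def)
      obtain e where e: "e > 0" "ball x e \<subseteq> U" using open_U x'(1) open_contains_ball by blast
      have t: "\<tau> x' = 0" if x'': "x' \<in> ball x e" for x'
      proof (cases "x' = x")
        case False
        have "x + s *\<^sub>R (x' - x) \<in> U" if s: "0 \<le> s" "s \<le> 1" for s
        proof -
          have "dist x (x + s *\<^sub>R (x' - x)) = s * norm (x' - x)" using s by (simp add: dist_norm)
          also have "\<dots> \<le> norm (x' - x)" using s by (simp add: mult_left_le_one_le)
          also have "\<dots> < e" using x'' by (simp add: dist_norm norm_minus_commute)
          finally show ?thesis using e(2) by auto
        qed
        then show ?thesis using zero_propagates[OF x', of "x' - x"] False by simp
      qed (use x' in simp)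
      \<comment> \<open>As \<open>\<tau>\<close> vanishes on the whole ball,
        \<open>tau_not_locally_zero\<close> forces \<theta> to vanish there as well.\<close>
      have "ball x e \<inter> V = {}"
      proof (rule ccontr)
        assume "ball x e \<inter> V \<noteq> {}"
        then obtain x' where "x' \<in> ball x e \<inter> V" by blast
        from tau_not_locally_zero[OF open_Int[OF open_ball open_V] _ this] t show False by blast
      qed
      then have "ball x e \<subseteq> K" using e(2) t by (auto simp: K_def)
      then show "\<exists>e>0. ball x e \<subseteq> K" using e(1) by blast
    qed
    then show ?thesis by (simp add: K_def open_openin_trans open_U Collect_restrict)
  qed
  moreover have "closedin (top_of_set U) K"
  proof -
    have "closedin (top_of_set U) {x \<in> U. \<theta> x = 0}" "closedin (top_of_set U) {x \<in> U. \<tau> x = 0}"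
      by (rule continuous_closedin_preimage_constant, rule smooth_on_continuous, (rule sm_theta sm_tau))+
    moreover have "K = {x \<in> U. \<theta> x = 0} \<inter> {x \<in> U. \<tau> x = 0}" by (auto simp: K_def)
    ultimately show ?thesis by (simp add: closedin_Int)
  qed
  ultimately have "K = {} \<or> K = U" using conn by (simp add: connected_clopen)
  moreover have "K \<noteq> U" using ne by (auto simp: K_def)
  ultimately have K: "K = {}" by simp
  show ?thesis
  proof
    fix x assume x: "x \<in> U"
    show "x \<in> closure V"
    proof (rule ccontr)
      assume nx: "x \<notin> closure V"
      have b: "(SOME b. b \<in> Basis) \<noteq> (0::'a)" using some_Basis nonzero_Basis by blast
      show False using outside_V(2,3)[OF x nx b] K x by (auto simp: K_def)
    qed
  qed
qed

lemma dense_generic: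
  assumes conn: "connected U" and ne: "V \<noteq> {}"
  shows "U \<subseteq> closure {x \<in> V. \<tau> x \<noteq> 0}"
proof -
  have "V \<subseteq> closure {x \<in> V. \<tau> x \<noteq> 0}"
  proof
    fix x assume x: "x \<in> V"
    show "x \<in> closure {x \<in> V. \<tau> x \<noteq> 0}"
    proof (rule ccontr)
      assume "x \<notin> closure {x \<in> V. \<tau> x \<noteq> 0}"
      then have "x \<in> V - closure {x \<in> V. \<tau> x \<noteq> 0}" using x by blast
      moreover have "open (V - closure {x \<in> V. \<tau> x \<noteq> 0})" by (intro open_Diff open_V closed_closure)
      ultimately obtain x' where "x' \<in> V - closure {x \<in> V. \<tau> x \<noteq> 0}" "\<tau> x' \<noteq> 0"
        using tau_not_locally_zero[of "V - closure {x \<in> V. \<tau> x \<noteq> 0}" x] by blast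
      then have "x' \<in> {x \<in> V. \<tau> x \<noteq> 0}" by simp
      then have "x' \<in> closure {x \<in> V. \<tau> x \<noteq> 0}" by (rule closure_subset[THEN subsetD])
      then show False using \<open>x' \<in> V - closure {x \<in> V. \<tau> x \<noteq> 0}\<close> by simp
    qed
  qed
  then have "closure V \<subseteq> closure {x \<in> V. \<tau> x \<noteq> 0}" using closure_minimal closed_closure by blast
  then show ?thesis using dense_V[OF assms] by blast
qed

section \<open>Extension to all base points by continuity\<close>

lemma base_continuous:
  assumes "smooth_on Z f" "\<And>x. f (x, 0) = 0"
  shows "continuous_on U (\<lambda>x. f (x, y) :: real)"
  using smooth_on_continuous[OF smooth_section[OF assms(1)]] assms(2) by (cases "y = 0") auto

lemma r_base_continuous: "continuous_on U (\<lambda>x. r (x, y))"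
  by (rule base_continuous[OF sm_r]) (simp add: r_def FN_def F_zero)

lemma q_base_continuous: "continuous_on U (\<lambda>x. q (x, y))"
  by (rule base_continuous[OF sm_q]) (simp add: q_def FN_def F_zero)

text \<open>For fixed fibre arguments, additivity and homogeneity are equations between functions
  continuous in \<open>x\<close>, so they pass from the dense generic points to all of
  \<open>U\<close>.\<close>

theorem fibre_structure:
  assumes conn: "connected U" and ne: "V \<noteq> {}" and x: "x \<in> U"
  shows "linear (\<lambda>y. r (x, y))" "linear (\<lambda>w. q (x, y + w) - q (x, y) - q (x, w))"
proof -
  let ?W = "{x \<in> V. \<tau> x \<noteq> 0}"
  have xW: "x \<in> closure ?W" using dense_generic[OF conn ne] x by blast
  have radd: "r (x, y + w) - (r (x, y) + r (x, w)) = 0" for y w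
    by (rule continuous_zero_on_closure[OF open_U _ _ x xW])
       (use r_additive_generic in \<open>auto intro!: continuous_intros r_base_continuous\<close>)
  have "r (x, y + w) = r (x, y) + r (x, w)" for y w
    using radd[of y w] by simp
  then show "linear (\<lambda>y. r (x, y))"
    using r_scale[OF x] by (intro linearI) auto
  define M where "M x w = q (x, y + w) - q (x, y) - q (x, w)" for x w
  have lin: "linear (M x)" if xw: "x \<in> ?W" for x
  proof (cases "y = 0")
    case True
    then have "M x = (\<lambda>w. 0)" by (simp add: fun_eq_iff M_def q_def FN_def F_zero)
    then show ?thesis by (simp add: linear_iff)
  next
    case False
    have "M x = (\<lambda>w. dd q (0, w) (x, y))"
      using q_polar_generic[of x y] xw False by (auto simp: M_def)
    moreover have "(x, y) \<in> Z" using xw False by simp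
    ultimately show ?thesis
      using linear_compose[OF _ linear_dd[OF sm_q], of "\<lambda>w. (0, w)" "(x, y)"] by (simp add: o_def linear_iff)
  qed
  have Mc: "continuous_on U (\<lambda>x. M x w)" for w
    unfolding M_def by (intro continuous_intros q_base_continuous)
  have 1: "M x (w + w') - (M x w + M x w') = 0" for w w'
    by (rule continuous_zero_on_closure[OF open_U _ _ x xW]) (auto intro!: continuous_intros Mc simp: linear_add[OF lin])
  have 2: "M x (k *\<^sub>R w) - k * M x w = 0" for k w
    by (rule continuous_zero_on_closure[OF open_U _ _ x xW]) (auto intro!: continuous_intros Mc simp: linear_cmul[OF lin])
  have "linear (M x)"
    by (rule linearI) (use 1 2 in \<open>simp_all add: algebra_simps\<close>)
  then show "linear (\<lambda>w. q (x, y + w) - q (x, y) - q (x, w))"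
    by (simp add: M_def[abs_def])
qed

end

section \<open>Geodesics and the projective factor\<close>

lemma smooth_on_lipschitz_cball:
  fixes f :: "'e::euclidean_space \<Rightarrow> 'b::real_normed_vector"
  assumes sm: "smooth_on S f" and sub: "cball z0 r \<subseteq> S"
  shows "\<exists>L\<ge>0. \<forall>x\<in>cball z0 r. \<forall>y\<in>cball z0 r. norm (f x - f y) \<le> L * norm (x - y)"
proof -
  have "\<exists>K. \<forall>x\<in>cball z0 r. norm (dd f b x) \<le> K" for b
    using compact_imp_bounded[OF compact_continuous_image[OF
      continuous_on_subset[OF smooth_on_continuous[OF smooth_on_dd[OF sm]] sub] compact_cball], of b]
    by (auto simp: bounded_iff)
  then obtain K where K: "\<And>b x. x \<in> cball z0 r \<Longrightarrow> norm (dd f b x) \<le> K b" by metis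
  define L where "L = \<bar>\<Sum>b\<in>Basis. K b\<bar>"
  have der: "(f has_derivative (\<lambda>v. dd f v x)) (at x within cball z0 r)" if "x \<in> cball z0 r" for x
    by (rule has_derivative_at_withinI[OF smooth_on_has_derivative[OF sm subsetD[OF sub that]]])
  have bound: "onorm (\<lambda>v. dd f v x) \<le> L" if "x \<in> cball z0 r" for x
  proof -
    have "onorm (\<lambda>v. dd f v x) \<le> (\<Sum>b\<in>Basis. norm (dd f b x))"
      by (rule onorm_componentwise) (rule has_derivative_bounded_linear[OF der[OF that]])
    also have "\<dots> \<le> (\<Sum>b\<in>Basis. K b)" by (intro sum_mono K that)
    finally show ?thesis by (simp add: L_def)
  qed
  have "norm (f x - f y) \<le> L * norm (x - y)" if "x \<in> cball z0 r" "y \<in> cball z0 r" for x y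
    by (rule differentiable_bound[OF convex_cball der bound]) (use that in auto)
  then show ?thesis by (intro exI[of _ L]) (auto simp: L_def)
qed

text \<open>Picard iteration for the vector field cut off by the projection to a ball, for which it is
  globally Lipschitz.\<close>

lemma forward_solution_exists:
  fixes f :: "'e::euclidean_space \<Rightarrow> 'e"
  assumes S: "open S" and sm: "smooth_on S f" and z0: "z0 \<in> S"
  shows "\<exists>\<epsilon>>0. \<exists>c. continuous_on UNIV c \<and> c 0 = z0 \<and>
    (\<forall>t\<in>{0<..<\<epsilon>}. c t \<in> S \<and> (c has_vector_derivative f (c t)) (at t))"
proof -
  obtain r where r: "r > 0" "cball z0 r \<subseteq> S" using S z0 open_contains_cball by blast
  obtain L where L: "L \<ge> 0" "\<And>x y. x \<in> cball z0 r \<Longrightarrow> y \<in> cball z0 r \<Longrightarrow> norm (f x - f y) \<le> L * norm (x - y)"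
    using smooth_on_lipschitz_cball[OF sm r(2)] by blast
  have cf: "continuous_on (cball z0 r) f"
    using smooth_on_continuous[OF sm] r(2) continuous_on_subset by blast
  have "\<exists>M. \<forall>x\<in>cball z0 r. norm (f x) \<le> M"
    using compact_imp_bounded[OF compact_continuous_image[OF cf compact_cball]] by (auto simp: bounded_iff)
  then obtain M where M: "\<And>x. x \<in> cball z0 r \<Longrightarrow> norm (f x) \<le> M" by blast
  have M0: "M \<ge> 0" using M[of z0] r(1) by (meson centre_in_cball less_imp_le norm_ge_zero order_trans)
  define pr where "pr = closest_point (cball z0 r)"
  have pr: "pr x \<in> cball z0 r" for x
    unfolding pr_def using r(1) by (intro closest_point_in_set) auto
  have pr_id: "pr x = x" if "x \<in> cball z0 r" for x
    using that by (simp add: pr_def closest_point_self)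
  have pr_lip: "norm (pr x - pr y) \<le> norm (x - y)" for x y
    using closest_point_lipschitz[of "cball z0 r" x y] r(1) by (simp add: pr_def dist_norm)
  define g where "g = f \<circ> pr"
  have g_lip: "norm (g x - g y) \<le> L * norm (x - y)" for x y
    using L(2)[OF pr pr, of x y] mult_left_mono[OF pr_lip L(1), of x y] by (simp add: g_def)
  have gM: "norm (g x) \<le> M" for x using M[OF pr] by (simp add: g_def)
  have gc: "continuous_on UNIV g"
  proof -
    have "continuous_on UNIV pr"
      unfolding pr_def using r(1) by (intro continuous_on_closest_point) auto
    then show ?thesis
      unfolding g_def using pr by (intro continuous_on_compose continuous_on_subset[OF cf]) auto
  qed
  \<comment> \<open>The first bound makes the Picard operator a contraction with factor 1/2; the
    second keeps the curve in the ball of radius \<open>r\<close>, where the projection is the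
    identity.\<close>
  define \<epsilon> where "\<epsilon> = min (1 / (2 * (L + 1))) (r / (M + 1))"
  have eps: "\<epsilon> > 0" using L(1) M0 r(1) by (simp add: \<epsilon>_def)
  have epsL: "\<epsilon> * L \<le> 1/2"
  proof -
    have "\<epsilon> * L \<le> (1 / (2 * (L + 1))) * (L + 1)"
      using L(1) by (intro mult_mono) (auto simp: \<epsilon>_def)
    also have "\<dots> = 1/2" using L(1) by (simp add: field_simps)
    finally show ?thesis .
  qed
  have epsM: "\<epsilon> * M \<le> r"
  proof -
    have "\<epsilon> * M \<le> (r / (M + 1)) * (M + 1)"
      using M0 r(1) by (intro mult_mono) (auto simp: \<epsilon>_def)
    then show ?thesis using M0 by simp
  qed
  \<comment> \<open>Clamping time lets the Picard operator act on the bounded continuous functions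
    on the whole line, a complete space.\<close>
  define cl where "cl t = max 0 (min t \<epsilon>)" for t :: real
  have cl: "0 \<le> cl t" "cl t \<le> \<epsilon>" for t using eps by (auto simp: cl_def)
  define T where "T \<phi> t = z0 + integral {0..cl t} (\<lambda>s. g (\<phi> s))" for \<phi> :: "real \<Rightarrow> 'e" and t
  have gphi: "continuous_on X (\<lambda>s. g (\<phi> s))" if "continuous_on UNIV \<phi>" for \<phi> :: "real \<Rightarrow> 'e" and X
    by (rule continuous_on_compose2[OF gc continuous_on_subset[OF that]]) auto
  have int: "(\<lambda>s. g (\<phi> s)) integrable_on {0..a}" if "continuous_on UNIV \<phi>" for \<phi> :: "real \<Rightarrow> 'e" and a
    by (rule integrable_continuous_real[OF gphi[OF that]])
  have T_bc: "T \<phi> \<in> bcontfun" if "continuous_on UNIV \<phi>" for \<phi>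
  proof (rule bcontfun_normI[where b = "norm z0 + M * \<epsilon>"])
    have "continuous_on {0..\<epsilon>} (\<lambda>a. integral {0..a} (\<lambda>s. g (\<phi> s)))"
      by (rule indefinite_integral_continuous_1[OF int[OF that]])
    moreover have "continuous_on UNIV cl" unfolding cl_def by (intro continuous_intros)
    ultimately have "continuous_on UNIV (\<lambda>t. integral {0..cl t} (\<lambda>s. g (\<phi> s)))"
      by (rule continuous_on_compose2) (use cl in auto)
    then show "continuous_on UNIV (T \<phi>)"
      unfolding T_def by (intro continuous_on_add continuous_on_const)
    fix t
    have "norm (integral {0..cl t} (\<lambda>s. g (\<phi> s))) \<le> M * (cl t - 0)"
      by (rule integral_bound[OF cl(1) gphi[OF that]]) (rule gM)
    also have "\<dots> \<le> M * \<epsilon>" using cl[of t] M0 by (simp add: mult_left_mono)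
    finally show "norm (T \<phi> t) \<le> norm z0 + M * \<epsilon>"
      unfolding T_def using norm_triangle_ineq[of z0 "integral {0..cl t} (\<lambda>s. g (\<phi> s))"] by linarith
  qed
  define TT :: "(real \<Rightarrow>\<^sub>C 'e) \<Rightarrow> (real \<Rightarrow>\<^sub>C 'e)" where "TT \<phi> = Bcontfun (T (apply_bcontfun \<phi>))" for \<phi>
  have TT: "apply_bcontfun (TT \<phi>) t = T (apply_bcontfun \<phi>) t" for \<phi> t
    unfolding TT_def by (simp add: Bcontfun_inverse T_bc)
  have "dist (TT \<phi>) (TT \<psi>) \<le> (1/2) * dist \<phi> \<psi>" for \<phi> \<psi>
  proof (rule dist_bound)
    fix t
    have "apply_bcontfun (TT \<phi>) t - apply_bcontfun (TT \<psi>) t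
        = integral {0..cl t} (\<lambda>s. g (apply_bcontfun \<phi> s) - g (apply_bcontfun \<psi> s))"
      unfolding TT T_def by (subst integral_diff) (auto intro!: int)
    also have "norm \<dots> \<le> (L * dist \<phi> \<psi>) * (cl t - 0)"
    proof (rule integral_bound[OF cl(1)])
      show "continuous_on {0..cl t} (\<lambda>s. g (apply_bcontfun \<phi> s) - g (apply_bcontfun \<psi> s))"
        by (intro continuous_on_diff gphi) auto
      fix s
      show "norm (g (apply_bcontfun \<phi> s) - g (apply_bcontfun \<psi> s)) \<le> L * dist \<phi> \<psi>"
        using g_lip[of "apply_bcontfun \<phi> s" "apply_bcontfun \<psi> s"]
          mult_left_mono[OF dist_bounded[of \<phi> s \<psi>] L(1)] by (simp add: dist_norm)
    qed
    also have "\<dots> \<le> (L * dist \<phi> \<psi>) * \<epsilon>" using cl[of t] L(1) by (intro mult_left_mono) auto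
    also have "\<dots> = (\<epsilon> * L) * dist \<phi> \<psi>" by simp
    also have "\<dots> \<le> (1/2) * dist \<phi> \<psi>" by (intro mult_right_mono epsL) auto
    finally show "dist (apply_bcontfun (TT \<phi>) t) (apply_bcontfun (TT \<psi>) t) \<le> (1/2) * dist \<phi> \<psi>"
      by (simp add: dist_norm)
  qed
  then obtain \<phi> where fixp: "TT \<phi> = \<phi>"
    using banach_fix_type[of "1/2" TT] by auto
  define c where "c = apply_bcontfun \<phi>"
  have cc: "continuous_on UNIV c" by (simp add: c_def)
  have ceq: "c t = z0 + integral {0..cl t} (\<lambda>s. g (c s))" for t
    using TT[of \<phi> t] by (simp add: fixp c_def T_def)
  have "cl 0 = 0" using eps by (simp add: cl_def)
  then have c0: "c 0 = z0" using ceq[of 0] by simp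
  have cin: "c t \<in> cball z0 r" for t
  proof -
    have "norm (integral {0..cl t} (\<lambda>s. g (c s))) \<le> M * (cl t - 0)"
      by (rule integral_bound[OF cl(1) gphi[OF cc]]) (rule gM)
    also have "\<dots> \<le> M * \<epsilon>" using cl[of t] M0 by (simp add: mult_left_mono)
    also have "\<dots> \<le> r" using epsM by (simp add: mult.commute)
    finally have "norm (c t - z0) \<le> r" by (subst ceq) simp
    then show ?thesis by (simp add: dist_norm norm_minus_commute)
  qed
  have "(c has_vector_derivative f (c t)) (at t)" if t: "t \<in> {0<..<\<epsilon>}" for t
  proof -
    have "((\<lambda>a. integral {0..a} (\<lambda>s. g (c s))) has_vector_derivative g (c t)) (at t within {0..\<epsilon>})"
      by (rule integral_has_vector_derivative[OF gphi[OF cc]]) (use t in auto)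
    then have "((\<lambda>a. integral {0..a} (\<lambda>s. g (c s))) has_vector_derivative g (c t)) (at t within {0<..<\<epsilon>})"
      by (rule has_vector_derivative_within_subset) auto
    then have d0: "((\<lambda>a. integral {0..a} (\<lambda>s. g (c s))) has_vector_derivative g (c t)) (at t)"
      using t at_within_open[of t "{0<..<\<epsilon>}"] by simp
    have d: "((\<lambda>a. z0 + integral {0..a} (\<lambda>s. g (c s))) has_vector_derivative g (c t)) (at t)"
      using has_vector_derivative_add[OF has_vector_derivative_const[of z0] d0] by simp
    have "(c has_vector_derivative g (c t)) (at t)"
    proof (rule has_vector_derivative_transform_within_open[OF d])
      show "open {0<..<\<epsilon>}" "t \<in> {0<..<\<epsilon>}" using t by auto
      show "z0 + integral {0..s} (\<lambda>s. g (c s)) = c s" if "s \<in> {0<..<\<epsilon>}" for s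
      proof -
        have "cl s = s" using that by (simp add: cl_def)
        then show ?thesis using ceq[of s] by simp
      qed
    qed
    then show ?thesis using pr_id[OF cin] by (simp add: g_def)
  qed
  then show ?thesis
    using eps cc c0 cin r(2) by (intro exI[of _ \<epsilon>] conjI exI[of _ c]) auto
qed

text \<open>The components of the curve orthogonal to its line are constant, so velocity and
  acceleration are both multiples of the direction \<open>w\<close> of the line.\<close>

lemma collinear_acceleration:
  fixes c v :: "real \<Rightarrow> 'e::euclidean_space"
  assumes I: "open I" "t \<in> I" and col: "collinear (c ` I)"
    and c: "\<And>t. t \<in> I \<Longrightarrow> (c has_vector_derivative v t) (at t)"
    and v: "(v has_vector_derivative a) (at t)" and ne: "v t \<noteq> 0"
  shows "a = ((a \<bullet> v t) / (v t \<bullet> v t)) *\<^sub>R v t"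
proof -
  obtain w where w: "\<And>x y. x \<in> c ` I \<Longrightarrow> y \<in> c ` I \<Longrightarrow> \<exists>k. x - y = k *\<^sub>R w"
    using col unfolding collinear_def by blast
  have der0: "n \<bullet> p' = 0" if "t \<in> I" "(p has_vector_derivative p') (at t)" "\<And>s. s \<in> I \<Longrightarrow> n \<bullet> p s = n \<bullet> p t"
    for n p' and p :: "real \<Rightarrow> 'e" and t
  proof -
    have "((\<lambda>s. n \<bullet> p s) has_vector_derivative n \<bullet> p') (at t)"
      using bounded_linear.has_vector_derivative[OF bounded_linear_inner_right that(2)] .
    then have "((\<lambda>s. n \<bullet> p t) has_vector_derivative n \<bullet> p') (at t)"
      by (rule has_vector_derivative_transform_within_open[OF _ I(1) that(1)]) (rule that(3))
    then show ?thesis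
      using vector_derivative_unique_at[OF _ has_vector_derivative_const] by blast
  qed
  have nv: "n \<bullet> v s = 0" if n: "n \<bullet> w = 0" and s: "s \<in> I" for n s
  proof (rule der0[OF s c[OF s]])
    fix s' assume "s' \<in> I"
    then obtain k where "c s' - c s = k *\<^sub>R w" using w[of "c s'" "c s"] s by blast
    then have "n \<bullet> (c s' - c s) = 0" using n by simp
    then show "n \<bullet> c s' = n \<bullet> c s" by (simp add: inner_diff_right)
  qed
  have na: "n \<bullet> a = 0" if n: "n \<bullet> w = 0" for n
    by (rule der0[OF I(2) v]) (simp add: nv[OF n] I(2))
  have span: "\<exists>k. p = k *\<^sub>R w" if "\<And>n. n \<bullet> w = 0 \<Longrightarrow> n \<bullet> p = 0" for p
  proof -
    define n where "n = p - ((p \<bullet> w) / (w \<bullet> w)) *\<^sub>R w"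
    have nw: "n \<bullet> w = 0" by (cases "w = 0") (simp_all add: n_def inner_diff_left)
    have "n \<bullet> n = n \<bullet> p - ((p \<bullet> w) / (w \<bullet> w)) * (n \<bullet> w)"
      unfolding n_def by (simp add: inner_diff_right inner_diff_left)
    then have "n = 0" using nw that[OF nw] by simp
    then show ?thesis by (auto simp: n_def)
  qed
  obtain k where k: "v t = k *\<^sub>R w" using span nv I(2) by blast
  obtain m where m: "a = m *\<^sub>R w" using span na by blast
  show ?thesis using ne unfolding k m by simp
qed

lemma smooth_on_linear_compose:
  "open S \<Longrightarrow> bounded_linear A \<Longrightarrow> smooth_on S f \<Longrightarrow> smooth_on S (\<lambda>x. A (f x))"
  by (simp add: smooth_on_def Ck_on_linear_compose)

lemma smooth_on_Pair:
  assumes "open S" "smooth_on S f" "smooth_on S g"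
  shows "smooth_on S (\<lambda>x. (f x, g x))"
proof -
  have "bounded_linear (\<lambda>a. (a, 0))" "bounded_linear (\<lambda>b. (0, b))"
    by (intro bounded_linear_Pair bounded_linear_ident bounded_linear_zero)+
  from smooth_on_add[OF assms(1) smooth_on_linear_compose[OF assms(1) this(1) assms(2)]
      smooth_on_linear_compose[OF assms(1) this(2) assms(3)]]
  show ?thesis by simp
qed

lemma smooth_on_det:
  fixes M :: "'a::real_normed_vector \<Rightarrow> real^'n^'n"
  assumes "open S" "\<And>i j. smooth_on S (\<lambda>z. M z $ i $ j)"
  shows "smooth_on S (\<lambda>z. det (M z))"
  unfolding det_def
  by (intro smooth_on_sum smooth_on_mult smooth_on_prod smooth_on_const assms)

lemma linear_sum_axis:
  fixes f :: "real^'n \<Rightarrow> real"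
  assumes "linear f"
  shows "(\<Sum>i\<in>UNIV. f (axis i 1) * v $ i) = f v"
proof -
  have "f v = f (\<Sum>i\<in>UNIV. v $ i *s axis i 1)" by (simp add: basis_expansion)
  also have "\<dots> = (\<Sum>i\<in>UNIV. v $ i * f (axis i 1))"
    by (simp add: scalar_mult_eq_scaleR linear_sum[OF assms] linear_cmul[OF assms])
  finally show ?thesis by (simp add: mult.commute)
qed

lemma matrix_inv_right:
  fixes M :: "real^'n^'n"
  assumes "invertible M"
  shows "M ** matrix_inv M = mat 1"
  using assms unfolding invertible_def matrix_inv_def by (rule someI2_ex) auto

locale finsler_space = slit_bundle U for U :: "(real^'n) set" +
  fixes F :: "real^'n \<Rightarrow> real^'n \<Rightarrow> real"
  assumes finsler: "finsler_metric U F"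
begin

lemma frechet_partial:
  assumes "smooth_on Z G" "\<And>x y. (x, y) \<in> Z \<Longrightarrow> K x y = G (x, y)" "(x, y) \<in> Z"
  shows "dx k K x y = dd G (axis k 1, 0) (x, y)" "dy k K x y = dd G (0, axis k 1) (x, y)"
proof -
  have x: "x \<in> U" and y: "y \<in> - {0}" using assms(3) by auto
  note G = smooth_on_has_derivative[OF assms(1,3)]
  have "((\<lambda>z. (z, y)) has_derivative (\<lambda>h. (h, 0))) (at x)"
    by (auto intro!: derivative_eq_intros)
  from has_derivative_compose[OF this G]
  have "((\<lambda>z. K z y) has_derivative (\<lambda>h. dd G (h, 0) (x, y))) (at x)"
    by (rule has_derivative_transform_within_open[OF _ open_U x]) (use y assms(2) in auto)
  then show "dx k K x y = dd G (axis k 1, 0) (x, y)"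
    unfolding dx_def by (simp add: frechet_derivative_at[symmetric])
  have "((\<lambda>z. (x, z)) has_derivative (\<lambda>h. (0, h))) (at y)"
    by (auto intro!: derivative_eq_intros)
  from has_derivative_compose[OF this G]
  have "((\<lambda>z. K x z) has_derivative (\<lambda>h. dd G (0, h) (x, y))) (at y)"
    by (rule has_derivative_transform_within_open[OF _ _ y]) (use x assms(2) in \<open>auto simp: open_Compl\<close>)
  then show "dy k K x y = dd G (0, axis k 1) (x, y)"
    unfolding dy_def by (simp add: frechet_derivative_at[symmetric])
qed

text \<open>\<open>F x 0\<close> is unconstrained for \<open>x \<notin> U\<close>, hence the case distinction.\<close>

definition Fu :: "(real^'n) \<times> (real^'n) \<Rightarrow> real" where
  "Fu z = (if snd z = 0 then 0 else F (fst z) (snd z))"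
definition E :: "(real^'n) \<times> (real^'n) \<Rightarrow> real" where "E z = (Fu z)\<^sup>2"

lemma Fu_F: "x \<in> U \<Longrightarrow> Fu (x, y) = F x y"
  using finsler by (auto simp: Fu_def finsler_metric_def)

lemma smFu: "smooth_on Z Fu"
proof -
  have "smooth_on Z (\<lambda>(x, y). F x y)" using finsler by (simp add: finsler_metric_def)
  then show ?thesis
    using smooth_on_cong[OF open_Z, of Fu "\<lambda>(x, y). F x y"] by (auto simp: Fu_def)
qed

lemma smE: "smooth_on Z E"
  unfolding E_def[abs_def] by (intro smooth_Z smFu)

lemma Fu_pos: "z \<in> Z \<Longrightarrow> Fu z > 0"
  using finsler Fu_F[of "fst z" "snd z"] unfolding finsler_metric_def
  by (cases z) (auto simp: less_le)

lemma Fu_hom: "x \<in> U \<Longrightarrow> l > 0 \<Longrightarrow> Fu (x, l *\<^sub>R y) = l * Fu (x, y)"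
  using finsler by (simp add: Fu_F finsler_metric_def)

lemma Eu_Fu:
  assumes z: "z \<in> Z"
  shows "dd Fu (0, snd z) z = Fu z"
proof -
  obtain x y where xy: "z = (x, y)" "x \<in> U" "y \<noteq> 0" using z by auto
  have "((\<lambda>s. Fu (z + s *\<^sub>R (0, y))) has_real_derivative dd Fu (0, y) (z + 0 *\<^sub>R (0, y))) (at 0)"
    by (rule dd_along_line) (use smooth_on_differentiable[OF smFu z] in \<open>simp flip: zero_prod_def\<close>)
  then have 1: "((\<lambda>s. Fu (z + s *\<^sub>R (0, y))) has_real_derivative dd Fu (0, y) z) (at 0)"
    by (simp flip: zero_prod_def)
  have e: "Fu (z + s *\<^sub>R (0, y)) = (1 + s) * Fu z" if "s \<in> {-1<..<1}" for s
    using Fu_hom[OF xy(2), of "1 + s" y] that by (simp add: xy(1) algebra_simps)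
  have "((\<lambda>s. (1 + s) * Fu z) has_real_derivative Fu z) (at 0)"
    by (auto intro!: derivative_eq_intros)
  then have "((\<lambda>s. Fu (z + s *\<^sub>R (0, y))) has_real_derivative Fu z) (at 0)"
    by (rule has_field_derivative_transform_within_open[where S = "{-1<..<1}"]) (auto simp: e[simplified])
  then show ?thesis using 1 DERIV_unique xy by fastforce
qed

lemma dd_E: "z \<in> Z \<Longrightarrow> dd E v z = 2 * Fu z * dd Fu v z"
  unfolding E_def[abs_def] by (rule dd_square[OF smFu])

lemma linear_fibre: "smooth_on Z G \<Longrightarrow> z \<in> Z \<Longrightarrow> linear (\<lambda>w. dd G (0, w) z)" for G :: "(real^'n) \<times> (real^'n) \<Rightarrow> real"
  using linear_compose[OF _ linear_dd, of "\<lambda>w. (0, w)" Z G z] by (simp add: o_def linear_iff)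

lemma linear_base: "smooth_on Z G \<Longrightarrow> z \<in> Z \<Longrightarrow> linear (\<lambda>w. dd G (w, 0) z)" for G :: "(real^'n) \<times> (real^'n) \<Rightarrow> real"
  using linear_compose[OF _ linear_dd, of "\<lambda>w. (w, 0)" Z G z] by (simp add: o_def linear_iff)

lemma E_F: "(x, y) \<in> Z \<Longrightarrow> (F x y)\<^sup>2 = E (x, y)"
  by (simp add: E_def Fu_F)

lemma fund_tensor_nth:
  assumes z: "(x, y) \<in> Z"
  shows "fund_tensor F x y $ i $ j = 1/2 * dd (dd E (0, axis i 1)) (0, axis j 1) (x, y)"
proof -
  have "dy i (\<lambda>x y. (F x y)\<^sup>2) x y = dd E (0, axis i 1) (x, y)" if "(x, y) \<in> Z" for x y
    by (rule frechet_partial(2)[OF smE E_F that])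
  from frechet_partial(2)[OF smooth_on_dd[OF smE] this z] show ?thesis
    by (simp add: fund_tensor_def)
qed

lemma fund_tensor_inner:
  assumes z: "(x, y) \<in> Z"
  shows "w \<bullet> (fund_tensor F x y *v v) = 1/2 * dd (dd E (0, v)) (0, w) (x, y)"
proof -
  have comp: "(fund_tensor F x y *v v) $ i = 1/2 * dd (dd E (0, v)) (0, axis i 1) (x, y)" for i
  proof -
    have "(fund_tensor F x y *v v) $ i = 1/2 * (\<Sum>j\<in>UNIV. dd (dd E (0, axis i 1)) (0, axis j 1) (x, y) * v $ j)"
      by (simp add: matrix_vector_mult_def fund_tensor_nth[OF z] sum_distrib_left mult.assoc)
    also have "\<dots> = 1/2 * dd (dd E (0, axis i 1)) (0, v) (x, y)"
      by (simp add: linear_sum_axis[OF linear_fibre[OF smooth_on_dd[OF smE] z]])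
    finally show ?thesis using dd_commute[OF open_Z smE z, of "(0, v)" "(0, axis i 1)"] by simp
  qed
  have "w \<bullet> (fund_tensor F x y *v v) = 1/2 * (\<Sum>i\<in>UNIV. dd (dd E (0, v)) (0, axis i 1) (x, y) * w $ i)"
    unfolding inner_vec_def comp by (simp add: sum_distrib_left mult_ac)
  then show ?thesis by (simp add: linear_sum_axis[OF linear_fibre[OF smooth_on_dd[OF smE] z]])
qed

lemma fund_tensor_det:
  assumes z: "(x, y) \<in> Z"
  shows "det (fund_tensor F x y) \<noteq> 0"
proof -
  have "pos_def (fund_tensor F x y)" using finsler z by (auto simp: finsler_metric_def)
  then have "v = 0" if "fund_tensor F x y *v v = 0" for v
    using that unfolding pos_def_def by (metis inner_zero_right less_irrefl)
  then show ?thesis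
    by (simp add: invertible_det_nz[symmetric] invertible_left_inverse matrix_left_invertible_ker)
qed

definition covector :: "real^'n \<Rightarrow> (real^'n) \<times> (real^'n) \<Rightarrow> real" where
  "covector w z = dd (dd E (0, w)) (snd z, 0) z - dd E (w, 0) z"

definition G :: "(real^'n) \<times> (real^'n) \<Rightarrow> real^'n" where
  "G z = (\<chi> i. geod_coeff F i (fst z) (snd z))"

lemma fund_tensor_G:
  assumes z: "(x, y) \<in> Z"
  shows "fund_tensor F x y *v G (x, y) = (\<chi> l. 1/4 * covector (axis l 1) (x, y))"
proof -
  define V where "V = (\<chi> l. covector (axis l 1) (x, y))"
  have d: "dx m (\<lambda>x y. (F x y)\<^sup>2) x y = dd E (axis m 1, 0) (x, y)" if "(x, y) \<in> Z" for x y m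
    by (rule frechet_partial(1)[OF smE E_F that])
  have dd: "dy l (dx m (\<lambda>x y. (F x y)\<^sup>2)) x y = dd (dd E (0, axis l 1)) (axis m 1, 0) (x, y)" for l m
    using frechet_partial(2)[OF smooth_on_dd[OF smE] d z] dd_commute[OF open_Z smE z] by simp
  have "(\<Sum>m\<in>UNIV. dy l (dx m (\<lambda>x y. (F x y)\<^sup>2)) x y * y $ m) - dx l (\<lambda>x y. (F x y)\<^sup>2) x y = V $ l" for l
    unfolding dd d[OF z] V_def covector_def
    by (simp add: linear_sum_axis[OF linear_base[OF smooth_on_dd[OF smE] z]])
  then have "G (x, y) = (1/4) *\<^sub>R (matrix_inv (fund_tensor F x y) *v V)"
    by (simp add: G_def geod_coeff_def vec_eq_iff matrix_vector_mult_def)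
  then have "fund_tensor F x y *v G (x, y) = (1/4) *\<^sub>R ((fund_tensor F x y ** matrix_inv (fund_tensor F x y)) *v V)"
    by (simp add: matrix_vector_mult_scaleR matrix_vector_mul_assoc)
  also have "fund_tensor F x y ** matrix_inv (fund_tensor F x y) = mat 1"
    using fund_tensor_det[OF z] by (simp add: invertible_det_nz matrix_inv_right)
  finally show ?thesis by (simp add: V_def vec_eq_iff)
qed

lemma smG: "smooth_on Z G"
proof -
  define M where "M k z = (\<chi> i j. if j = k then 1/4 * covector (axis i 1) z
     else 1/2 * dd (dd E (0, axis i 1)) (0, axis j 1) z)" for k :: 'n and z
  define N where "N z = (\<chi> i j. 1/2 * dd (dd E (0, axis i 1)) (0, axis j 1) z)" for z
  have N: "fund_tensor F x y = N (x, y)" if "(x, y) \<in> Z" for x y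
    by (simp add: N_def vec_eq_iff fund_tensor_nth[OF that])
  have cov: "smooth_on Z (covector w)" for w
    unfolding covector_def[abs_def] by (intro smooth_Z smooth_hor smE)
  have "smooth_on Z (\<lambda>z. \<chi> k. det (M k z) / det (N z))"
  proof (intro smooth_on_vec smooth_on_divide smooth_on_det open_Z)
    show "smooth_on Z (\<lambda>z. M k z $ i $ j)" for k i j
      by (cases "j = k") (auto simp: M_def intro!: smooth_Z cov smE smooth_on_divide[OF open_Z])
    show "smooth_on Z (\<lambda>z. N z $ i $ j)" for i j
      by (auto simp: N_def intro!: smooth_Z smE smooth_on_divide[OF open_Z])
    show "det (N z) \<noteq> 0" if "z \<in> Z" for z
      using fund_tensor_det[of "fst z" "snd z"] N[of "fst z" "snd z"] that by simp
  qed
  moreover have "(\<chi> k. det (M k z) / det (N z)) = G z" if "z \<in> Z" for z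
  proof -
    have z: "(fst z, snd z) \<in> Z" using that by simp
    have "G z = (\<chi> k. det (\<chi> i j. if j = k then (\<chi> l. 1/4 * covector (axis l 1) z) $ i else N z $ i $ j) / det (N z))"
    proof (rule cramer[THEN iffD1])
      show "det (N z) \<noteq> 0" using fund_tensor_det[OF z] N[OF z] by simp
      show "N z *v G z = (\<chi> l. 1/4 * covector (axis l 1) z)" using fund_tensor_G[OF z] N[OF z] by simp
    qed
    then show ?thesis by (simp add: M_def N_def cong: if_cong)
  qed
  ultimately show ?thesis
    using smooth_on_cong[OF open_Z, of "\<lambda>z. \<chi> k. det (M k z) / det (N z)" G] by simp
qed

end

locale projectively_flat_space = finsler_space U F
  for U :: "(real^'n) set" and F :: "real^'n \<Rightarrow> real^'n \<Rightarrow> real" +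
  assumes proj: "projectively_flat U F"
begin

lemma G_parallel:
  assumes z: "z \<in> Z"
  shows "G z = ((G z \<bullet> snd z) / (snd z \<bullet> snd z)) *\<^sub>R snd z"
proof -
  define X where "X z = (snd z, (-2) *\<^sub>R G z)" for z
  have smX: "smooth_on Z X"
    unfolding X_def[abs_def]
    by (intro smooth_on_Pair[OF open_Z] smooth_on_scaleR[OF open_Z] smooth_on_const smG smooth_on_linear bounded_linear_snd)
  obtain \<epsilon> c where eps: "\<epsilon> > 0" and c: "continuous_on UNIV c" "c 0 = z"
    and sol: "\<And>t. t \<in> {0<..<\<epsilon>} \<Longrightarrow> c t \<in> Z" "\<And>t. t \<in> {0<..<\<epsilon>} \<Longrightarrow> (c has_vector_derivative X (c t)) (at t)"
    using forward_solution_exists[OF open_Z smX z] by blast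
  have d1: "((\<lambda>t. fst (c t)) has_vector_derivative snd (c t)) (at t)" if "t \<in> {0<..<\<epsilon>}" for t
    using bounded_linear.has_vector_derivative[OF bounded_linear_fst sol(2)[OF that]] by (simp add: X_def)
  have d2: "((\<lambda>t. snd (c t)) has_vector_derivative (-2) *\<^sub>R G (c t)) (at t)" if "t \<in> {0<..<\<epsilon>}" for t
    using bounded_linear.has_vector_derivative[OF bounded_linear_snd sol(2)[OF that]] by (simp add: X_def)
  have "geodesic_on U F {0<..<\<epsilon>} (\<lambda>t. fst (c t))"
    unfolding geodesic_on_def
  proof (intro conjI exI ballI)
    fix t assume t: "t \<in> {0<..<\<epsilon>}"
    show "fst (c t) \<in> U" "snd (c t) \<noteq> 0" using sol(1)[OF t] by auto
    show "((\<lambda>t. fst (c t)) has_vector_derivative snd (c t)) (at t)" by (rule d1[OF t])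
    have "(-2) *\<^sub>R G (c t) = (\<chi> i. - 2 * geod_coeff F i (fst (c t)) (snd (c t)))"
      by (simp add: G_def vec_eq_iff)
    then show "((\<lambda>t. snd (c t)) has_vector_derivative (\<chi> i. - 2 * geod_coeff F i (fst (c t)) (snd (c t)))) (at t)"
      using d2[OF t] by simp
  qed (auto simp: is_interval_oo)
  then have col: "collinear ((\<lambda>t. fst (c t)) ` {0<..<\<epsilon>})"
    using proj by (simp add: projectively_flat_def)
  define K where "K z = G z - ((G z \<bullet> snd z) / (snd z \<bullet> snd z)) *\<^sub>R snd z" for z
  have K0: "K (c t) = 0" if t: "t \<in> {0<..<\<epsilon>}" for t
  proof -
    have "snd (c t) \<noteq> 0" using sol(1)[OF t] by auto
    then have "(-2) *\<^sub>R G (c t) = (((-2) *\<^sub>R G (c t)) \<bullet> snd (c t) / (snd (c t) \<bullet> snd (c t))) *\<^sub>R snd (c t)"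
      by (intro collinear_acceleration[OF open_greaterThanLessThan t col]) (use d1 d2[OF t] in auto)
    also have "\<dots> = (-2) *\<^sub>R (((G (c t) \<bullet> snd (c t)) / (snd (c t) \<bullet> snd (c t))) *\<^sub>R snd (c t))"
      by simp
    finally have "(-2) *\<^sub>R K (c t) = 0" by (simp add: K_def scaleR_diff_right)
    then show ?thesis by simp
  qed
  have "isCont K z"
  proof -
    have "isCont G z" using smooth_on_continuous[OF smG] open_Z z continuous_on_eq_continuous_at by blast
    moreover have "snd z \<bullet> snd z \<noteq> 0" using z by auto
    ultimately show ?thesis unfolding K_def by (intro continuous_intros) auto
  qed
  moreover have "isCont c 0" using c(1) by (simp add: continuous_on_eq_continuous_at)
  then have "(c \<longlongrightarrow> z) (at_right 0)"
    using c(2) by (auto simp: isCont_def intro: tendsto_within_subset)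
  ultimately have "((\<lambda>t. K (c t)) \<longlongrightarrow> K z) (at_right 0)"
    by (rule isCont_tendsto_compose)
  moreover have "eventually (\<lambda>t. K (c t) = 0) (at_right 0)"
    using eps K0 by (auto simp: eventually_at_right_field intro!: exI[of _ \<epsilon>])
  ultimately have "((\<lambda>t::real. 0) \<longlongrightarrow> K z) (at_right 0)"
    by (rule Lim_transform_eventually)
  then have "K z = 0"
    using tendsto_unique[OF trivial_limit_at_right_real _ tendsto_const] by blast
  then show ?thesis by (simp add: K_def)
qed

definition P :: "(real^'n) \<times> (real^'n) \<Rightarrow> real" where "P z = (G z \<bullet> snd z) / (snd z \<bullet> snd z)"

lemma G_P: "z \<in> Z \<Longrightarrow> G z = P z *\<^sub>R snd z"
  using G_parallel by (simp add: P_def)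

lemma smP: "smooth_on Z P"
proof -
  have s: "smooth_on Z snd" by (rule smooth_on_linear[OF bounded_linear_snd])
  show ?thesis
    unfolding P_def[abs_def] by (intro smooth_on_divide smooth_on_inner open_Z smG s) auto
qed

lemma euler_commute:
  fixes f :: "(real^'n) \<times> (real^'n) \<Rightarrow> real"
  assumes "smooth_on Z f" "z \<in> Z"
  shows "dd (\<lambda>z. dd f (snd z, 0) z) (0, snd z) z = dd f (snd z, 0) z + dd (\<lambda>z. dd f (0, snd z) z) (snd z, 0) z"
  using dd_hor[OF assms, of "(0, snd z)"] dd_euler[OF assms, of "(snd z, 0)"] linear_0[OF linear_dd[OF assms]]
    dd_commute[OF open_Z assms, of "(0, snd z)" "(snd z, 0)"] by (simp add: zero_prod_def)

lemma Eu_E: "z \<in> Z \<Longrightarrow> dd E (0, snd z) z = 2 * E z"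
  using Eu_Fu[of z] by (simp add: dd_E E_def power2_eq_square)

lemma covector_P:
  assumes z: "z \<in> Z"
  shows "4 * P z * Fu z * dd Fu (0, w) z = covector w z"
proof -
  have z': "(fst z, snd z) \<in> Z" using z by simp
  have "dd (\<lambda>z. dd E (0, snd z) z) (0, w) z = dd (\<lambda>z. 2 * E z) (0, w) z"
    by (rule dd_eq_Z[OF z smooth_euler[OF smE] Eu_E])
  then have "dd (dd E (0, w)) (0, snd z) z = dd E (0, w) z"
    using dd_euler[OF smE z, of "(0, w)"] by (simp add: dd_rules smE smooth_on_const z dd_const)
  then have g: "w \<bullet> (fund_tensor F (fst z) (snd z) *v snd z) = Fu z * dd Fu (0, w) z"
    using fund_tensor_inner[OF z', of w "snd z"] dd_commute[OF open_Z smE z, of "(0, snd z)" "(0, w)"] by (simp add: dd_E z)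
  have "w \<bullet> (fund_tensor F (fst z) (snd z) *v G z) = 1/4 * (\<Sum>l\<in>UNIV. covector (axis l 1) z * w $ l)"
    using fund_tensor_G[OF z'] by (simp add: inner_vec_def sum_distrib_left mult_ac)
  also have "linear (\<lambda>w. covector w z)"
  proof -
    have "linear (\<lambda>w. dd (dd E (0, w)) (snd z, 0) z)"
      using linear_fibre[OF smooth_on_dd[OF smE] z, of "(snd z, 0)"] dd_commute[OF open_Z smE z, of _ "(snd z, 0)"] by simp
    then show ?thesis unfolding covector_def by (intro linear_compose_sub linear_base[OF smE z])
  qed
  then have "(\<Sum>l\<in>UNIV. covector (axis l 1) z * w $ l) = covector w z"
    by (rule linear_sum_axis)
  finally show ?thesis
    using g by (simp add: G_P[OF z] matrix_vector_mult_scaleR)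
qed

lemma horE: assumes z: "z \<in> Z" shows "dd E (snd z, 0) z = 4 * P z * (Fu z)\<^sup>2"
proof -
  have "dd (\<lambda>z. dd E (0, snd z) z) (snd z, 0) z = dd (\<lambda>z. 2 * E z) (snd z, 0) z"
    by (rule dd_eq_Z[OF z smooth_euler[OF smE] Eu_E])
  then have "dd (\<lambda>z. dd E (0, snd z) z) (snd z, 0) z = 2 * dd E (snd z, 0) z"
    by (simp add: dd_rules smE smooth_on_const z dd_const)
  then have "dd (dd E (0, snd z)) (snd z, 0) z = 2 * dd E (snd z, 0) z"
    using euler_commute[OF smE z] dd_hor[OF smE z, of "(0, snd z)"] by simp
  then have "covector (snd z) z = dd E (snd z, 0) z" by (simp add: covector_def)
  then show ?thesis using covector_P[OF z, of "snd z"] Eu_Fu[OF z] by (simp add: power2_eq_square)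
qed

lemma hamel:
  assumes z: "z \<in> Z"
  shows "dd Fu (w, 0) z = dd P (0, w) z * Fu z + P z * dd Fu (0, w) z"
proof -
  have "dd (\<lambda>z. dd E (snd z, 0) z) (0, w) z = dd (\<lambda>z. 4 * P z * (Fu z)\<^sup>2) (0, w) z"
    by (rule dd_eq_Z[OF z smooth_hor[OF smE] horE])
  then have "dd E (w, 0) z + dd (dd E (0, w)) (snd z, 0) z = 4 * dd P (0, w) z * (Fu z)\<^sup>2 + 8 * P z * Fu z * dd Fu (0, w) z"
    using dd_hor[OF smE z, of "(0, w)"] by (simp add: dd_rules dd_square smP smFu smooth_Z z dd_const algebra_simps)
  then have "4 * Fu z * (dd Fu (w, 0) z - (dd P (0, w) z * Fu z + P z * dd Fu (0, w) z)) = 0"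
    using covector_P[OF z, of w] dd_E[OF z, of "(w, 0)"] unfolding covector_def by algebra
  then show ?thesis using Fu_pos[OF z] by simp
qed

lemma Eu_P:
  assumes z: "z \<in> Z"
  shows "dd P (0, snd z) z = P z"
proof -
  have hF: "dd Fu (snd z, 0) z = 2 * Fu z * P z" if "z \<in> Z" for z
    using horE[OF that] dd_E[OF that] Fu_pos[OF that] by (simp add: power2_eq_square)
  have "dd (\<lambda>z. dd Fu (snd z, 0) z) (0, snd z) z = dd (\<lambda>z. 2 * Fu z * P z) (0, snd z) z"
    by (rule dd_eq_Z[OF z smooth_hor[OF smFu] hF])
  then have 1: "dd (\<lambda>z. dd Fu (snd z, 0) z) (0, snd z) z = 2 * Fu z * dd P (0, snd z) z + 2 * Fu z * P z"
    using Eu_Fu[OF z] by (simp add: dd_rules smP smFu smooth_Z z dd_const algebra_simps)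
  have "dd (\<lambda>z. dd Fu (0, snd z) z) (snd z, 0) z = dd Fu (snd z, 0) z"
    by (rule dd_eq_Z[OF z smooth_euler[OF smFu] Eu_Fu])
  then have "2 * Fu z * (dd P (0, snd z) z - P z) = 0"
    using 1 euler_commute[OF smFu z] hF[OF z] by algebra
  then show ?thesis using Fu_pos[OF z] by simp
qed

lemma riemann_curv_structure:
  assumes z: "(x, y) \<in> Z"
  shows "\<exists>k. riemann_curv F x y *v u = ((P (x, y))\<^sup>2 - dd P (y, 0) (x, y)) *\<^sub>R u + k *\<^sub>R y"
proof -
  define z where "z = (x, y)"
  have zZ: "z \<in> Z" using z by (simp add: z_def)
  define g where "g i z = P z * snd z $ i" for i and z :: "(real^'n) \<times> (real^'n)"
  have lin: "bounded_linear (\<lambda>z :: (real^'n) \<times> (real^'n). snd z $ i)" for i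
    by (rule bounded_linear_compose[OF bounded_linear_vec_nth bounded_linear_snd])
  note sml = smooth_on_linear[OF lin]
  have smg: "smooth_on Z (g i)" for i
    unfolding g_def[abs_def] by (intro smooth_Z smP sml)
  have gG: "geod_coeff F i x y = g i (x, y)" if "(x, y) \<in> Z" for i x y
    using G_P[OF that] by (simp add: G_def g_def vec_eq_iff)
  have dg: "dd (g i) a z = P z * snd a $ i + dd P a z * snd z $ i" if "z \<in> Z" for i a z
    unfolding g_def[abs_def] by (simp add: dd_rules smP sml that dd_linear[OF lin])
  have ddg: "dd (dd (g i) a) b z = dd P b z * snd a $ i + dd P a z * snd b $ i + dd (dd P a) b z * snd z $ i" for i a b
    by (subst dd_eq_Z[OF zZ smooth_on_dd[OF smg], where g = "\<lambda>z. P z * snd a $ i + dd P a z * snd z $ i"])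
       (auto simp: dg dd_rules smP sml smooth_Z zZ dd_linear[OF lin] dd_const)
  have d1: "dx k (geod_coeff F i) x y = dd (g i) (axis k 1, 0) (x, y)" "dy k (geod_coeff F i) x y = dd (g i) (0, axis k 1) (x, y)"
    if "(x, y) \<in> Z" for k i x y
    by (rule frechet_partial(1)[OF smg gG that], assumption, rule frechet_partial(2)[OF smg gG that], assumption)
  have d2: "dy k (dx j (geod_coeff F i)) x y = dd (dd (g i) (axis j 1, 0)) (0, axis k 1) z" for k j i
    unfolding z_def by (rule frechet_partial(2)[OF smooth_on_dd[OF smg] d1(1) z])
  have d3: "dy k (dy j (geod_coeff F i)) x y = dd (dd (g i) (0, axis j 1)) (0, axis k 1) z" for k j i
    unfolding z_def by (rule frechet_partial(2)[OF smooth_on_dd[OF smg] d1(2) z])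
  define X where "X k = dd P (axis k 1, 0) z" for k
  define Y where "Y k = dd P (0, axis k 1) z" for k
  define S1 where "S1 k = (\<Sum>j\<in>UNIV. dd (dd P (axis j 1, 0)) (0, axis k 1) z * y $ j)" for k
  define S2 where "S2 k = (\<Sum>j\<in>UNIV. dd (dd P (0, axis j 1)) (0, axis k 1) z * y $ j)" for k
  define T where "T k = 2 * X k - S1 k + 2 * P z * S2 k + 2 * P z * Y k - (3 * P z * Y k)" for k
  have sX: "(\<Sum>j\<in>UNIV. X j * y $ j) = dd P (y, 0) z" and sY: "(\<Sum>j\<in>UNIV. Y j * y $ j) = P z"
    using linear_sum_axis[OF linear_base[OF smP zZ], of y] linear_sum_axis[OF linear_fibre[OF smP zZ], of y] Eu_P[OF zZ]
    by (simp_all add: X_def Y_def z_def)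
  define \<delta> where "\<delta> i j = (if i = j then 1 else 0 :: real)" for i j :: 'n
  have ax: "axis k 1 $ i = \<delta> i k" for k i :: 'n by (simp add: axis_def \<delta>_def)
  have sum_d: "(\<Sum>j\<in>UNIV. \<delta> i j * f j) = f i" "(\<Sum>j\<in>UNIV. f j * \<delta> j i) = f i" "(\<Sum>j\<in>UNIV. f j * \<delta> i j) = f i" for f i
    by (simp_all add: \<delta>_def mult_delta_left mult_delta_right)
  have R: "riemann_curv F x y $ i $ k = ((P z)\<^sup>2 - dd P (y, 0) z) * \<delta> i k + y $ i * T k" for i k
  proof -
    have a: "dx k (geod_coeff F i) x y = X k * y $ i" for k i
      by (simp add: d1[OF z] dg[OF z] X_def z_def)
    have b: "dy k (geod_coeff F i) x y = Y k * y $ i + P z * \<delta> i k" for k i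
      by (simp add: d1[OF z] dg[OF z] Y_def z_def ax)
    have c: "dy k (dx j (geod_coeff F i)) x y = X j * \<delta> i k + dd (dd P (axis j 1, 0)) (0, axis k 1) z * y $ i" for j
      by (simp add: d2 ddg X_def ax) (simp add: z_def)
    have d: "dy k (dy j (geod_coeff F i)) x y = Y k * \<delta> i j + Y j * \<delta> i k + dd (dd P (0, axis j 1)) (0, axis k 1) z * y $ i" for j
      by (simp add: d3 ddg Y_def ax) (simp add: z_def)
    have e: "geod_coeff F j x y = P z * y $ j" for j by (simp add: gG[OF z] g_def z_def)
    have 1: "(\<Sum>j\<in>UNIV. y $ j * dy k (dx j (geod_coeff F i)) x y) = dd P (y, 0) z * \<delta> i k + S1 k * y $ i"
      unfolding c sX[symmetric] S1_def by (simp add: algebra_simps sum.distrib sum_distrib_left)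
    have 2: "(\<Sum>j\<in>UNIV. geod_coeff F j x y * dy k (dy j (geod_coeff F i)) x y)
        = P z * Y k * y $ i + P z * P z * \<delta> i k + P z * S2 k * y $ i"
    proof -
      have "(\<Sum>j\<in>UNIV. geod_coeff F j x y * dy k (dy j (geod_coeff F i)) x y)
        = (\<Sum>j\<in>UNIV. (P z * Y k * y $ j) * \<delta> i j) + P z * \<delta> i k * (\<Sum>j\<in>UNIV. Y j * y $ j) + P z * y $ i * S2 k"
        unfolding d e S2_def by (simp add: algebra_simps sum.distrib sum_distrib_left)
      then show ?thesis unfolding sum_d sY by (simp add: algebra_simps)
    qed
    have 3: "(\<Sum>j\<in>UNIV. dy j (geod_coeff F i) x y * dy k (geod_coeff F j) x y) = 3 * P z * Y k * y $ i + P z * P z * \<delta> i k"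
    proof -
      have "(\<Sum>j\<in>UNIV. dy j (geod_coeff F i) x y * dy k (geod_coeff F j) x y)
        = y $ i * Y k * (\<Sum>j\<in>UNIV. Y j * y $ j) + (\<Sum>j\<in>UNIV. (P z * y $ i * Y j) * \<delta> j k)
          + (\<Sum>j\<in>UNIV. (P z * Y k * y $ j) * \<delta> i j) + (\<Sum>j\<in>UNIV. (P z * P z * \<delta> i j) * \<delta> j k)"
        unfolding b by (simp add: algebra_simps sum.distrib sum_distrib_left)
      then show ?thesis unfolding sum_d sY by (simp add: algebra_simps)
    qed
    show ?thesis
      unfolding riemann_curv_def by (simp add: 1 2 3 a T_def algebra_simps power2_eq_square)
  qed
  have "riemann_curv F x y *v u = ((P z)\<^sup>2 - dd P (y, 0) z) *\<^sub>R u + (\<Sum>k\<in>UNIV. T k * u $ k) *\<^sub>R y"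
  proof (rule vec_eq_iff[THEN iffD2], rule allI)
    fix i
    have "(riemann_curv F x y *v u) $ i = (\<Sum>k\<in>UNIV. (((P z)\<^sup>2 - dd P (y, 0) z) * u $ k) * \<delta> i k) + y $ i * (\<Sum>k\<in>UNIV. T k * u $ k)"
      by (simp add: matrix_vector_mult_def R sum.distrib sum_subtractf sum_distrib_left algebra_simps)
    then show "(riemann_curv F x y *v u) $ i = (((P z)\<^sup>2 - dd P (y, 0) z) *\<^sub>R u + (\<Sum>k\<in>UNIV. T k * u $ k) *\<^sub>R y) $ i"
      unfolding sum_d by (simp add: mult.commute)
  qed
  then show ?thesis unfolding z_def by blast
qed

lemma horP:
  assumes dim: "CARD('n) \<ge> 2" and weak: "weakly_isotropic_flag_curv U F \<theta> \<sigma>" and zZ: "z \<in> Z"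
  shows "dd P (snd z, 0) z = (P z)\<^sup>2 - 3 * (\<theta> (fst z) \<bullet> snd z) * Fu z - \<sigma> (fst z) * (Fu z)\<^sup>2"
proof -
  obtain x y where z: "z = (x, y)" by (cases z)
  have xy: "(x, y) \<in> Z" "x \<in> U" "y \<noteq> 0" using zZ z by auto
  define g where "g v w = v \<bullet> (fund_tensor F x y *v w)" for v w
  have pd: "pos_def (fund_tensor F x y)" using finsler xy by (auto simp: finsler_metric_def)
  have gpos: "g v v > 0" if "v \<noteq> 0" for v using pd that by (auto simp: pos_def_def g_def)
  have gsym: "g v w = g w v" for v w
    using dd_commute[OF open_Z smE xy(1), of "(0, v)" "(0, w)"] by (simp add: g_def fund_tensor_inner[OF xy(1)])
  have gyy: "g y y = (Fu z)\<^sup>2"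
  proof -
    have "dd (\<lambda>z. dd E (0, snd z) z) (0, y) z = dd (\<lambda>z. 2 * E z) (0, y) z"
      by (rule dd_eq_Z[OF zZ smooth_euler[OF smE] Eu_E])
    also have "\<dots> = 2 * dd E (0, y) z"
      by (simp add: dd_rules smE smooth_on_const zZ dd_const)
    finally have "dd (dd E (0, y)) (0, y) z = dd E (0, y) z"
      using dd_euler[OF smE zZ, of "(0, y)"] by (simp add: z)
    then show ?thesis
      using fund_tensor_inner[OF xy(1), of y y] Eu_E[OF zZ] by (simp add: g_def z E_def)
  qed
  obtain u where u: "u \<noteq> 0" "(fund_tensor F x y *v y) \<bullet> u = 0"
    using orthogonal_to_vector_exists[of "fund_tensor F x y *v y"] dim by (auto simp: orthogonal_def)
  then have guy: "g u y = 0" by (simp add: g_def inner_commute)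
  have usp: "u \<notin> span {y}"
  proof
    assume "u \<in> span {y}"
    then obtain k where "u = k *\<^sub>R y" by (auto simp: span_singleton)
    then show False using guy gpos[OF xy(3)] u(1) by (auto simp: g_def)
  qed
  obtain k where k: "riemann_curv F x y *v u = ((P z)\<^sup>2 - dd P (y, 0) z) *\<^sub>R u + k *\<^sub>R y"
    using riemann_curv_structure[OF xy(1), of u] z by auto
  have "g (riemann_curv F x y *v u) u = ((P z)\<^sup>2 - dd P (y, 0) z) * g u u"
    using guy gsym[of y u] unfolding k g_def by (simp add: inner_add_left)
  then have "flag_curv F x y u = (((P z)\<^sup>2 - dd P (y, 0) z) * g u u) / (g y y * g u u)"
    using guy gsym[of y u] by (simp add: flag_curv_def Let_def g_def)
  also have "\<dots> = ((P z)\<^sup>2 - dd P (y, 0) z) / (Fu z)\<^sup>2"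
    using gpos[OF u(1)] by (simp add: gyy)
  finally have "((P z)\<^sup>2 - dd P (y, 0) z) / (Fu z)\<^sup>2 = 3 * (\<theta> x \<bullet> y) / Fu z + \<sigma> x"
    using weak xy usp by (simp add: weakly_isotropic_flag_curv_def Fu_F z)
  moreover have "Fu z > 0" by (rule Fu_pos[OF zZ])
  moreover have "c = 3 * t * f + s * f\<^sup>2" if "c / f\<^sup>2 = 3 * t / f + s" "f > 0" for c t f s :: real
  proof -
    have "c = (c / f\<^sup>2) * f\<^sup>2" using that(2) by simp
    also have "\<dots> = 3 * t * f + s * f\<^sup>2"
      unfolding that(1) using that(2) by (simp add: distrib_right power2_eq_square)
    finally show ?thesis .
  qed
  ultimately have "(P z)\<^sup>2 - dd P (y, 0) z = 3 * (\<theta> x \<bullet> y) * Fu z + \<sigma> x * (Fu z)\<^sup>2"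
    by blast
  then show ?thesis unfolding z fst_conv snd_conv by linarith
qed

end

section \<open>The Randers representation\<close>

theorem theorem1p3:
  fixes U :: "(real^'n) set"
    and F :: "real^'n \<Rightarrow> real^'n \<Rightarrow> real"
    and \<theta> :: "real^'n \<Rightarrow> real^'n"
    and \<sigma> :: "real^'n \<Rightarrow> real"
  assumes "CARD('n) \<ge> 2"
    and "open U" and "connected U"
    and "finsler_metric U F"
    and "projectively_flat U F"
    and "smooth_on U \<theta>" and "smooth_on U \<sigma>"
    and "\<exists>x\<in>U. \<theta> x \<noteq> 0"
    and "weakly_isotropic_flag_curv U F \<theta> \<sigma>"
  shows "randers_metric U F"
proof -
  interpret projectively_flat_space U F
    by unfold_locales (use assms in auto)
  interpret R: finsler_pair U Fu P \<theta> \<sigma>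
  proof
    show "dd Fu (v, 0) z = dd P (0, v) z * Fu z + P z * dd Fu (0, v) z" if "z \<in> Z" for z v
      by (rule hamel[OF that])
    show "dd P (snd z, 0) z = (P z)\<^sup>2 - 3 * (\<theta> (fst z) \<bullet> snd z) * Fu z - \<sigma> (fst z) * (Fu z)\<^sup>2" if "z \<in> Z" for z
      by (rule horP[OF assms(1,9) that])
    show "Fu (x, 0) = 0" for x by (simp add: Fu_def)
    show "Fu z \<noteq> 0" if "z \<in> Z" for z using Fu_pos[OF that] by simp
  qed (use assms(1,6,7) smFu smP Eu_P Eu_Fu Fu_pos Fu_hom in auto)
  have V: "R.V \<noteq> {}" using assms(8) by auto
  define w where "w z = (R.r z)\<^sup>2 / 4 - R.q z" for z
  have w_F: "w (x, y) = ((Fu (x, y) + Fu (x, - y)) / 2)\<^sup>2" for x y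
    by (simp add: w_def R.r_def R.q_def R.FN_def power2_eq_square field_simps)
  define W where "W x y y' = (w (x, y + y') - w (x, y) - w (x, y')) / 2" for x y y'
  have W_sym: "W x y y' = W x y' y" for x y y' by (simp add: W_def add.commute)
  have W_lin: "linear (W x y)" if x: "x \<in> U" for x y
  proof -
    note lr = R.fibre_structure(1)[OF assms(3) V x] and lq = R.fibre_structure(2)[OF assms(3) V x, of y]
    have "W x y y' = (R.r (x, y) / 4) *\<^sub>R R.r (x, y') - (1/2) *\<^sub>R (R.q (x, y + y') - R.q (x, y) - R.q (x, y'))" for y'
      unfolding W_def w_def linear_add[OF lr] power2_sum real_scaleR_def by (simp add: diff_divide_distrib add_divide_distrib)
    then have eq: "W x y = (\<lambda>y'. (R.r (x, y) / 4) *\<^sub>R R.r (x, y') - (1/2) *\<^sub>R (R.q (x, y + y') - R.q (x, y) - R.q (x, y')))"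
      by (rule ext)
    show ?thesis
      unfolding eq by (intro linear_compose_sub linear_compose_scale_right lr lq)
  qed
  have W_diag: "W x y y = w (x, y)" if x: "x \<in> U" for x y
  proof -
    have "w (x, y + y) = 4 * w (x, y)"
      using R.r_scale[OF x, of 2 y] R.q_scale[OF x, of 2 y] by (simp add: w_def scaleR_2 power2_eq_square)
    then show ?thesis by (simp add: W_def)
  qed
  define a where "a x = (\<chi> i j. W x (axis i 1) (axis j 1))" for x
  define b where "b x = (\<chi> i. R.r (x, axis i 1) / 2)" for x
  have smw: "smooth_on Z w"
    unfolding w_def[abs_def] by (intro smooth_on_divide[OF open_Z] smooth_Z R.sm_r R.sm_q) auto
  have ax_sum: "axis i 1 + axis j 1 \<noteq> (0 :: real^'n)" for i j
  proof
    assume "axis i 1 + axis j 1 = (0 :: real^'n)"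
    then have "(axis i 1 + axis j 1 :: real^'n) $ i = 0" by simp
    then show False by (auto simp: axis_def split: if_splits)
  qed
  have "smooth_on U a"
    unfolding a_def W_def
    by (intro smooth_on_vec smooth_on_divide smooth_on_diff smooth_on_const smooth_section smw assms(2) ax_sum) auto
  moreover have "smooth_on U b"
    unfolding b_def by (intro smooth_on_vec smooth_on_divide smooth_on_const smooth_section R.sm_r assms(2)) auto
  moreover have "pos_def (a x) \<and> sqrt (b x \<bullet> (matrix_inv (a x) *v b x)) < 1 \<and>
      (\<forall>y. F x y = sqrt (y \<bullet> (a x *v y)) + b x \<bullet> y)" if x: "x \<in> U" for x
  proof -
    have a_apply: "a x *v v = (\<chi> i. W x (axis i 1) v)" for v
      by (simp add: a_def matrix_vector_mult_def linear_sum_axis[OF W_lin[OF x]])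
    have a_inner: "v \<bullet> (a x *v v) = w (x, v)" for v
    proof -
      have "v \<bullet> (a x *v v) = (\<Sum>i\<in>UNIV. W x v (axis i 1) * v $ i)"
        by (simp add: a_apply inner_vec_def W_sym[of x v] mult.commute)
      then show ?thesis by (simp add: linear_sum_axis[OF W_lin[OF x]] W_diag[OF x])
    qed
    have b_inner: "b x \<bullet> y = R.r (x, y) / 2" for y
    proof -
      have "b x \<bullet> y = (\<Sum>i\<in>UNIV. R.r (x, axis i 1) * y $ i) / 2"
        by (simp add: b_def inner_vec_def sum_divide_distrib)
      then show ?thesis by (simp add: linear_sum_axis[OF R.fibre_structure(1)[OF assms(3) V x]])
    qed
    have Fpos: "Fu (x, v) > 0" if "v \<noteq> 0" for v using Fu_pos[of "(x, v)"] x that by simp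
    have Fnn: "Fu (x, v) \<ge> 0" for v using Fpos[of v] by (cases "v = 0") (auto simp: Fu_def)
    have sq: "sqrt (w (x, v)) = (Fu (x, v) + Fu (x, - v)) / 2" for v
      unfolding w_F using Fnn[of v] Fnn[of "- v"] by simp
    have rep: "Fu (x, y) = sqrt (y \<bullet> (a x *v y)) + b x \<bullet> y" for y
      by (simp add: a_inner b_inner sq R.r_def R.FN_def field_simps)
    have wpos: "w (x, v) > 0" if "v \<noteq> 0" for v
      unfolding w_F using Fpos[OF that] Fpos[of "- v"] that by simp
    have pd: "pos_def (a x)"
      unfolding pos_def_def
    proof (intro conjI allI impI)
      show "transpose (a x) = a x"
        by (simp add: transpose_def a_def vec_eq_iff) (metis W_sym)
      show "v \<bullet> (a x *v v) > 0" if "v \<noteq> 0" for v using wpos[OF that] by (simp add: a_inner)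
    qed
    have "invertible (a x)"
    proof -
      have "v = 0" if "a x *v v = 0" for v
        using pd that unfolding pos_def_def by (metis inner_zero_right less_irrefl)
      then show ?thesis by (simp add: invertible_left_inverse matrix_left_invertible_ker)
    qed
    then have inv: "a x *v (matrix_inv (a x) *v b x) = b x"
      by (simp add: matrix_vector_mul_assoc matrix_inv_right)
    define v where "v = matrix_inv (a x) *v b x"
    have "sqrt (b x \<bullet> v) < 1"
    proof (cases "v = 0")
      case False
      have bv: "v \<bullet> (a x *v v) = b x \<bullet> v" using inv by (simp add: v_def inner_commute)
      have m: "b x \<bullet> v > 0" using wpos[OF False] a_inner[of v] bv by simp
      have "(- v) \<bullet> (a x *v (- v)) = b x \<bullet> v"
        using bv by (simp add: linear_neg[OF matrix_vector_mul_linear])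
      then have lt: "sqrt (b x \<bullet> v) > b x \<bullet> v"
        using rep[of "- v"] Fpos[of "- v"] False by simp
      show ?thesis
      proof (rule ccontr)
        assume "\<not> ?thesis"
        then have "1 * sqrt (b x \<bullet> v) \<le> sqrt (b x \<bullet> v) * sqrt (b x \<bullet> v)"
          using m by (intro mult_right_mono) auto
        then show False using lt m by simp
      qed
    qed simp
    then show ?thesis using pd rep Fu_F[OF x] by (simp add: v_def)
  qed
  ultimately show ?thesis
    unfolding randers_metric_def using assms(4) by blast
qed

end
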